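(* Let $G$ be a finite simple bipartite graph on $N\ge 9$ vertices. Then $$\operatorname{R}(G)\le\left\lceil N/4\right\rceil .$$
   Context: Let $G$ be a finite simple graph (not necessarily connected; isolated vertices are allowed). Two distinct letters $a,b$ alternate in a word $w$ if, after deleting from $w$ all letters other than $a$ and $b$, the resulting word contains neither $aa$ nor $bb$ as consecutive letters. For a positive integer $k$, a word $w$ over the alphabet $V(G)$ is a $k$-uniform representation of $G$ if every vertex occurs exactly $k$ times in $w$ and, for all distinct vertices $a,b$, the letters $a,b$ alternate in $w$ if and only if $a$ and $b$ are adjacent in $G$; $G$ is $k$-representable if such a word exists. The representation number $\operatorname{R}(G)$ is the least positive integer $k$ for which $G$ is $k$-representable (every bipartite graph is $k$-representable for some $k$). *)

theory Defs
  imports Complex_Main "Graph_Theory.Pair_Digraph"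
begin

text \<open>
  A finite simple graph is a \<^locale>\<open>pair_graph\<close>: a finite vertex set \<^term>\<open>pverts G\<close> together with
  a symmetric irreflexive set \<^term>\<open>parcs G\<close> of ordered pairs of vertices, so each undirected
  edge is present in both orientations.
\<close>

definition bipartite :: "'a pair_pre_digraph \<Rightarrow> bool" where
  "bipartite G \<longleftrightarrow> (\<exists>A B. pverts G = A \<union> B \<and> A \<inter> B = {} \<and>
     (\<forall>(u, v) \<in> parcs G. (u \<in> A \<and> v \<in> B) \<or> (u \<in> B \<and> v \<in> A)))"

definition alternate :: "'a list \<Rightarrow> 'a \<Rightarrow> 'a \<Rightarrow> bool" where
  "alternate w a b \<longleftrightarrow> distinct_adj (filter (\<lambda>x. x = a \<or> x = b) w)"

definition uniform_representation :: "'a pair_pre_digraph \<Rightarrow> nat \<Rightarrow> 'a list \<Rightarrow> bool" where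
  "uniform_representation G k w \<longleftrightarrow>
     set w \<subseteq> pverts G \<and>
     (\<forall>v \<in> pverts G. count_list w v = k) \<and>
     (\<forall>a \<in> pverts G. \<forall>b \<in> pverts G. a \<noteq> b \<longrightarrow> (alternate w a b \<longleftrightarrow> (a, b) \<in> parcs G))"

definition representable :: "nat \<Rightarrow> 'a pair_pre_digraph \<Rightarrow> bool" where
  "representable k G \<longleftrightarrow> k > 0 \<and> (\<exists>w. uniform_representation G k w)"

text \<open>The value is unspecified if \<open>G\<close> is not representable for any \<open>k\<close>.\<close>

definition representation_number :: "'a pair_pre_digraph \<Rightarrow> nat" where
  "representation_number G = (LEAST k. representable k G)"

end

theory Submission
  imports Defs "HOL-Library.Product_Lexorder"
begin

text \<open>
  Let \<open>N\<close> be the nonadjacency relation between the two sides \<open>P\<close> and \<open>Q\<close>. The word consists of \<open>k\<close>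
  consecutive zones, each containing one copy of every \<open>b \<in> Q\<close> near its centre, and one copy of every
  \<open>a \<in> P\<close> lies between any two consecutive centres. Undisturbed, all \<open>a\<close> and \<open>b\<close> alternate; displacing a
  copy of \<open>b\<close> over a copy of \<open>a\<close> destroys this. If \<open>P\<close> consists of \<open>k\<close> pairs, one per zone, then in zone
  \<open>i\<close> the copy of \<open>b\<close> can jump over the first member of the pair (to the left), over the second one (to
  the right) or over both (in either direction). Two letters of \<open>Q\<close> fail to alternate unless one
  displacement vector is strictly below the other in every zone, so the pairing and the free
  directions have to be chosen such that this does not happen.

  A side with fewer than \<open>2 * k\<close> points is padded by points without nonneighbours, so let
  \<open>card P = 2 * k\<close> and \<open>card Q = 2 * k\<close>. If some \<open>a\<close> is dominated by some \<open>a'\<close>, i.e.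
  \<open>N a b\<close> implies \<open>N a' b\<close>, these two form the last pair, whose zone separates all letters except for
  chains through a \<open>b\<close> with \<open>N a' b\<close>; counting subsets yields a pairing of the other points without
  such chains. A point with exactly two nonneighbours is treated similarly. Otherwise all
  neighbourhoods in \<open>N\<close>, up to isolated edges, have at least three elements, and since a hypergraph
  with \<open>v\<close> vertices and \<open>m\<close> edges of size at least three has a hitting set of size at most
  \<open>(v + m) / 4\<close>, some \<open>k\<close>-set hits them all; it provides the second members of the pairs. For \<open>k = 3\<close>
  the counting bounds fail and the small degrees need a finer choice of the pairs.
\<close>

text \<open>The constant 4 comes from the geometry of a zone. A letter leaving the centre meets the
  points on its left, or on its right, in a fixed order, so it can jump only over initial segments
  of these two orders. For two points placed in opposite orders on the two sides all four subsets
  occur; for three points at most six of the eight would. Hence \<open>k\<close> zones serve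
  \<open>2 * k\<close> points, however many letters \<open>Q\<close> has, and of two sides with
  together at most \<open>4 * k\<close> vertices one is small enough. The obstacle is alternation
  inside \<open>Q\<close>. The empty set and the singletons fix the displacement; only a jump over
  both members of a pair can go either way, and this is the whole freedom available against strict
  chains of displacement vectors. A dominated point is valuable because its pair needs only three
  subsets: none, the dominating point, both. The dominating point can then be nearest on both sides,
  and every letter that jumps over it has a free direction. Nine vertices guarantee a third zone, on
  which the ordering of the points in the gaps relies.\<close>

section \<open>Words described by sort keys\<close>

lemma distinct_adj_map_sorted_iff:
  fixes xs :: "'k::linorder list"
  assumes "sorted_wrt (<) xs"
  shows "distinct_adj (map g xs) \<longleftrightarrow>
    (\<forall>p\<in>set xs. \<forall>q\<in>set xs. p < q \<and> g p = g q \<longrightarrow> (\<exists>r\<in>set xs. p < r \<and> r < q \<and> g r \<noteq> g p))"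
    (is "?L \<longleftrightarrow> ?R")
proof
  assume L: ?L
  show ?R
  proof (intro ballI impI)
    fix p q assume "p \<in> set xs" "q \<in> set xs" and pq: "p < q \<and> g p = g q"
    then obtain i j where ij: "i < length xs" "xs ! i = p" "j < length xs" "xs ! j = q"
      by (metis in_set_conv_nth)
    have mono: "\<And>a b. a < b \<Longrightarrow> b < length xs \<Longrightarrow> xs ! a < xs ! b"
      using assms by (auto intro: sorted_wrt_nth_less)
    have "i < j"
    proof (rule ccontr)
      assume "\<not> i < j"
      then have "j = i \<or> j < i" by auto
      then show False using mono[of j i] ij pq by auto
    qed
    have adj: "g (xs ! i) \<noteq> g (xs ! Suc i)"
      using L ij \<open>i < j\<close> by (auto simp: distinct_adj_conv_nth)
    have "Suc i \<noteq> j" using adj ij pq by auto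
    then have "Suc i < j" using \<open>i < j\<close> by simp
    then have "xs ! i < xs ! Suc i" "xs ! Suc i < xs ! j"
      using mono[of i "Suc i"] mono[of "Suc i" j] ij by simp_all
    then show "\<exists>r\<in>set xs. p < r \<and> r < q \<and> g r \<noteq> g p"
      using ij adj \<open>Suc i < j\<close> by (intro bexI[of _ "xs ! Suc i"]) auto
  qed
next
  assume R: ?R
  show ?L unfolding distinct_adj_conv_nth
  proof (intro allI impI)
    fix i assume "Suc i < length (map g xs)"
    then have i: "Suc i < length xs" by simp
    show "map g xs ! i \<noteq> map g xs ! Suc i"
    proof
      assume eq: "map g xs ! i = map g xs ! Suc i"
      have lt: "xs ! i < xs ! Suc i" using assms i by (auto intro: sorted_wrt_nth_less)
      have "\<exists>r\<in>set xs. xs ! i < r \<and> r < xs ! Suc i"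
        using R[rule_format, of "xs ! i" "xs ! Suc i"] i eq lt by auto
      then obtain m where m: "m < length xs" "xs ! i < xs ! m" "xs ! m < xs ! Suc i"
        by (metis in_set_conv_nth)
      have sorted: "\<And>a b. a < b \<Longrightarrow> b < length xs \<Longrightarrow> xs ! a < xs ! b"
        using assms by (auto intro: sorted_wrt_nth_less)
      have "i < m"
      proof (rule ccontr)
        assume "\<not> i < m"
        then have "m = i \<or> m < i" by auto
        then show False using sorted[of m i] m i by fastforce
      qed
      moreover have "m < Suc i"
      proof (rule ccontr)
        assume "\<not> m < Suc i"
        then have "m = Suc i \<or> Suc i < m" by auto
        then show False using sorted[of "Suc i" m] m i by fastforce
      qed
      ultimately show False by simp
    qed
  qed
qed

text \<open>Each occurrence of a letter gets a position in a linear order, so alternation is decided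
  by comparing keys and the list itself never has to be computed.\<close>

definition word_of_keys :: "('e \<Rightarrow> 'k::linorder) \<Rightarrow> ('e \<Rightarrow> 'v) \<Rightarrow> 'e set \<Rightarrow> 'v list" where
  "word_of_keys key lab E = map (lab \<circ> inv_into E key) (sorted_list_of_set (key ` E))"

lemma
  assumes "finite E" "inj_on key E"
  shows set_word_of_keys: "set (word_of_keys key lab E) = lab ` E"
    and count_word_of_keys: "count_list (word_of_keys key lab E) v = card {e\<in>E. lab e = v}"
proof -
  show "set (word_of_keys key lab E) = lab ` E"
    using assms by (force simp: word_of_keys_def image_iff)
  have "count_list (word_of_keys key lab E) v =
      length (filter (\<lambda>p. lab (inv_into E key p) = v) (sorted_list_of_set (key ` E)))"
    by (simp add: word_of_keys_def count_list_eq_length_filter filter_map o_def eq_commute)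
  also have "\<dots> = card (set (filter (\<lambda>p. lab (inv_into E key p) = v) (sorted_list_of_set (key ` E))))"
    by (intro distinct_card[symmetric] distinct_filter) simp
  also have "set (filter (\<lambda>p. lab (inv_into E key p) = v) (sorted_list_of_set (key ` E))) = key ` {e\<in>E. lab e = v}"
    using assms by auto
  also have "card \<dots> = card {e\<in>E. lab e = v}"
    using assms by (intro card_image) (auto intro: inj_on_subset)
  finally show "count_list (word_of_keys key lab E) v = card {e\<in>E. lab e = v}" .
qed

lemma alternate_word_of_keys:
  fixes lab :: "'e \<Rightarrow> 'v" and key :: "'e \<Rightarrow> 'k::linorder"
  assumes "finite E" "inj_on key E"
  defines "S \<equiv> \<lambda>u v. {e\<in>E. lab e \<in> {u, v}}"
  shows "alternate (word_of_keys key lab E) u v \<longleftrightarrow>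
    (\<forall>e\<in>S u v. \<forall>e'\<in>S u v. key e < key e' \<and> lab e = lab e' \<longrightarrow>
      (\<exists>m\<in>S u v. key e < key m \<and> key m < key e' \<and> lab m \<noteq> lab e))"
proof -
  define g where "g = lab \<circ> inv_into E key"
  define xs where "xs = filter (\<lambda>p. g p = u \<or> g p = v) (sorted_list_of_set (key ` E))"
  have "sorted_wrt (<) xs"
    unfolding xs_def by (intro sorted_wrt_filter) simp
  moreover have "filter (\<lambda>x. x = u \<or> x = v) (word_of_keys key lab E) = map g xs"
    by (simp add: word_of_keys_def xs_def g_def filter_map o_def)
  ultimately have "alternate (word_of_keys key lab E) u v \<longleftrightarrow>
    (\<forall>p\<in>set xs. \<forall>q\<in>set xs. p < q \<and> g p = g q \<longrightarrow> (\<exists>r\<in>set xs. p < r \<and> r < q \<and> g r \<noteq> g p))"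
    by (simp add: alternate_def distinct_adj_map_sorted_iff)
  also have "set xs = key ` S u v"
    using assms by (auto simp: xs_def g_def)
  finally show ?thesis using assms by (simp add: g_def)
qed

lemma alternate_commute: "alternate w a b \<longleftrightarrow> alternate w b a"
  by (simp add: alternate_def disj_commute)

text \<open>\<open>N\<close> is nonadjacency. The sum type keeps the sides apart and lets them have
  different types, so that index pairs and padding elements can serve as points.\<close>

definition rep :: "nat \<Rightarrow> 'p set \<Rightarrow> 'q set \<Rightarrow> ('p \<Rightarrow> 'q \<Rightarrow> bool) \<Rightarrow> bool" where
  "rep k P Q N \<longleftrightarrow> (\<exists>w :: ('p + 'q) list.
     set w \<subseteq> P <+> Q \<and> (\<forall>v \<in> P <+> Q. count_list w v = k) \<and>
     (\<forall>a\<in>P. \<forall>b\<in>Q. alternate w (Inl a) (Inr b) \<longleftrightarrow> \<not> N a b) \<and>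
     (\<forall>a\<in>P. \<forall>a'\<in>P. a \<noteq> a' \<longrightarrow> \<not> alternate w (Inl a) (Inl a')) \<and>
     (\<forall>b\<in>Q. \<forall>b'\<in>Q. b \<noteq> b' \<longrightarrow> \<not> alternate w (Inr b) (Inr b')))"

section \<open>Correctness of the zone construction\<close>

text \<open>Localises a change of relative position to two consecutive zones or gaps, where it
  produces an immediate repetition of a letter.\<close>

lemma nonconstant_step:
  fixes n :: nat and p :: "nat \<Rightarrow> bool"
  assumes "i < n" "p i" "j < n" "\<not> p j"
  shows "\<exists>i. Suc i < n \<and> p i \<noteq> p (Suc i)"
proof (rule ccontr)
  assume "\<not> ?thesis"
  then have "p m = p 0" if "m < n" for m using that by (induction m) auto
  then show False using assms by blast
qed

text \<open>
  Zone \<open>i\<close> contains a copy of \<open>a\<close> at distance \<open>l i a\<close> to the left, or \<open>r i a\<close> to the right, of its centre,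
  where \<open>0\<close> means that there is no such copy. The letter \<open>b\<close> occurs in zone \<open>i\<close> at displacement \<open>d b i\<close>.
  By \<open>split\<close>, every \<open>a\<close> occurs exactly once between consecutive centres (cyclically). The injection
  \<open>f\<close> only breaks the remaining ties: reversing it in zone \<open>0\<close> keeps letters with equal displacements from alternating.
\<close>

locale zone_scheme =
  fixes k :: nat and P :: "'p set" and Q :: "'q set" and N :: "'p \<Rightarrow> 'q \<Rightarrow> bool"
    and l r :: "nat \<Rightarrow> 'p \<Rightarrow> nat" and d :: "'q \<Rightarrow> nat \<Rightarrow> int" and f :: "'q \<Rightarrow> int"
  assumes k: "2 \<le> k" and fin: "finite P" "finite Q" and f: "inj_on f Q"
    and split: "\<And>i a. i < k \<Longrightarrow> a \<in> P \<Longrightarrow> 0 < r i a \<longleftrightarrow> l (Suc i mod k) a = 0"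
    and l_inj: "\<And>i a a'. i < k \<Longrightarrow> a \<in> P \<Longrightarrow> a' \<in> P \<Longrightarrow> l i a = l i a' \<Longrightarrow> 0 < l i a \<Longrightarrow> a = a'"
    and r_inj: "\<And>i a a'. i < k \<Longrightarrow> a \<in> P \<Longrightarrow> a' \<in> P \<Longrightarrow> r i a = r i a' \<Longrightarrow> 0 < r i a \<Longrightarrow> a = a'"
    and N: "\<And>a b. a \<in> P \<Longrightarrow> b \<in> Q \<Longrightarrow> N a b \<longleftrightarrow>
      (\<exists>i<k. 0 < l i a \<and> int (l i a) \<le> - d b i \<or> 0 < r i a \<and> int (r i a) \<le> d b i)"
    and uncut: "\<And>a b. a \<in> P \<Longrightarrow> b \<in> Q \<Longrightarrow>
      (\<exists>i<k. \<not> (0 < l i a \<and> int (l i a) \<le> - d b i \<or> 0 < r i a \<and> int (r i a) \<le> d b i))"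
    and order: "\<And>a a'. a \<in> P \<Longrightarrow> a' \<in> P \<Longrightarrow> a \<noteq> a' \<Longrightarrow>
      (\<exists>i<k. 0 < r i a \<and> (r i a' = 0 \<or> r i a < r i a') \<or>
             r i a = 0 \<and> r i a' = 0 \<and> l (Suc i mod k) a' < l (Suc i mod k) a)"
    and incomp: "\<And>b b'. b \<in> Q \<Longrightarrow> b' \<in> Q \<Longrightarrow> \<exists>i<k. d b' i \<le> d b i"
begin

text \<open>Doubling the displacements puts letters of \<open>Q\<close> at even and points at odd
  positions. Copy \<open>i\<close> of a point lies in the gap after centre \<open>i\<close>; in the
  last gap it may wrap around to the start of the word. Among letters with equal displacement the
  one with the larger total displacement comes first, so being weakly smaller everywhere is not
  enough to be earlier everywhere.\<close>

fun key :: "('p + 'q) \<times> nat \<Rightarrow> nat \<times> int \<times> int \<times> int" where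
  "key (Inl a, i) = (if 0 < r i a then (i, 2 * int (r i a) - 1, 0, 0)
     else (Suc i mod k, 1 - 2 * int (l (Suc i mod k) a), 0, 0))"
| "key (Inr b, i) = (i, 2 * d b i, - (\<Sum>j<k. d b j), if i = 0 then f b else - f b)"

definition E :: "(('p + 'q) \<times> nat) set" where "E = (P <+> Q) \<times> {..<k}"

abbreviation w :: "('p + 'q) list" where "w \<equiv> word_of_keys key fst E"

definition cut :: "'q \<Rightarrow> nat \<Rightarrow> 'p \<Rightarrow> bool" where
  "cut b i a \<longleftrightarrow> 0 < l i a \<and> int (l i a) \<le> - d b i \<or> 0 < r i a \<and> int (r i a) \<le> d b i"

lemma finite_E: "finite E" using fin by (simp add: E_def)

lemma succ_mod_cases: "i < k \<Longrightarrow> Suc i mod k = Suc i \<and> Suc i < k \<or> i = k - 1 \<and> Suc i mod k = 0"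
proof (cases "Suc i < k")
  case False
  moreover assume "i < k"
  ultimately have "Suc i = k" by simp
  then show ?thesis by auto
qed simp

lemma succ_mod_inj: "i < k \<Longrightarrow> j < k \<Longrightarrow> Suc i mod k = Suc j mod k \<Longrightarrow> i = j"
  using succ_mod_cases[of i] succ_mod_cases[of j] by auto

lemma succ_mod_less: "Suc i mod k < k" using k by simp

lemma inj_key: "inj_on key E"
proof (rule inj_onI)
  fix e e' assume e: "e \<in> E" "e' \<in> E" and eq: "key e = key e'"
  obtain u i u' i' where uu: "e = (u, i)" "e' = (u', i')" by (cases e, cases e')
  have ik: "i < k" "i' < k" using e uu by (auto simp: E_def)
  have odd_even: "2 * x - 1 \<noteq> 2 * y" "1 - 2 * x \<noteq> 2 * y" for x y :: int by presburger+
  have pos: "0 < l (Suc j mod k) a" if "j < k" "a \<in> P" "\<not> 0 < r j a" for j a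
    using split[OF that(1,2)] that(3) by simp
  show "e = e'"
  proof (cases u; cases u')
    fix a a' assume c: "u = Inl a" "u' = Inl a'"
    have a: "a \<in> P" "a' \<in> P" using e uu c by (auto simp: E_def)
    show ?thesis
    proof (cases "0 < r i a"; cases "0 < r i' a'")
      assume "0 < r i a" "0 < r i' a'"
      then show ?thesis using eq uu c a ik r_inj[of i a a'] by auto
    next
      assume r: "\<not> 0 < r i a" "\<not> 0 < r i' a'"
      then show ?thesis
        using eq uu c a ik succ_mod_inj[of i i'] l_inj[OF succ_mod_less, of a a' i] pos[OF ik(1) a(1)] by auto
    next
      assume r: "0 < r i a" "\<not> 0 < r i' a'"
      then show ?thesis using eq uu c pos[OF ik(2) a(2)] by auto
    next
      assume r: "\<not> 0 < r i a" "0 < r i' a'"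
      then show ?thesis using eq uu c pos[OF ik(1) a(1)] by auto
    qed
  next
    fix b b' assume c: "u = Inr b" "u' = Inr b'"
    then show ?thesis using eq uu e f by (auto simp: E_def inj_on_def split: if_splits)
  qed (use eq uu odd_even in \<open>auto split: if_splits dest: sym\<close>)
qed

lemma card_copies: "v \<in> P <+> Q \<Longrightarrow> card {e\<in>E. fst e = v} = k"
proof -
  assume "v \<in> P <+> Q"
  then have "{e\<in>E. fst e = v} = {v} \<times> {..<k}" by (auto simp: E_def)
  then show ?thesis by simp
qed

lemma count_w: "v \<in> P <+> Q \<Longrightarrow> count_list w v = k"
  by (simp only: count_word_of_keys[OF finite_E inj_key] card_copies)

lemma set_w: "set w \<subseteq> P <+> Q"
  unfolding set_word_of_keys[OF finite_E inj_key] by (auto simp: E_def)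

lemma alternate_w:
  assumes "u \<in> P <+> Q" "v \<in> P <+> Q" "u \<noteq> v"
  shows "alternate w u v \<longleftrightarrow>
    (\<forall>i<k. \<forall>j<k. key (u, i) < key (u, j) \<longrightarrow> (\<exists>m<k. key (u, i) < key (v, m) \<and> key (v, m) < key (u, j))) \<and>
    (\<forall>i<k. \<forall>j<k. key (v, i) < key (v, j) \<longrightarrow> (\<exists>m<k. key (v, i) < key (u, m) \<and> key (u, m) < key (v, j)))"
proof -
  have S: "{e\<in>E. fst e \<in> {u, v}} = {u} \<times> {..<k} \<union> {v} \<times> {..<k}"
    using assms by (auto simp: E_def)
  have ball: "(\<forall>e\<in>{x} \<times> {..<k}. F e) \<longleftrightarrow> (\<forall>i<k. F (x, i))"
    and bex: "(\<exists>e\<in>{x} \<times> {..<k}. F e) \<longleftrightarrow> (\<exists>i<k. F (x, i))" for x :: "'p + 'q" and F :: "('p + 'q) \<times> nat \<Rightarrow> bool"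
    by auto
  have vu: "v \<noteq> u" using assms(3) by simp
  show ?thesis
    unfolding alternate_word_of_keys[OF finite_E inj_key] S ball_Un bex_Un ball bex fst_conv
    by (simp only: assms(3) vu simp_thms)
qed

lemma not_alternateI:
  assumes "u \<in> P <+> Q" "v \<in> P <+> Q" "u \<noteq> v" "i < k" "j < k" "key (u, i) < key (u, j)"
    and "\<And>m. m < k \<Longrightarrow> \<not> (key (u, i) < key (v, m) \<and> key (v, m) < key (u, j))"
  shows "\<not> alternate w u v" "\<not> alternate w v u"
proof -
  have no: "\<not> (\<exists>m<k. key (u, i) < key (v, m) \<and> key (v, m) < key (u, j))" using assms(7) by blast
  show "\<not> alternate w u v"
    unfolding alternate_w[OF assms(1,2,3)] using assms(4-6) no by blast
  show "\<not> alternate w v u"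
    unfolding alternate_w[OF assms(2,1) assms(3)[symmetric]] using assms(4-6) no by blast
qed

lemma point_key_right: "0 < r i a \<Longrightarrow> key (Inl a, i) = (i, 2 * int (r i a) - 1, 0, 0)"
  by simp

lemma point_key_cases:
  assumes "a \<in> P" "i < k"
  obtains z where "z < k" "0 < r z a" "key (Inl a, i) = (z, 2 * int (r z a) - 1, 0, 0)"
    | z where "z < k" "0 < l z a" "key (Inl a, i) = (z, 1 - 2 * int (l z a), 0, 0)"
proof (cases "0 < r i a")
  case True then show ?thesis using assms that by simp
next
  case False
  then have "0 < l (Suc i mod k) a" using split[of i a] assms by simp
  then show ?thesis using that(2)[of "Suc i mod k"] False succ_mod_less by simp
qed

lemma point_key_left_ex:
  assumes "a \<in> P" "z < k" "0 < l z a"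
  shows "\<exists>i<k. key (Inl a, i) = (z, 1 - 2 * int (l z a), 0, 0)"
proof -
  define i where "i = (if z = 0 then k - 1 else z - 1)"
  have "i < k" "Suc i mod k = z" using assms k by (auto simp: i_def)
  then show ?thesis using assms split[of i a] by (intro exI[of _ i]) auto
qed

text \<open>Without jumps each copy of \<open>b\<close> stays on the centre's side of all copies of
  \<open>a\<close> in its zone, and each gap between consecutive centres holds exactly one copy of
  \<open>a\<close>.\<close>

lemma alternate_if_uncut:
  assumes a: "a \<in> P" and b: "b \<in> Q" and nc: "\<And>i. i < k \<Longrightarrow> \<not> cut b i a"
  shows "alternate w (Inl a) (Inr b)"
proof -
  have nl: "1 - 2 * int (l i a) < 2 * d b i" if "i < k" "0 < l i a" for i
    using nc[OF that(1)] that by (auto simp: cut_def)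
  have nr: "2 * d b i < 2 * int (r i a) - 1" if "i < k" "0 < r i a" for i
    using nc[OF that(1)] that by (auto simp: cut_def)
  have "\<exists>m<k. key (Inl a, i) < key (Inr b, m) \<and> key (Inr b, m) < key (Inl a, j)"
    if ij: "i < k" "j < k" and lt: "key (Inl a, i) < key (Inl a, j)" for i j
  proof (rule point_key_cases[OF a ij(1)])
    fix z assume z: "z < k" "0 < l z a" "key (Inl a, i) = (z, 1 - 2 * int (l z a), 0, 0)"
    have "key (Inr b, z) < key (Inl a, j)"
    proof (rule point_key_cases[OF a ij(2)])
      fix z' assume z': "z' < k" "0 < r z' a" "key (Inl a, j) = (z', 2 * int (r z' a) - 1, 0, 0)"
      show ?thesis using lt nr[OF z'(1,2)] unfolding z(3) z'(3) by (cases "z = z'") auto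
    next
      fix z' assume z': "z' < k" "0 < l z' a" "key (Inl a, j) = (z', 1 - 2 * int (l z' a), 0, 0)"
      show ?thesis using lt unfolding z(3) z'(3) by (cases "z = z'") auto
    qed
    moreover have "key (Inl a, i) < key (Inr b, z)"
      using nl[OF z(1,2)] unfolding z(3) by simp
    ultimately show ?thesis using z(1) by (intro exI[of _ z] conjI)
  next
    fix z assume z: "z < k" "0 < r z a" "key (Inl a, i) = (z, 2 * int (r z a) - 1, 0, 0)"
    show ?thesis
    proof (rule point_key_cases[OF a ij(2)])
      fix z' assume z': "z' < k" "0 < r z' a" "key (Inl a, j) = (z', 2 * int (r z' a) - 1, 0, 0)"
      have "z < z'" using lt unfolding z(3) z'(3) by (cases "z = z'") auto
      then show ?thesis using z' nr[OF z'(1,2)] unfolding z(3) z'(3) by (intro exI[of _ z']) simp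
    next
      fix z' assume z': "z' < k" "0 < l z' a" "key (Inl a, j) = (z', 1 - 2 * int (l z' a), 0, 0)"
      have "z < z'" using lt z(2) z'(2) unfolding z(3) z'(3) by (cases "z = z'") auto
      \<comment> \<open>A right copy in zone \<open>z\<close> already fills the gap after it, so a
        left copy cannot follow before the next centre.\<close>
      moreover have "z' \<noteq> Suc z" using split[OF z(1) a] z(2) z'(1,2) by auto
      ultimately have "Suc z < z'" by simp
      then show ?thesis using z'(1) unfolding z(3) z'(3) by (intro exI[of _ "Suc z"]) simp
    qed
  qed
  moreover have "\<exists>m<k. key (Inr b, i) < key (Inl a, m) \<and> key (Inl a, m) < key (Inr b, j)"
    if ij: "i < k" "j < k" and lt: "key (Inr b, i) < key (Inr b, j)" for i j
  proof -
    have "i < j" using lt by (cases "i = j") (auto split: if_splits)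
    show ?thesis
    proof (cases "0 < r i a")
      case True
      then show ?thesis using ij nr[OF ij(1)] \<open>i < j\<close> by (intro exI[of _ i]) simp
    next
      case False
      have "Suc i < k" using ij \<open>i < j\<close> by simp
      moreover from this have "0 < l (Suc i) a" using split[OF ij(1) a] False by simp
      ultimately show ?thesis
        using ij nl[of "Suc i"] \<open>i < j\<close> False by (intro exI[of _ i]) (cases "j = Suc i"; simp)
    qed
  qed
  ultimately show ?thesis using a b by (subst alternate_w) auto
qed

text \<open>By \<open>uncut\<close> there are consecutive zones such that \<open>b\<close> jumps
  over \<open>a\<close> in exactly one of them. Jumping away from the gap between them leaves two
  copies of \<open>a\<close> with no \<open>b\<close> in between; jumping into the gap leaves two
  copies of \<open>b\<close> with no \<open>a\<close> in between. If all zones were cut, the shifts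
  would cancel and the letters could alternate again.\<close>

lemma not_alternate_if_cut:
  assumes a: "a \<in> P" and b: "b \<in> Q" and c: "i0 < k" "cut b i0 a"
  shows "\<not> alternate w (Inl a) (Inr b)"
proof -
  obtain i1 where "i1 < k" "\<not> cut b i1 a" using uncut[OF a b] by (auto simp: cut_def)
  then obtain i where i: "Suc i < k" "cut b i a \<noteq> cut b (Suc i) a"
    using nonconstant_step[of i0 k "\<lambda>i. cut b i a" i1] c by blast
  have ab: "Inl a \<in> P <+> Q" "Inr b \<in> P <+> Q" using a b by auto
  have sp: "0 < r i a \<longleftrightarrow> l (Suc i) a = 0" using split[of i a] i a by simp
  have next_key: "\<exists>m<k. key (Inl a, m) = (if 0 < r i a then (i, 2 * int (r i a) - 1, 0, 0)
      else (Suc i, 1 - 2 * int (l (Suc i) a), 0, 0))"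
    using i sp by (intro exI[of _ i]) auto
  \<comment> \<open>The jump into the gap: the copy of \<open>a\<close> in the gap ends up outside
    the interval between the two copies of \<open>b\<close>.\<close>
  have no_point: ?thesis if no: "0 < r i a \<Longrightarrow> int (r i a) \<le> d b i" "0 < l i a \<Longrightarrow> - d b i < int (l i a)"
    "0 < r (Suc i) a \<Longrightarrow> d b (Suc i) < int (r (Suc i) a)" "0 < l (Suc i) a \<Longrightarrow> int (l (Suc i) a) \<le> - d b (Suc i)"
  proof (rule not_alternateI(2)[OF ab(2,1) _ _ i(1)])
    show "\<not> (key (Inr b, i) < key (Inl a, m) \<and> key (Inl a, m) < key (Inr b, Suc i))" if "m < k" for m
    proof (rule point_key_cases[OF a that])
      fix z assume z: "0 < r z a" "key (Inl a, m) = (z, 2 * int (r z a) - 1, 0, 0)"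
      show ?thesis using no z(1) unfolding z(2) by (cases "z = i"; cases "z = Suc i") auto
    next
      fix z assume z: "0 < l z a" "key (Inl a, m) = (z, 1 - 2 * int (l z a), 0, 0)"
      show ?thesis using no z(1) unfolding z(2) by (cases "z = i"; cases "z = Suc i") auto
    qed
  qed (use i in auto)
  show ?thesis
  proof (cases "cut b i a")
    case True
    then have nc: "\<not> cut b (Suc i) a" using i by simp
    show ?thesis
    proof (cases "0 < l i a \<and> int (l i a) \<le> - d b i")
      case L: True
      obtain m where m: "m < k" "key (Inl a, m) = (i, 1 - 2 * int (l i a), 0, 0)"
        using point_key_left_ex[OF a, of i] i L by auto
      obtain m' where m': "m' < k" "key (Inl a, m') = (if 0 < r i a then (i, 2 * int (r i a) - 1, 0, 0)
        else (Suc i, 1 - 2 * int (l (Suc i) a), 0, 0))" using next_key by blast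
      show ?thesis
      proof (rule not_alternateI(1)[OF ab _ m(1) m'(1)])
        show "key (Inl a, m) < key (Inl a, m')" using L unfolding m(2) m'(2) by auto
        show "\<not> (key (Inl a, m) < key (Inr b, n) \<and> key (Inr b, n) < key (Inl a, m'))" for n
        proof (cases "n = Suc i")
          case True
          then show ?thesis using nc sp unfolding m'(2) by (auto simp: cut_def)
        next
          case False
          then show ?thesis using L unfolding m(2) m'(2) by (cases "n = i") auto
        qed
      qed simp
    next
      case False
      then have "0 < r i a" "int (r i a) \<le> d b i" using True by (auto simp: cut_def)
      then show ?thesis using nc sp by (intro no_point) (auto simp: cut_def)
    qed
  next
    case False
    then have c': "cut b (Suc i) a" using i by simp
    show ?thesis
    proof (cases "0 < l (Suc i) a \<and> int (l (Suc i) a) \<le> - d b (Suc i)")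
      case True
      then show ?thesis using False sp by (intro no_point) (auto simp: cut_def)
    next
      case R: False
      then have R: "0 < r (Suc i) a" "int (r (Suc i) a) \<le> d b (Suc i)" using c' by (auto simp: cut_def)
      obtain m' where m': "m' < k" "key (Inl a, m') = (if 0 < r i a then (i, 2 * int (r i a) - 1, 0, 0)
        else (Suc i, 1 - 2 * int (l (Suc i) a), 0, 0))" using next_key by blast
      show ?thesis
      proof (rule not_alternateI(1)[OF ab _ m'(1) i(1)])
        show "key (Inl a, m') < key (Inl a, Suc i)"
        proof (cases "0 < r i a")
          case False
          then have "0 < l (Suc i) a" using sp by simp
          then show ?thesis using R(1) False unfolding m'(2) point_key_right[OF R(1)] by simp
        next
          case True
          then show ?thesis using R(1) unfolding m'(2) point_key_right[OF R(1)] by simp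
        qed
        show "\<not> (key (Inl a, m') < key (Inr b, m) \<and> key (Inr b, m) < key (Inl a, Suc i))" for m
        proof (cases "m = i")
          case True
          have "0 < r i a \<Longrightarrow> 2 * d b i < 2 * int (r i a) - 1" using \<open>\<not> cut b i a\<close> by (auto simp: cut_def)
          then show ?thesis using True unfolding m'(2) by auto
        next
          case False
          then show ?thesis using R unfolding m'(2) point_key_right[OF R(1)] by (cases "m = Suc i") auto
        qed
      qed simp
    qed
  qed
qed

lemma alternate_iff: "a \<in> P \<Longrightarrow> b \<in> Q \<Longrightarrow> alternate w (Inl a) (Inr b) \<longleftrightarrow> \<not> N a b"
  using alternate_if_uncut[of a b] not_alternate_if_cut[of a b] N[of a b] by (auto simp: cut_def)

text \<open>By \<open>incomp\<close> some zone has a tie in the displacements, which the third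
  component decides for the larger total. So the totals, and with them all displacements, coincide,
  and the last component orders zones \<open>0\<close> and \<open>1\<close> in opposite
  ways.\<close>

lemma not_all_less:
  assumes b: "b \<in> Q" "b' \<in> Q" and less: "\<And>i. i < k \<Longrightarrow> key (Inr b, i) < key (Inr b', i)"
  shows False
proof -
  have le: "d b i \<le> d b' i" if "i < k" for i using less[OF that] by auto
  obtain i where i: "i < k" "d b' i \<le> d b i" using incomp[OF b] by blast
  have "(\<Sum>j<k. d b j) = (\<Sum>j<k. d b' j)"
    using sum_mono[of "{..<k}" "d b" "d b'"] le less[OF i(1)] i by auto
  then have "d b i = d b' i" if "i < k" for i
    using sum_mono_inv[of "d b" "{..<k}" "d b'"] le that by auto
  then have eq: "d b 0 = d b' 0" "d b 1 = d b' 1" using k by auto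
  show False using less[of 0] less[of 1] k eq \<open>(\<Sum>j<k. d b j) = (\<Sum>j<k. d b' j)\<close> by auto
qed

text \<open>The order of the two letters differs between two consecutive zones, and the letter that
  is later in one and earlier in the next repeats.\<close>

lemma not_alternate_right:
  assumes b: "b \<in> Q" "b' \<in> Q" and ne: "b \<noteq> b'"
  shows "\<not> alternate w (Inr b) (Inr b')"
proof -
  have tot: "key (Inr b, i) < key (Inr b', i) \<or> key (Inr b', i) < key (Inr b, i)" if "i < k" for i
  proof -
    have "key (Inr b, i) \<noteq> key (Inr b', i)"
      using inj_key b ne that by (auto simp: inj_on_def E_def simp del: key.simps)
    then show ?thesis by (simp only: linorder_neq_iff)
  qed
  obtain i j where "i < k" "key (Inr b, i) < key (Inr b', i)" "j < k" "\<not> key (Inr b, j) < key (Inr b', j)"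
    using not_all_less[OF b] not_all_less[OF b(2,1)] tot by (metis order_less_asym')
  then obtain i where i: "Suc i < k"
      "(key (Inr b, i) < key (Inr b', i)) \<noteq> (key (Inr b, Suc i) < key (Inr b', Suc i))"
    using nonconstant_step[of i k "\<lambda>i. key (Inr b, i) < key (Inr b', i)" j] by auto
  have zone: "m = i \<or> m = Suc i" if "key (Inr x, i) < key (Inr y, m)" "key (Inr y, m) < key (Inr x, Suc i)" for x y m
    using that by (auto split: if_splits)
  have main: "\<not> alternate w (Inr x) (Inr y)"
    if xy: "x \<in> Q" "y \<in> Q" "x \<noteq> y" "key (Inr x, i) < key (Inr y, i)" "key (Inr y, Suc i) < key (Inr x, Suc i)" for x y
  proof (rule not_alternateI(2)[of "Inr y" "Inr x" i "Suc i"])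
    fix m show "\<not> (key (Inr y, i) < key (Inr x, m) \<and> key (Inr x, m) < key (Inr y, Suc i))"
      using zone[of y x m] xy(4,5) by (metis order_less_asym')
  qed (use xy i in auto)
  show ?thesis
  proof (cases "key (Inr b, i) < key (Inr b', i)")
    case True
    then have "key (Inr b', Suc i) < key (Inr b, Suc i)" using i tot by blast
    then show ?thesis using main[OF b ne True] by simp
  next
    case False
    then have "key (Inr b', i) < key (Inr b, i)" "key (Inr b, Suc i) < key (Inr b', Suc i)"
      using i tot[of i] by auto
    then show ?thesis using main[OF b(2,1) ne[symmetric]] by (simp add: alternate_commute)
  qed
qed

text \<open>The order of two points in gap \<open>i\<close>, read from one centre to the next
  cyclically. For the last gap it need not be the order in the word, since copies in this gap may
  stand at either end of the word.\<close>

definition before :: "nat \<Rightarrow> 'p \<Rightarrow> 'p \<Rightarrow> bool" where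
  "before i a a' \<longleftrightarrow> 0 < r i a \<and> (r i a' = 0 \<or> r i a < r i a') \<or>
     r i a = 0 \<and> r i a' = 0 \<and> l (Suc i mod k) a' < l (Suc i mod k) a"

lemma key_less_if_before: "Suc i < k \<Longrightarrow> before i a a' \<Longrightarrow> key (Inl a, i) < key (Inl a', i)"
  by (auto simp: before_def)

lemma key_less_if_index_less:
  assumes "a \<in> P" "a' \<in> P" "i < j" "Suc j < k" shows "key (Inl a, i) < key (Inl a', j)"
  using assms split[of j a'] split[of i a] by auto

lemma key_last_cases:
  assumes "a \<in> P"
  shows "0 < r (k - 1) a \<and> key (Inl a, k - 1) = (k - 1, 2 * int (r (k - 1) a) - 1, 0, 0) \<or>
    r (k - 1) a = 0 \<and> 0 < l 0 a \<and> key (Inl a, k - 1) = (0, 1 - 2 * int (l 0 a), 0, 0)"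
  using k split[of "k - 1" a] assms by auto

lemma before_or: "a \<in> P \<Longrightarrow> a' \<in> P \<Longrightarrow> a \<noteq> a' \<Longrightarrow> i < k \<Longrightarrow> before i a a' \<or> before i a' a"
  using r_inj[of i a a'] l_inj[of "Suc i mod k" a a'] split[of i a] split[of i a'] succ_mod_less[of i]
  unfolding before_def by (metis linorder_neqE_nat neq0_conv)

lemma before_asym: "before i a a' \<Longrightarrow> \<not> before i a' a"
  by (auto simp: before_def)

lemma key_last_right:
  assumes "a \<in> P" "a' \<in> P" "0 < r (k - 1) a" "Suc i < k"
  shows "key (Inl a', i) < key (Inl a, k - 1)"
  using assms split[of i a'] by (cases "Suc i = k - 1") auto

lemma key_last_left:
  assumes "a \<in> P" "a' \<in> P" "r (k - 1) a = 0" "Suc i < k"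
  shows "key (Inl a, k - 1) < key (Inl a', i)"
  using assms key_last_cases[of a] split[of i a'] by (cases "i = 0") auto

declare key.simps [simp del]

lemma not_alternate_if_before_step:
  assumes a: "a \<in> P" "a' \<in> P" "a \<noteq> a'" and i: "Suc (Suc i) < k"
    and bef: "before i a a'" "before (Suc i) a' a"
  shows "\<not> alternate w (Inl a') (Inl a)"
proof (rule not_alternateI(1)[of _ _ i "Suc i"])
  show "key (Inl a', i) < key (Inl a', Suc i)" using a i by (intro key_less_if_index_less) auto
  show "\<not> (key (Inl a', i) < key (Inl a, m) \<and> key (Inl a, m) < key (Inl a', Suc i))" if "m < k" for m
  proof (cases "m = k - 1")
    case True
    show ?thesis
    proof (cases "0 < r (k - 1) a")
      case R: True
      show ?thesis using key_last_right[OF a(1,2) R, of "Suc i"] True i by (meson order_less_asym')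
    next
      case False
      then show ?thesis using key_last_left[OF a(1,2) _ Suc_lessD[OF i]] True gr0I by (meson order_less_asym')
    qed
  next
    case False
    then have m: "Suc m < k" using that by simp
    consider "m < i" | "m = i" | "m = Suc i" | "Suc i < m" by linarith
    then show ?thesis
    proof cases
      case 1 then show ?thesis using key_less_if_index_less[OF a(1,2) 1 Suc_lessD[OF i]] by (meson order_less_asym')
    next
      case 2 then show ?thesis using key_less_if_before[OF Suc_lessD[OF i] bef(1)] by (meson order_less_asym')
    next
      case 3 then show ?thesis using key_less_if_before[OF i bef(2)] by (meson order_less_asym')
    next
      case 4 then show ?thesis using key_less_if_index_less[OF a(2,1) 4 m] by (meson order_less_asym')
    qed
  qed
qed (use a i in auto)

text \<open>If the last copy of \<open>a\<close> ends the word, then \<open>a'\<close> repeats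
  across the final two gaps. If it has wrapped around to the start, then \<open>a\<close> repeats
  there, since the last copy of \<open>a'\<close> is either still earlier or at the end.\<close>

lemma not_alternate_if_before_last:
  assumes a: "a \<in> P" "a' \<in> P" "a \<noteq> a'" and bef: "\<And>i. Suc i < k \<Longrightarrow> before i a a'"
    and last: "before (k - 1) a' a"
  shows "\<not> alternate w (Inl a') (Inl a)"
proof (cases "0 < r (k - 1) a")
  case True
  then have rr: "0 < r (k - 1) a'" "r (k - 1) a' < r (k - 1) a" using last by (auto simp: before_def)
  have k2: "Suc (k - 2) < k" using k by simp
  show ?thesis
  proof (rule not_alternateI(1)[of _ _ "k - 2" "k - 1"])
    show "key (Inl a', k - 2) < key (Inl a', k - 1)" using key_last_right[OF a(2,2) rr(1) k2] .
    show "\<not> (key (Inl a', k - 2) < key (Inl a, m) \<and> key (Inl a, m) < key (Inl a', k - 1))" if "m < k" for m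
    proof -
      consider "m = k - 1" | "m = k - 2" | "m < k - 2" using \<open>m < k\<close> by linarith
      then show ?thesis
      proof cases
        case 1 then show ?thesis using rr True by (simp add: key.simps)
      next
        case 2 then show ?thesis using key_less_if_before[OF k2 bef[OF k2]] by (meson order_less_asym')
      next
        case 3 then show ?thesis using key_less_if_index_less[OF a(1,2) 3 k2] by (meson order_less_asym')
      qed
    qed
  qed (use a k in auto)
next
  case False
  have k0: "Suc 0 < k" using k by simp
  show ?thesis
  proof (rule not_alternateI(2)[of _ _ "k - 1" 0])
    show "key (Inl a, k - 1) < key (Inl a, 0)" using key_last_left[OF a(1,1)] False k0 by simp
    show "\<not> (key (Inl a, k - 1) < key (Inl a', m) \<and> key (Inl a', m) < key (Inl a, 0))" if "m < k" for m
    proof -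
      consider "m = k - 1" | "m = 0" "Suc m < k" | "0 < m" "Suc m < k" using \<open>m < k\<close> by linarith
      then show ?thesis
      proof cases
        case 1
        show ?thesis
        proof (cases "0 < r (k - 1) a'")
          case True
          then show ?thesis using key_last_right[OF a(2,1) True k0] 1 by (meson order_less_asym')
        next
          case F: False
          then have "l 0 a < l 0 a'" using last False k by (auto simp: before_def)
          then show ?thesis using 1 F False k by (auto simp: key.simps)
        qed
      next
        case 2 then show ?thesis using key_less_if_before[OF k0 bef[OF k0]] by (meson order_less_asym')
      next
        case 3 then show ?thesis using key_less_if_index_less[OF a(1,2) 3] by (meson order_less_asym')
      qed
    qed
  qed (use a k in auto)
qed

text \<open>By \<open>order\<close> both orders of the two points occur in some gap. Either the
  order changes within the first \<open>k - 1\<close> gaps, or these agree and the wrapped gap is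
  the one that differs.\<close>

lemma not_alternate_left:
  assumes a: "a \<in> P" "a' \<in> P" and ne: "a \<noteq> a'"
  shows "\<not> alternate w (Inl a) (Inl a')"
proof (cases "\<exists>i. Suc i < k - 1 \<and> before i a a' \<noteq> before (Suc i) a a'")
  case True
  then obtain i where "Suc i < k - 1" and i': "before i a a' \<noteq> before (Suc i) a a'" by blast
  then have i: "Suc (Suc i) < k" "before i a a' \<noteq> before (Suc i) a a'" by simp_all
  show ?thesis
  proof (cases "before i a a'")
    case True
    then have "before (Suc i) a' a" using i before_or[OF a ne, of "Suc i"] by auto
    then show ?thesis using not_alternate_if_before_step[OF a ne i(1) True] by (simp add: alternate_commute)
  next
    case False
    then have "before (Suc i) a a'" "before i a' a" using i before_or[OF a ne, of i] by auto
    then show ?thesis using not_alternate_if_before_step[OF a(2,1) ne[symmetric] i(1)] by simp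
  qed
next
  case False
  then have const: "before i a a' = before 0 a a'" if "i < k - 1" for i
    using that False by (induction i) auto
  obtain i j where ij: "i < k" "before i a a'" "j < k" "before j a' a"
    using order[OF a ne] order[OF a(2,1) ne[symmetric]] unfolding before_def by blast
  have k0: "0 < k - 1" using k by simp
  show ?thesis
  proof (cases "before 0 a a'")
    case True
    then have "j = k - 1" using const[of j] ij before_asym by (cases "j < k - 1") auto
    then show ?thesis
      using not_alternate_if_before_last[OF a ne] const True ij(4) by (simp add: alternate_commute)
  next
    case F: False
    then have "i = k - 1" using const[of i] ij by (cases "i < k - 1") auto
    moreover have "before m a' a" if "Suc m < k" for m
      using const[of m] F before_or[OF a ne, of m] that by auto
    ultimately show ?thesis
      using not_alternate_if_before_last[OF a(2,1) ne[symmetric]] ij(2) by simp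
  qed
qed

theorem rep: "rep k P Q N"
  unfolding rep_def using set_w count_w alternate_iff not_alternate_left not_alternate_right by blast

end

section \<open>Renaming, exchange of sides, deletion of letters, and the link to graphs\<close>

lemma repE:
  fixes P :: "'p set" and Q :: "'q set"
  assumes "rep k P Q N"
  obtains w :: "('p + 'q) list" where "set w \<subseteq> P <+> Q" "\<forall>v \<in> P <+> Q. count_list w v = k"
     "\<forall>a\<in>P. \<forall>b\<in>Q. alternate w (Inl a) (Inr b) \<longleftrightarrow> \<not> N a b"
     "\<forall>a\<in>P. \<forall>a'\<in>P. a \<noteq> a' \<longrightarrow> \<not> alternate w (Inl a) (Inl a')"
     "\<forall>b\<in>Q. \<forall>b'\<in>Q. b \<noteq> b' \<longrightarrow> \<not> alternate w (Inr b) (Inr b')"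
  using assms unfolding rep_def by (elim exE conjE)

lemma repI:
  fixes P :: "'p set" and Q :: "'q set" and w :: "('p + 'q) list"
  assumes "set w \<subseteq> P <+> Q" "\<And>a. a \<in> P \<Longrightarrow> count_list w (Inl a) = k" "\<And>b. b \<in> Q \<Longrightarrow> count_list w (Inr b) = k"
     "\<And>a b. a\<in>P \<Longrightarrow> b\<in>Q \<Longrightarrow> alternate w (Inl a) (Inr b) \<longleftrightarrow> \<not> N a b"
     "\<And>a a'. a\<in>P \<Longrightarrow> a'\<in>P \<Longrightarrow> a \<noteq> a' \<Longrightarrow> \<not> alternate w (Inl a) (Inl a')"
     "\<And>b b'. b\<in>Q \<Longrightarrow> b'\<in>Q \<Longrightarrow> b \<noteq> b' \<Longrightarrow> \<not> alternate w (Inr b) (Inr b')"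
  shows "rep k P Q N"
  unfolding rep_def using assms by (intro exI[of _ w] conjI ballI impI; (elim PlusE)?) simp_all

lemma alternate_map:
  assumes "inj_on h S" "set w \<subseteq> S" "u \<in> S" "v \<in> S"
  shows "alternate (map h w) (h u) (h v) \<longleftrightarrow> alternate w u v"
proof -
  have "filter (\<lambda>x. x = h u \<or> x = h v) (map h w) = map h (filter (\<lambda>x. x = u \<or> x = v) w)"
    using assms by (auto simp: filter_map o_def inj_on_eq_iff intro!: arg_cong[where f = "map h"] filter_cong)
  moreover have "inj_on h (set (filter (\<lambda>x. x = u \<or> x = v) w))"
    using assms by (auto intro: inj_on_subset)
  ultimately show ?thesis by (simp add: alternate_def distinct_adj_map_iff)
qed

lemma count_list_map_inj_on:
  assumes "inj_on h S" "set w \<subseteq> S" "v \<in> S"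
  shows "count_list (map h w) (h v) = count_list w v"
  using assms by (induction w) (auto simp: inj_on_eq_iff)

lemma rep_reindex:
  assumes rep: "rep k P Q N" and h: "inj_on h P" "inj_on g Q"
    and N: "\<And>a b. a \<in> P \<Longrightarrow> b \<in> Q \<Longrightarrow> N' (h a) (g b) \<longleftrightarrow> N a b"
  shows "rep k (h ` P) (g ` Q) N'"
proof -
  from rep obtain w where w: "set w \<subseteq> P <+> Q" "\<forall>v \<in> P <+> Q. count_list w v = k"
     "\<forall>a\<in>P. \<forall>b\<in>Q. alternate w (Inl a) (Inr b) \<longleftrightarrow> \<not> N a b"
     "\<forall>a\<in>P. \<forall>a'\<in>P. a \<noteq> a' \<longrightarrow> \<not> alternate w (Inl a) (Inl a')"
     "\<forall>b\<in>Q. \<forall>b'\<in>Q. b \<noteq> b' \<longrightarrow> \<not> alternate w (Inr b) (Inr b')"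
    by (rule repE)
  define m where "m = map_sum h g"
  have inj: "inj_on m (P <+> Q)" 
    by (rule inj_onI) (auto simp: m_def inj_on_eq_iff[OF h(1)] inj_on_eq_iff[OF h(2)])
  have im: "h ` P <+> g ` Q = m ` (P <+> Q)" by (force simp: m_def)
  have alt: "alternate (map m w) (m u) (m v) \<longleftrightarrow> alternate w u v" if "u \<in> P <+> Q" "v \<in> P <+> Q" for u v
    using alternate_map[OF inj w(1) that] .
  have m: "m (Inl a) = Inl (h a)" "m (Inr b) = Inr (g b)" for a b by (simp_all add: m_def)
  have "\<not> alternate (map m w) (Inl (h a)) (Inl (h a'))" if "a \<in> P" "a' \<in> P" "h a \<noteq> h a'" for a a'
    using alt[of "Inl a" "Inl a'"] that w(4) by (auto simp: m InlI)
  moreover have "\<not> alternate (map m w) (Inr (g b)) (Inr (g b'))" if "b \<in> Q" "b' \<in> Q" "g b \<noteq> g b'" for b b'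
    using alt[of "Inr b" "Inr b'"] that w(5) by (auto simp: m InrI)
  moreover have "alternate (map m w) (Inl (h a)) (Inr (g b)) \<longleftrightarrow> \<not> N' (h a) (g b)" if "a \<in> P" "b \<in> Q" for a b
    using alt[of "Inl a" "Inr b"] that w(3) N by (auto simp: m InlI InrI)
  moreover have "count_list (map m w) (Inl (h a)) = k" if "a \<in> P" for a
    using count_list_map_inj_on[OF inj w(1), of "Inl a"] w(2) that by (auto simp: m InlI InrI)
  moreover have "count_list (map m w) (Inr (g b)) = k" if "b \<in> Q" for b
    using count_list_map_inj_on[OF inj w(1), of "Inr b"] w(2) that by (auto simp: m InlI InrI)
  moreover have "set (map m w) \<subseteq> h ` P <+> g ` Q" unfolding im using w(1) by auto
  ultimately show ?thesis by (intro repI[of "map m w"]; (elim imageE)?) simp_all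
qed

lemma rep_swap:
  assumes "rep k P Q N"
  shows "rep k Q P (\<lambda>b a. N a b)"
proof -
  from assms obtain w where w: "set w \<subseteq> P <+> Q" "\<forall>v \<in> P <+> Q. count_list w v = k"
     "\<forall>a\<in>P. \<forall>b\<in>Q. alternate w (Inl a) (Inr b) \<longleftrightarrow> \<not> N a b"
     "\<forall>a\<in>P. \<forall>a'\<in>P. a \<noteq> a' \<longrightarrow> \<not> alternate w (Inl a) (Inl a')"
     "\<forall>b\<in>Q. \<forall>b'\<in>Q. b \<noteq> b' \<longrightarrow> \<not> alternate w (Inr b) (Inr b')"
    by (rule repE)
  define m :: "'a + 'b \<Rightarrow> 'b + 'a" where "m = case_sum Inr Inl"
  have m: "m (Inl a) = Inr a" "m (Inr b) = Inl b" for a b by (simp_all add: m_def)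
  have inj: "inj_on m UNIV"
  proof (rule inj_onI)
    fix u v assume "m u = m v" then show "u = v" by (cases u; cases v) (simp_all add: m)
  qed
  have im: "m ` (P <+> Q) \<subseteq> Q <+> P" by (auto simp: m)
  have alt: "alternate (map m w) (m u) (m v) \<longleftrightarrow> alternate w u v" for u v
    using alternate_map[OF inj] by simp
  have "alternate (map m w) (Inl b) (Inr a) \<longleftrightarrow> alternate w (Inl a) (Inr b)" for a b
    using alt[of "Inr b" "Inl a"] by (simp add: m alternate_commute)
  moreover have "alternate (map m w) (Inl b) (Inl b') \<longleftrightarrow> alternate w (Inr b) (Inr b')" for b b'
    using alt[of "Inr b" "Inr b'"] by (simp add: m)
  moreover have "alternate (map m w) (Inr b) (Inr b') \<longleftrightarrow> alternate w (Inl b) (Inl b')" for b b'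
    using alt[of "Inl b" "Inl b'"] by (simp add: m)
  moreover have "count_list (map m w) (Inl b) = k" if "b \<in> Q" for b
    using count_list_map_inj_on[OF inj, of w "Inr b"] w(2) that by (auto simp: m InlI InrI)
  moreover have "count_list (map m w) (Inr a) = k" if "a \<in> P" for a
    using count_list_map_inj_on[OF inj, of w "Inl a"] w(2) that by (auto simp: m InlI InrI)
  moreover have "set (map m w) \<subseteq> Q <+> P" using im image_mono[OF w(1), of m] by simp
  ultimately show ?thesis using w(3-5) by (intro repI[of "map m w"]) simp_all
qed

lemma alternate_filter: "F u \<Longrightarrow> F v \<Longrightarrow> alternate (filter F w) u v \<longleftrightarrow> alternate w u v"
  unfolding alternate_def filter_filter
  by (rule arg_cong[where f = distinct_adj], rule filter_cong) auto

lemma count_list_filter_true: "F v \<Longrightarrow> count_list (filter F w) v = count_list w v"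
  by (induction w) auto

text \<open>Deleting letters does not affect the alternation of the remaining ones; this discards
  the padding.\<close>

lemma rep_subset:
  assumes rep: "rep k P Q N" and sub: "P' \<subseteq> P" "Q' \<subseteq> Q"
  shows "rep k P' Q' N"
proof -
  from rep obtain w where w: "set w \<subseteq> P <+> Q" "\<forall>v \<in> P <+> Q. count_list w v = k"
     "\<forall>a\<in>P. \<forall>b\<in>Q. alternate w (Inl a) (Inr b) \<longleftrightarrow> \<not> N a b"
     "\<forall>a\<in>P. \<forall>a'\<in>P. a \<noteq> a' \<longrightarrow> \<not> alternate w (Inl a) (Inl a')"
     "\<forall>b\<in>Q. \<forall>b'\<in>Q. b \<noteq> b' \<longrightarrow> \<not> alternate w (Inr b) (Inr b')"
    by (rule repE)
  define F where "F v \<longleftrightarrow> v \<in> P' <+> Q'" for v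
  have F: "\<And>a. a \<in> P' \<Longrightarrow> F (Inl a)" "\<And>b. b \<in> Q' \<Longrightarrow> F (Inr b)" by (auto simp: F_def)
  have "set (filter F w) \<subseteq> P' <+> Q'" by (auto simp: F_def)
  then show ?thesis
    using w(2-5) sub
    by (intro repI[of "filter F w"]) (auto simp: alternate_filter count_list_filter_true F subset_iff)
qed

lemma uniform_representation_if_rep:
  assumes rep: "rep k P Q N" and G: "pverts G = P \<union> Q" "P \<inter> Q = {}"
    "\<And>a b. a \<in> P \<Longrightarrow> b \<in> Q \<Longrightarrow> ((a, b) \<in> parcs G \<longleftrightarrow> \<not> N a b) \<and> ((b, a) \<in> parcs G \<longleftrightarrow> \<not> N a b)"
    "\<And>a a'. a \<in> P \<Longrightarrow> a' \<in> P \<Longrightarrow> (a, a') \<notin> parcs G" "\<And>b b'. b \<in> Q \<Longrightarrow> b' \<in> Q \<Longrightarrow> (b, b') \<notin> parcs G"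
  shows "\<exists>w. uniform_representation G k w"
proof -
  from rep obtain w where w: "set w \<subseteq> P <+> Q" "\<forall>v \<in> P <+> Q. count_list w v = k"
     "\<forall>a\<in>P. \<forall>b\<in>Q. alternate w (Inl a) (Inr b) \<longleftrightarrow> \<not> N a b"
     "\<forall>a\<in>P. \<forall>a'\<in>P. a \<noteq> a' \<longrightarrow> \<not> alternate w (Inl a) (Inl a')"
     "\<forall>b\<in>Q. \<forall>b'\<in>Q. b \<noteq> b' \<longrightarrow> \<not> alternate w (Inr b) (Inr b')"
    by (rule repE)
  define m where "m = case_sum id (id :: 'a \<Rightarrow> 'a)"
  have inj: "inj_on m (P <+> Q)" 
    using G(2) by (intro inj_onI) (auto simp: m_def)
  have im: "P \<union> Q = m ` (P <+> Q)" by (force simp: m_def)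
  have m: "m (Inl a) = a" "m (Inr b) = b" for a b by (simp_all add: m_def)
  have PP: "alternate (map m w) a a' \<longleftrightarrow> alternate w (Inl a) (Inl a')" if "a \<in> P" "a' \<in> P" for a a'
    using alternate_map[OF inj w(1), of "Inl a" "Inl a'"] that by (simp add: m InlI)
  have QQ: "alternate (map m w) b b' \<longleftrightarrow> alternate w (Inr b) (Inr b')" if "b \<in> Q" "b' \<in> Q" for b b'
    using alternate_map[OF inj w(1), of "Inr b" "Inr b'"] that by (simp add: m InrI)
  have PQ: "alternate (map m w) a b \<longleftrightarrow> alternate w (Inl a) (Inr b)" if "a \<in> P" "b \<in> Q" for a b
    using alternate_map[OF inj w(1), of "Inl a" "Inr b"] that by (simp add: m InlI InrI)
  have QP: "alternate (map m w) b a \<longleftrightarrow> alternate w (Inl a) (Inr b)" if "a \<in> P" "b \<in> Q" for a b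
    using PQ[OF that] by (simp add: alternate_commute)
  have "count_list (map m w) v = k" if "v \<in> pverts G" for v
    using that w(2) count_list_map_inj_on[OF inj w(1), of "Inl v"] count_list_map_inj_on[OF inj w(1), of "Inr v"]
    unfolding G(1) by (auto simp: m InlI InrI)
  moreover have "set (map m w) \<subseteq> pverts G"
    using image_mono[OF w(1), of m] by (simp add: G(1) im)
  moreover have "alternate (map m w) a b \<longleftrightarrow> (a, b) \<in> parcs G" if "a \<in> pverts G" "b \<in> pverts G" "a \<noteq> b" for a b
  proof -
    consider "a \<in> P" "b \<in> P" | "a \<in> Q" "b \<in> Q" | "a \<in> P" "b \<in> Q" | "a \<in> Q" "b \<in> P"
      using \<open>a \<in> pverts G\<close> \<open>b \<in> pverts G\<close> unfolding G(1) by blast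
    then show ?thesis
    proof cases
      case 1 then show ?thesis using PP[of a b] w(4) G(4)[of a b] \<open>a \<noteq> b\<close> by simp
    next
      case 2 then show ?thesis using QQ[of a b] w(5) G(5)[of a b] \<open>a \<noteq> b\<close> by simp
    next
      case 3 then show ?thesis using PQ[of a b] w(3) G(3)[of a b] by simp
    next
      case 4 then show ?thesis using QP[of b a] w(3) G(3)[of b a] by simp
    qed
  qed
  ultimately show ?thesis unfolding uniform_representation_def by blast
qed

section \<open>Zone schemes for families of pairs\<close>

text \<open>
  Left of the centre of its zone, the first member of a pair is at distance \<open>1\<close> and the second at distance \<open>2\<close>;
  on the right it is the other way round. These are the displacements that jump over the intended members.
\<close>

definition pair_rank :: "bool \<Rightarrow> bool \<Rightarrow> int \<Rightarrow> bool" where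
  "pair_rank x y e \<longleftrightarrow>
    (if x then if y then e = -2 \<or> e = 2 else e = -1 else if y then e = 1 else e = 0)"

lemma ex_pred_mod: "m < k \<Longrightarrow> \<exists>i<k. Suc i mod k = m" for k :: nat
  by (intro exI[of _ "if m = 0 then k - 1 else m - 1"]) auto

lemma ex_third:
  fixes k :: nat
  assumes "3 \<le> k"
  shows "\<exists>m<k. m \<noteq> i \<and> m \<noteq> j"
proof -
  consider "0 \<noteq> i \<and> 0 \<noteq> j" | "1 \<noteq> i \<and> 1 \<noteq> j" | "2 \<noteq> i \<and> 2 \<noteq> j" by force
  then show ?thesis
  proof cases
    case 1 then show ?thesis using assms by (intro exI[of _ 0]) simp
  next
    case 2 then show ?thesis using assms by (intro exI[of _ 1]) simp
  next
    case 3 then show ?thesis using assms by (intro exI[of _ 2]) simp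
  qed
qed

lemma rep_pair_scheme:
  fixes N :: "nat \<times> bool \<Rightarrow> 'q \<Rightarrow> bool" and d :: "'q \<Rightarrow> nat \<Rightarrow> int"
  assumes k: "3 \<le> k" and fin: "finite Q"
    and rank: "\<And>b i. b \<in> Q \<Longrightarrow> i < k \<Longrightarrow> pair_rank (N (i, False) b) (N (i, True) b) (d b i)"
    and incomp: "\<And>b b'. b \<in> Q \<Longrightarrow> b' \<in> Q \<Longrightarrow> \<exists>i<k. d b' i \<le> d b i"
  shows "rep k ({..<k} \<times> UNIV) Q N"
proof -
  define l :: "nat \<Rightarrow> nat \<times> bool \<Rightarrow> nat" where
    "l = (\<lambda>i (j, s). if j = i then (if s then 2 else 1) else 0)"
  \<comment> \<open>Points of other pairs are parked at distance at least 4, out of reach of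
    displacements of size at most 2. Among them all first members precede all second members, as
    \<open>4 + j < 4 + k\<close>.\<close>
  define r :: "nat \<Rightarrow> nat \<times> bool \<Rightarrow> nat" where
    "r = (\<lambda>i (j, s). if j = Suc i mod k then 0 else if j = i then (if s then 1 else 2)
       else if s then 4 + k + j else 4 + j)"
  obtain f0 :: "'q \<Rightarrow> nat" where f0: "inj_on f0 Q"
    using finite_imp_inj_to_nat_seg[OF fin] by blast
  have neq: "Suc i mod k \<noteq> i" if "i < k" for i
    using k that by (cases "Suc i = k") auto
  have bound: "\<bar>d b i\<bar> \<le> 2" if "b \<in> Q" "i < k" for b i
    using rank[OF that] by (auto simp: pair_rank_def split: if_splits)
  have cut: "0 < l i (j, s) \<and> int (l i (j, s)) \<le> - d b i \<or> 0 < r i (j, s) \<and> int (r i (j, s)) \<le> d b i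
      \<longleftrightarrow> i = j \<and> N (j, s) b" if "b \<in> Q" "i < k" for b i j s
    using bound[OF that] rank[OF that] neq[OF that(2)]
    by (cases s) (auto simp: l_def r_def pair_rank_def split: if_splits)
  interpret zone_scheme k "{..<k} \<times> UNIV" Q N l r d "\<lambda>b. int (f0 b)"
  proof
    show "inj_on (\<lambda>b. int (f0 b)) Q" using f0 by (auto simp: inj_on_def)
    show "0 < r i a \<longleftrightarrow> l (Suc i mod k) a = 0" for i a
      by (cases a) (auto simp: l_def r_def)
    show "a = a'" if "l i a = l i a'" "0 < l i a" for i a a'
      using that by (cases a; cases a') (auto simp: l_def split: if_splits)
    show "a = a'" if "a \<in> {..<k} \<times> (UNIV :: bool set)" "a' \<in> {..<k} \<times> (UNIV :: bool set)" "r i a = r i a'" "0 < r i a" for i a a'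
      using that by (cases a; cases a') (auto simp: r_def split: if_splits)
    fix a b assume a: "a \<in> {..<k} \<times> (UNIV :: bool set)" and b: "b \<in> Q"
    obtain j s where js: "a = (j, s)" "j < k" using a by auto
    show "N a b \<longleftrightarrow> (\<exists>i<k. 0 < l i a \<and> int (l i a) \<le> - d b i \<or> 0 < r i a \<and> int (r i a) \<le> d b i)"
      using js cut[OF b] by blast
    show "\<exists>i<k. \<not> (0 < l i a \<and> int (l i a) \<le> - d b i \<or> 0 < r i a \<and> int (r i a) \<le> d b i)"
      using ex_third[OF k, of j j] js cut[OF b] by blast
  next
    fix a a' assume a: "a \<in> {..<k} \<times> (UNIV :: bool set)" "a' \<in> {..<k} \<times> (UNIV :: bool set)" "a \<noteq> a'"
    obtain j s j' s' where js: "a = (j, s)" "j < k" "a' = (j', s')" "j' < k" using a by auto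
    consider "\<not> s'" | "s" | "\<not> s" "s'" by blast
    then show "\<exists>i<k. 0 < r i a \<and> (r i a' = 0 \<or> r i a < r i a') \<or>
             r i a = 0 \<and> r i a' = 0 \<and> l (Suc i mod k) a' < l (Suc i mod k) a"
    proof cases
      case 1
      obtain i where "i < k" "Suc i mod k = j'" using ex_pred_mod[OF js(4)] by blast
      then show ?thesis using 1 js a(3) by (intro exI[of _ i]) (auto simp: l_def r_def)
    next
      case 2
      then show ?thesis using js a(3) neq[OF js(2)] by (intro exI[of _ j]) (auto simp: r_def)
    next
      case 3
      \<comment> \<open>In gap \<open>i\<close> with successor zone \<open>m\<close> the first
        member \<open>a\<close> is not in its late left position, and the second member
        \<open>a'\<close> is not in its early right position; this needs a zone avoiding two
        others.\<close>
      obtain m where m: "m < k" "m \<noteq> j" "m \<noteq> Suc j' mod k" using ex_third[OF k] by blast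
      obtain i where i: "i < k" "Suc i mod k = m" using ex_pred_mod[OF m(1)] by blast
      then show ?thesis using 3 js m by (intro exI[of _ i]) (auto simp: r_def)
    qed
  qed (use k fin incomp in auto)
  show ?thesis by (rule rep)
qed

text \<open>
  The last pair \<open>c = (k - 1, False)\<close>, \<open>z = (k - 1, True)\<close> is only used to separate chains through a letter that
  jumps over \<open>c\<close>. If \<open>ins\<close> holds, a copy of \<open>z\<close> is inserted in zone \<open>1\<close>, to the left, between the two members
  of pair \<open>1\<close>; letters that have to jump over \<open>z\<close> but not over \<open>c\<close> do so there.
\<close>

lemma rep_center_scheme:
  fixes N :: "nat \<times> bool \<Rightarrow> 'q \<Rightarrow> bool" and e :: "'q \<Rightarrow> nat \<Rightarrow> int" and ins :: bool
  assumes k: "3 \<le> k" and fin: "finite Q"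
    and rank: "\<And>b i. b \<in> Q \<Longrightarrow> i < k - 1 \<Longrightarrow> \<not> (ins \<and> i = 1) \<Longrightarrow> pair_rank (N (i, False) b) (N (i, True) b) (e b i)"
    and rank1: "\<And>b. b \<in> Q \<Longrightarrow> ins \<Longrightarrow> \<not> (N (k - 1, True) b \<and> \<not> N (k - 1, False) b) \<Longrightarrow>
      pair_rank (N (1, False) b) (N (1, True) b) (e b 1) \<and> e b 1 \<noteq> -2"
    and rank2: "\<And>b. b \<in> Q \<Longrightarrow> N (k - 1, True) b \<Longrightarrow> \<not> N (k - 1, False) b \<Longrightarrow>
      ins \<and> N (1, False) b \<and> e b 1 = (if N (1, True) b then -3 else -2)"
    and extremal: "\<And>b. b \<in> Q \<Longrightarrow> N (k - 1, False) b \<Longrightarrow>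
      (\<forall>b'\<in>Q. \<exists>i<k - 1. e b' i \<le> e b i) \<or> (\<forall>b'\<in>Q. \<exists>i<k - 1. e b i \<le> e b' i)"
  shows "rep k ({..<k} \<times> UNIV) Q N"
proof -
  \<comment> \<open>A letter over \<open>c\<close> with nothing strictly above it goes left in the
    last zone; any other letter over \<open>c\<close> goes right and by \<open>extremal\<close> has
    nothing strictly below it. If \<open>b\<close> were below \<open>b'\<close> in all zones, the
    last displacement would be at least 0 for \<open>b\<close> and at most 0 for
    \<open>b'\<close>.\<close>
  define top where "top b \<longleftrightarrow> (\<forall>b'\<in>Q. \<exists>i<k - 1. e b' i \<le> e b i)" for b
  define d where "d b i = (if i < k - 1 then e b i else if N (k - 1, False) b then
     (if top b then -1 else 1) * (if N (k - 1, True) b then 2 else 1) else 0)" for b i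
  define l :: "nat \<Rightarrow> nat \<times> bool \<Rightarrow> nat" where
    "l = (\<lambda>i (j, s). if ins \<and> i = 1 then (if j = 1 then (if s then 3 else 1) else if j = k - 1 \<and> s then 2 else 0)
       else if j = i then (if s then 2 else 1) else 0)"
  \<comment> \<open>In the last zone \<open>c\<close> is nearer than \<open>z\<close> on both sides,
    which frees the direction of every jump over \<open>c\<close> but makes \<open>z\<close>
    unreachable without \<open>c\<close>.\<close>
  define r :: "nat \<Rightarrow> nat \<times> bool \<Rightarrow> nat" where
    "r = (\<lambda>i (j, s). if j = Suc i mod k \<or> ins \<and> Suc i mod k = 1 \<and> j = k - 1 \<and> s then 0
       else if j = i then (if s \<longleftrightarrow> i \<noteq> k - 1 then 1 else 2)
       else if s then 4 + k + j else 4 + j)"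
  obtain f0 :: "'q \<Rightarrow> nat" where f0: "inj_on f0 Q"
    using finite_imp_inj_to_nat_seg[OF fin] by blast
  have neq: "Suc i mod k \<noteq> i" if "i < k" for i
    using k that by (cases "Suc i = k") auto
  have last: "Suc (k - 1) mod k = 0" using k by simp
  have k1: "k - 1 \<noteq> 0" "k - 1 \<noteq> 1" "1 < k - 1" using k by auto
  have cut_pair: "0 < l i (j, s) \<and> int (l i (j, s)) \<le> - d b i \<or> 0 < r i (j, s) \<and> int (r i (j, s)) \<le> d b i
      \<longleftrightarrow> i = j \<and> N (j, s) b" if "b \<in> Q" "i < k - 1" "\<not> (ins \<and> i = 1)" "j < k" for b i j s
  proof -
    have "i < k" using that by simp
    then show ?thesis
      using rank[OF that(1-3)] neq[of i] that
      by (cases s) (auto simp: l_def r_def d_def pair_rank_def split: if_splits)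
  qed
  have cut_one: "0 < l 1 (j, s) \<and> int (l 1 (j, s)) \<le> - d b 1 \<or> 0 < r 1 (j, s) \<and> int (r 1 (j, s)) \<le> d b 1
      \<longleftrightarrow> j = 1 \<and> N (1, s) b \<or> j = k - 1 \<and> s \<and> N (k - 1, True) b \<and> \<not> N (k - 1, False) b"
    if "b \<in> Q" "ins" "j < k" for b j s
  proof (cases "N (k - 1, True) b \<and> \<not> N (k - 1, False) b")
    case True
    then show ?thesis
      using rank2[OF that(1)] neq[of 1] that k k1
      by (cases s) (auto simp: l_def r_def d_def split: if_splits)
  next
    case False
    then show ?thesis
      using rank1[OF that(1,2) False] neq[of 1] that k k1
      by (cases s) (auto simp: l_def r_def d_def pair_rank_def split: if_splits)
  qed
  have cut_center: "0 < l (k - 1) (j, s) \<and> int (l (k - 1) (j, s)) \<le> - d b (k - 1) \<or>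
      0 < r (k - 1) (j, s) \<and> int (r (k - 1) (j, s)) \<le> d b (k - 1)
      \<longleftrightarrow> j = k - 1 \<and> N (j, s) b \<and> N (k - 1, False) b" if "b \<in> Q" "j < k" for b j s
    using that last k1 by (cases s) (auto simp: l_def r_def d_def split: if_splits)
  have r0: "r i (j, s) = 0 \<longleftrightarrow> j = Suc i mod k \<or> ins \<and> Suc i mod k = 1 \<and> j = k - 1 \<and> s" for i j s
    by (auto simp: r_def)
  have l0: "l m (j, s) = 0 \<longleftrightarrow> \<not> (j = m \<or> ins \<and> m = 1 \<and> j = k - 1 \<and> s)" for m j s
    by (auto simp: l_def)
  interpret zone_scheme k "{..<k} \<times> UNIV" Q N l r d "\<lambda>b. int (f0 b)"
  proof
    show "inj_on (\<lambda>b. int (f0 b)) Q" using f0 by (auto simp: inj_on_def)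
    show "0 < r i a \<longleftrightarrow> l (Suc i mod k) a = 0" for i a
    proof -
      have "(r i (fst a, snd a) = 0) \<longleftrightarrow> \<not> (l (Suc i mod k) (fst a, snd a) = 0)"
        unfolding r0 l0 by blast
      then show ?thesis by (cases "r i a = 0") simp_all
    qed
    show "a = a'" if "l i a = l i a'" "0 < l i a" for i a a'
    proof -
      obtain j s j' s' where js: "a = (j, s)" "a' = (j', s')" by (cases a; cases a')
      show ?thesis
      proof (cases "ins \<and> i = 1")
        case True
        then have v: "l i (j, s) = (if j = 1 then (if s then 3 else 1) else if j = k - 1 \<and> s then 2 else 0)" for j s
          by (simp add: l_def)
        show ?thesis using that unfolding js v by (cases s; cases s') (simp_all split: if_splits)
      next
        case False
        then have v: "l i (j, s) = (if j = i then (if s then 2 else 1) else 0)" for j s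
          by (simp only: l_def if_False prod.case)
        show ?thesis using that unfolding js v by (cases s; cases s') (simp_all split: if_splits)
      qed
    qed
    show "a = a'" if asm: "a \<in> {..<k} \<times> (UNIV :: bool set)" "a' \<in> {..<k} \<times> (UNIV :: bool set)" "r i a = r i a'" "0 < r i a" for i a a'
    proof -
      obtain j s j' s' where js': "a = (j, s)" "a' = (j', s')" by (cases a; cases a')
      then have js: "a = (j, s)" "a' = (j', s')" "j < k" "j' < k" using asm(1,2) by simp_all
      have "r i (j, s) = (if j = i then (if s \<longleftrightarrow> i \<noteq> k - 1 then 1 else 2) else if s then 4 + k + j else 4 + j)"
        if "0 < r i (j, s)" for j s
      proof -
        have "\<not> (j = Suc i mod k \<or> ins \<and> Suc i mod k = 1 \<and> j = k - 1 \<and> s)"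
          using that r0[of i j s] by linarith
        then show ?thesis by (simp only: r_def prod.case if_False)
      qed
      note v = this
      have "0 < r i (j, s)" "0 < r i (j', s')" using asm(3,4) js by simp_all
      then show ?thesis using asm(3) js(3,4) unfolding js(1,2) v[OF \<open>0 < r i (j, s)\<close>] v[OF \<open>0 < r i (j', s')\<close>]
        by (cases s; cases s') (simp_all split: if_splits)
    qed
    fix a b assume a: "a \<in> {..<k} \<times> (UNIV :: bool set)" and b: "b \<in> Q"
    obtain j s where "a = (j, s)" by (cases a)
    then have js: "a = (j, s)" "j < k" using a by simp_all
    let ?cut = "\<lambda>i. 0 < l i a \<and> int (l i a) \<le> - d b i \<or> 0 < r i a \<and> int (r i a) \<le> d b i"
    have cut: "?cut i \<longleftrightarrow> (if i = k - 1 then j = k - 1 \<and> N (j, s) b \<and> N (k - 1, False) b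
        else if ins \<and> i = 1 then j = 1 \<and> N (1, s) b \<or> j = k - 1 \<and> s \<and> N (k - 1, True) b \<and> \<not> N (k - 1, False) b
        else i = j \<and> N (j, s) b)" if "i < k" for i
    proof (cases "i = k - 1")
      case True
      show ?thesis unfolding js True using cut_center[OF b js(2), of s] by simp
    next
      case False
      then have i: "i < k - 1" using that by simp
      show ?thesis
      proof (cases "ins \<and> i = 1")
        case True
        then show ?thesis unfolding js using cut_one[OF b _ js(2), of s] False by simp
      next
        case F: False
        show ?thesis unfolding js cut_pair[OF b i F js(2), of s] by (simp only: F False if_False)
      qed
    qed
    show "N a b \<longleftrightarrow> (\<exists>i<k. ?cut i)"
    proof
      assume N: "N a b"
      show "\<exists>i<k. ?cut i"
      proof (cases "j = k - 1 \<and> \<not> N (k - 1, False) b")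
        case True
        then show ?thesis using N js k k1 rank2[OF b] cut[of 1] by (cases s) (auto intro: exI[of _ 1])
      next
        case False
        then show ?thesis using N js k1 cut[of j] by (intro exI[of _ j]) auto
      qed
    next
      assume "\<exists>i<k. ?cut i"
      then obtain i where "i < k" "?cut i" by blast
      then show "N a b" using cut[of i] js k1 by (simp only: if_split) (cases s; auto)
    qed
    have k01: "0 < k" "1 < k" using k by simp_all
    \<comment> \<open>A point is jumped over only in its own zone or, for \<open>z\<close>, also in
      zone 1. So zone 1 is free for pair 0, and zone 0 for all other points.\<close>
    show "\<exists>i<k. \<not> ?cut i"
    proof (cases "j = 0")
      case True
      have "\<not> ?cut 1" unfolding cut[OF k01(2)] using True k1 by auto
      then show ?thesis using k01 by blast
    next
      case False
      have "\<not> ?cut 0" unfolding cut[OF k01(1)] using False k1 by auto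
      then show ?thesis using k01 by blast
    qed
  next
    fix a a' assume a: "a \<in> {..<k} \<times> (UNIV :: bool set)" "a' \<in> {..<k} \<times> (UNIV :: bool set)" "a \<noteq> a'"
    obtain j s j' s' where js': "a = (j, s)" "a' = (j', s')" by (cases a; cases a')
    then have js: "a = (j, s)" "j < k" "a' = (j', s')" "j' < k" using a(1,2) by simp_all
    consider "\<not> s'" | "s" "j \<noteq> k - 1" | "\<not> s" "j = k - 1" | "\<not> s" "j \<noteq> k - 1" "s'" "j' = k - 1"
      | "s" "j = k - 1" "s'" "j' \<noteq> k - 1" | "\<not> s" "s'" "j \<noteq> k - 1" "j' \<noteq> k - 1"
      using js a(3) by blast
    then show "\<exists>i<k. 0 < r i a \<and> (r i a' = 0 \<or> r i a < r i a') \<or>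
             r i a = 0 \<and> r i a' = 0 \<and> l (Suc i mod k) a' < l (Suc i mod k) a"
    proof cases
      case 1
      obtain i where "i < k" "Suc i mod k = j'" using ex_pred_mod[OF js(4)] by blast
      then show ?thesis using 1 js a(3) by (intro exI[of _ i]) (auto simp: l_def r_def)
    next
      case 2
      then show ?thesis using js a(3) neq[OF js(2)] by (intro exI[of _ j]) (auto simp: r_def)
    next
      case 3
      then show ?thesis using js a(3) last k1 by (intro exI[of _ j]) (auto simp: r_def)
    next
      case 4
      obtain i where "i < k" "Suc i mod k = k - 1" using ex_pred_mod[of "k - 1" k] k by auto
      then show ?thesis using 4 js k1 by (intro exI[of _ i]) (auto simp: r_def)
    next
      case 5
      then show ?thesis using js last k1 by (intro exI[of _ "k - 1"]) (auto simp: r_def)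
    next
      case 6
      obtain m where m: "m < k" "m \<noteq> j" "m \<noteq> Suc j' mod k" using ex_third[OF k] by blast
      obtain i where i: "i < k" "Suc i mod k = m" using ex_pred_mod[OF m(1)] by blast
      then show ?thesis using 6 js m by (intro exI[of _ i]) (auto simp: r_def)
    qed
  next
    fix b b' assume b: "b \<in> Q" "b' \<in> Q"
    show "\<exists>i<k. d b' i \<le> d b i"
    proof (rule ccontr)
      assume "\<not> ?thesis"
      then have less: "\<And>i. i < k \<Longrightarrow> d b i < d b' i" by auto
      then have e: "e b i < e b' i" if "i < k - 1" for i using that less[of i] by (simp add: d_def)
      have nt: "\<not> top b" using e b unfolding top_def by (metis not_le)
      have "N (k - 1, False) b' \<Longrightarrow> top b'" using extremal[OF b(2)] e b unfolding top_def by (metis not_le)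
      then have "d b' (k - 1) \<le> 0" by (simp add: d_def)
      moreover have "0 \<le> d b (k - 1)" using nt by (simp add: d_def)
      ultimately show False using less[of "k - 1"] k by simp
    qed
  qed (use k fin in auto)
  show ?thesis by (rule rep)
qed

section \<open>Small hitting sets\<close>

lemma card_UN_disjoint_le:
  assumes "finite I" "\<And>i. i \<in> I \<Longrightarrow> finite (A i)" "\<And>i j. i \<in> I \<Longrightarrow> j \<in> I \<Longrightarrow> i \<noteq> j \<Longrightarrow> A i \<inter> A j = {}"
    and "\<And>i. i \<in> I \<Longrightarrow> n \<le> card (A i)"
  shows "n * card I \<le> card (\<Union>i\<in>I. A i)"
proof -
  have "card (\<Union>i\<in>I. A i) = (\<Sum>i\<in>I. card (A i))" using assms by (intro card_UN_disjoint) auto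
  moreover have "(\<Sum>i\<in>I. n) \<le> (\<Sum>i\<in>I. card (A i))" using assms(4) by (intro sum_mono)
  ultimately show ?thesis by (simp add: mult.commute)
qed

text \<open>In the dual graph the members of \<open>E\<close> are nodes of degree at least three,
  those of \<open>V\<close> are edges, and a hitting set is an edge cover. A maximum matching
  \<open>M\<close> plus one edge for each uncovered node in \<open>U\<close> is one. As
  \<open>E\<close> has \<open>2|M| + |U|\<close> elements, the bound amounts to
  \<open>2|M| + 3|U| <= |V|\<close>: the edges at \<open>U\<close> number at least
  \<open>3|U|\<close>, and those avoiding \<open>U\<close> at least \<open>2|M|\<close>.\<close>

lemma hitting_set_two_regular:
  fixes V :: "'p set" and E :: "'p set set"
  assumes fin: "finite V" "finite E" and E: "\<And>e. e \<in> E \<Longrightarrow> e \<subseteq> V \<and> 3 \<le> card e"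
    and two: "\<And>v. v \<in> V \<Longrightarrow> card {e\<in>E. v \<in> e} = 2"
    and inj: "\<And>u v. u \<in> V \<Longrightarrow> v \<in> V \<Longrightarrow> {e\<in>E. u \<in> e} = {e\<in>E. v \<in> e} \<Longrightarrow> u = v"
  shows "\<exists>S\<subseteq>V. (\<forall>e\<in>E. S \<inter> e \<noteq> {}) \<and> 4 * card S \<le> card V + card E"
proof -
  define D where "D v = {e\<in>E. v \<in> e}" for v
  have finD: "finite (D v)" for v using fin by (simp add: D_def)
  have D_eq: "D w = {e, f}" if "w \<in> V" "e \<in> E" "f \<in> E" "e \<noteq> f" "w \<in> e" "w \<in> f" for w e f
  proof -
    have "{e, f} \<subseteq> D w" "card (D w) = 2" using that two by (auto simp: D_def)
    then show ?thesis using card_seteq[OF finD, of "{e, f}" w] that(4) by simp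
  qed
  \<comment> \<open>A good set is a matching of the dual graph.\<close>
  define good where "good M \<longleftrightarrow> M \<subseteq> V \<and> (\<forall>u\<in>M. \<forall>v\<in>M. u \<noteq> v \<longrightarrow> D u \<inter> D v = {})" for M
  have "good {}" by (simp add: good_def)
  moreover have "\<forall>M. good M \<longrightarrow> card M < Suc (card V)"
    using fin by (auto simp: good_def less_Suc_eq_le intro: card_mono)
  ultimately have "\<exists>M. good M \<and> (\<forall>M'. good M' \<longrightarrow> card M' \<le> card M)"
    by (rule ex_has_greatest_nat)
  then obtain M where M: "good M" and max: "\<And>M'. good M' \<Longrightarrow> card M' \<le> card M"
    by blast
  have finM: "finite M" using M fin finite_subset by (auto simp: good_def)
  have MV: "M \<subseteq> V" and Mdisj: "\<And>u v. u \<in> M \<Longrightarrow> v \<in> M \<Longrightarrow> u \<noteq> v \<Longrightarrow> D u \<inter> D v = {}"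
    using M by (auto simp: good_def)
  define C where "C = (\<Union>v\<in>M. D v)"
  define U where "U = E - C"
  have CE: "C \<subseteq> E" by (auto simp: C_def D_def)
  have finC: "finite C" "finite U" using fin CE finite_subset by (auto simp: U_def)
  have "card C = (\<Sum>v\<in>M. card (D v))"
    unfolding C_def using finM finD Mdisj by (intro card_UN_disjoint) auto
  also have "\<dots> = (\<Sum>v\<in>M. 2)" using MV two by (intro sum.cong) (auto simp: D_def)
  finally have cardC: "card C = 2 * card M" by simp
  have cardE: "card E = 2 * card M + card U"
    using cardC CE fin card_Diff_subset[OF finC(1) CE] card_mono[OF fin(2) CE] by (simp add: U_def)
  have noD: "e \<notin> D v" if "e \<in> U" "v \<in> M" for e v using that by (auto simp: U_def C_def)
  \<comment> \<open>An edge between two uncovered nodes could be added to the matching.\<close>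
  have Udisj: "e \<inter> f = {}" if ef: "e \<in> U" "f \<in> U" "e \<noteq> f" for e f
  proof (rule ccontr)
    assume "e \<inter> f \<noteq> {}"
    then obtain w where w: "w \<in> e" "w \<in> f" by blast
    have wV: "w \<in> V" "e \<in> E" "f \<in> E" using w ef E by (auto simp: U_def)
    have Dw: "D w = {e, f}" using D_eq[OF wV ef(3) w] .
    have "w \<notin> M" using noD[OF ef(1), of w] Dw by auto
    moreover have "good (insert w M)"
      using M wV(1) noD[OF ef(1)] noD[OF ef(2)] unfolding good_def by (auto simp: Dw)
    ultimately show False using max[of "insert w M"] finM by simp
  qed
  define B where "B = \<Union>U"
  define O' where "O' = V - B"
  have BV: "B \<subseteq> V" using E by (auto simp: B_def U_def)
  have finB: "finite B" "finite O'" using BV fin finite_subset by (auto simp: O'_def)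
  have finite_edge: "finite e" if "e \<in> E" for e using E[OF that] fin finite_subset by auto
  have cardB: "3 * card U \<le> card B"
    using card_UN_disjoint_le[OF finC(2), of "\<lambda>e. e" 3] Udisj E finite_edge by (auto simp: B_def U_def)
  \<comment> \<open>Degrees counted in \<open>O'\<close> at the two ends of a matching edge. If one
    end has no neighbour in \<open>U\<close>, they are at least 3 and 1; otherwise each end loses at
    most one edge to \<open>U\<close>, and both are at least 2.\<close>
  have four: "4 \<le> (\<Sum>e\<in>D v. card (e \<inter> O'))" if v: "v \<in> M" for v
  proof -
    have "card (D v) = 2" using two v MV by (auto simp: D_def)
    then obtain e f where ef: "D v = {e, f}" "e \<noteq> f" by (auto simp: card_2_iff)
    have efE: "e \<in> E" "f \<in> E" "v \<in> e" "v \<in> f" using ef by (auto simp: D_def)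
    have efU: "e \<notin> U" "f \<notin> U" using noD v ef by auto
    have vO: "v \<in> O'" using v MV noD by (auto simp: O'_def B_def D_def U_def)
    have split: "card e = card (e \<inter> B) + card (e \<inter> O')" if "e \<in> E" for e
    proof -
      have "e = (e \<inter> B) \<union> (e \<inter> O')" using E[OF that] by (auto simp: O'_def)
      moreover have "(e \<inter> B) \<inter> (e \<inter> O') = {}" by (auto simp: O'_def)
      ultimately show ?thesis using finite_edge[OF that] by (metis card_Un_disjoint finite_Int)
    qed
    have one: "1 \<le> card (h \<inter> O')" if "h \<in> E" "v \<in> h" for h
      using that vO finite_edge[OF that(1)] by (auto simp: Suc_le_eq card_gt_0_iff)
    \<comment> \<open>Different uncovered neighbours of the two ends would give an augmenting path,
      on which \<open>v\<close> is replaced by \<open>w\<close> and \<open>w'\<close>.\<close>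
    have same: "g = g'" if w: "w \<in> e" "w \<in> g" "g \<in> U" and w': "w' \<in> f" "w' \<in> g'" "g' \<in> U" for w g w' g'
    proof (rule ccontr)
      assume "g \<noteq> g'"
      have g: "g \<in> E" "g' \<in> E" using w w' by (auto simp: U_def)
      have V: "w \<in> V" "w' \<in> V" using w w' efE E by auto
      have Dw: "D w = {e, g}" "D w' = {f, g'}"
        using D_eq[OF V(1) efE(1) g(1)] D_eq[OF V(2) efE(2) g(2)] w w' efU by auto
      have disj: "D w \<inter> D w' = {}" using Dw ef \<open>g \<noteq> g'\<close> efU w w' by auto
      then have ne: "w \<noteq> w'" using Dw by auto
      have out: "D w \<inter> D x = {}" "D w' \<inter> D x = {}" if "x \<in> M" "x \<noteq> v" for x
        using Mdisj[OF v that(1)] that noD[OF w(3) that(1)] noD[OF w'(3) that(1)] Dw ef by auto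
      have notM: "w \<notin> M" "w' \<notin> M" using noD[OF w(3), of w] noD[OF w'(3), of w'] Dw by auto
      have "good (insert w (insert w' (M - {v})))"
        using M V disj out unfolding good_def by (auto simp: Int_commute)
      then have "card (insert w (insert w' (M - {v}))) \<le> card M" by (rule max)
      moreover have "card (insert w (insert w' (M - {v}))) = Suc (Suc (card M - 1))"
        using notM ne finM v by simp
      ultimately show False using v finM card_gt_0_iff[of M] by (auto simp: card_eq_0_iff)
    qed
    have le1: "card (h \<inter> B) \<le> 1" if h: "h \<in> E" "h \<notin> U"
        and uni: "\<And>w w' g g'. w \<in> h \<Longrightarrow> w \<in> g \<Longrightarrow> g \<in> U \<Longrightarrow> w' \<in> h \<Longrightarrow> w' \<in> g' \<Longrightarrow> g' \<in> U \<Longrightarrow> g = g'" for h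
    proof -
      have "w = w'" if w: "w \<in> h \<inter> B" "w' \<in> h \<inter> B" for w w'
      proof -
        obtain g g' where g: "g \<in> U" "w \<in> g" "g' \<in> U" "w' \<in> g'" using w by (auto simp: B_def)
        have "g = g'" using uni[of w g w' g'] g w by auto
        then have "D w = {h, g}" "D w' = {h, g}"
          using g w h D_eq[of w h g] D_eq[of w' h g] E[OF h(1)] by (auto simp: U_def)
        then show ?thesis using inj[of w w'] w E[OF h(1)] by (auto simp: D_def)
      qed
      then show ?thesis using finite_edge[OF h(1)] by (auto simp: card_le_Suc0_iff_eq)
    qed
    have "4 \<le> card (e \<inter> O') + card (f \<inter> O')"
    proof (cases "e \<inter> B = {} \<or> f \<inter> B = {}")
      case True
      then show ?thesis
        using split[OF efE(1)] split[OF efE(2)] one[OF efE(1,3)] one[OF efE(2,4)] E[OF efE(1)] E[OF efE(2)] by auto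
    next
      case False
      then obtain w g w' g' where "w \<in> e" "w \<in> g" "g \<in> U" "w' \<in> f" "w' \<in> g'" "g' \<in> U"
        by (auto simp: B_def)
      then have "card (e \<inter> B) \<le> 1" "card (f \<inter> B) \<le> 1"
        using same by (intro le1; use efE efU in metis)+
      then show ?thesis
        using split[OF efE(1)] split[OF efE(2)] E[OF efE(1)] E[OF efE(2)] by auto
    qed
    then show ?thesis using ef by simp
  qed
  \<comment> \<open>Double counting: an edge in \<open>O'\<close> has two ends, so it is counted at
    most twice.\<close>
  have "4 * card M \<le> (\<Sum>v\<in>M. \<Sum>e\<in>D v. card (e \<inter> O'))"
    using sum_mono[of M "\<lambda>_. 4" "\<lambda>v. \<Sum>e\<in>D v. card (e \<inter> O')"] four by simp
  also have "\<dots> = (\<Sum>e\<in>C. card (e \<inter> O'))"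
    unfolding C_def using finM finD Mdisj by (intro sum.UNION_disjoint[symmetric]) auto
  also have "\<dots> = (\<Sum>e\<in>C. \<Sum>w\<in>O'. if w \<in> e then 1 else 0)"
    using finB by (intro sum.cong refl) (simp add: sum.If_cases Int_commute Int_def conj_commute)
  also have "\<dots> = (\<Sum>w\<in>O'. \<Sum>e\<in>C. if w \<in> e then 1 else 0)" by (rule sum.swap)
  also have "\<dots> \<le> (\<Sum>w\<in>O'. 2)"
  proof (rule sum_mono)
    fix w assume w: "w \<in> O'"
    have "(\<Sum>e\<in>C. if w \<in> e then 1 else 0) = card {e\<in>C. w \<in> e}"
      using finC by (simp add: sum.If_cases Int_def)
    also have "\<dots> \<le> card (D w)" using CE finD by (intro card_mono) (auto simp: D_def)
    also have "\<dots> = 2" using w two by (auto simp: O'_def D_def)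
    finally show "(\<Sum>e\<in>C. if w \<in> e then 1 else 0) \<le> (2::nat)" .
  qed
  finally have cardO: "2 * card M \<le> card O'" by simp
  have cardV: "card V = card B + card O'"
    using BV fin card_Diff_subset[OF finB(1) BV] card_mono[OF fin(1) BV] by (simp add: O'_def)
  obtain p where p: "\<And>e. e \<in> E \<Longrightarrow> p e \<in> e"
  proof
    fix e assume "e \<in> E"
    then have "e \<noteq> {}" using E by fastforce
    then show "(SOME x. x \<in> e) \<in> e" by (rule some_in_eq[THEN iffD2])
  qed
  define S where "S = M \<union> p ` U"
  have "S \<subseteq> V" using MV p E by (auto simp: S_def U_def)
  moreover have "S \<inter> e \<noteq> {}" if e: "e \<in> E" for e
  proof (cases "e \<in> U")
    case True
    then show ?thesis using p[OF e] by (auto simp: S_def)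
  next
    case False
    then obtain v where "v \<in> M" "v \<in> e" using e by (auto simp: U_def C_def D_def)
    then show ?thesis by (auto simp: S_def)
  qed
  moreover have "card S \<le> card M + card U"
    unfolding S_def using card_Un_le[of M "p ` U"] card_image_le[OF finC(2), of p] by linarith
  ultimately show ?thesis using cardE cardV cardO cardB by (intro exI[of _ S]) auto
qed

text \<open>The bound of Chvatal and McDiarmid and of Tuza. A vertex is chosen greedily whenever at least
  four vertices and edges become irrelevant; otherwise the hypergraph is the dual of a simple graph
  of minimum degree three, and a maximum matching of that graph suffices.\<close>

lemma small_hitting_set:
  fixes V :: "'p set" and E :: "'p set set"
  assumes fin: "finite V" "finite E" and E: "\<And>e. e \<in> E \<Longrightarrow> e \<subseteq> V \<and> 3 \<le> card e"
  shows "\<exists>S\<subseteq>V. (\<forall>e\<in>E. S \<inter> e \<noteq> {}) \<and> 4 * card S \<le> card V + card E"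
  using assms
proof (induction "card V + card E" arbitrary: V E rule: less_induct)
  case less
  note fin = less.prems(1,2) and E = less.prems(3)
  define D where "D v = {e\<in>E. v \<in> e}" for v
  \<comment> \<open>Once \<open>v\<close> is chosen and its edges are deleted, the vertices of
    \<open>W v\<close> are exactly those on no remaining edge.\<close>
  define W where "W v = {u\<in>V. D u \<subseteq> D v}" for v
  have finDW: "finite (D v)" "finite (W v)" for v using fin by (simp_all add: D_def W_def)
  have vW: "v \<in> W v" if "v \<in> V" for v using that by (simp add: W_def)
  consider (drop) v where "v \<in> V" "4 \<le> card (W v) + card (D v)" | (isolated) v where "v \<in> V" "D v = {}"
    | (two) "\<And>v. v \<in> V \<Longrightarrow> card (W v) + card (D v) \<le> 3" "\<And>v. v \<in> V \<Longrightarrow> D v \<noteq> {}"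
  proof -
    have "n \<le> 3" if "\<not> 4 \<le> n" for n :: nat using that by linarith
    then show ?thesis using that by blast
  qed
  then show ?case
  proof cases
    case drop
    have sub: "W v \<subseteq> V" "D v \<subseteq> E" by (auto simp: W_def D_def)
    have le: "card (W v) \<le> card V" "card (D v) \<le> card E" using sub fin by (auto intro: card_mono)
    have c: "card (V - W v) = card V - card (W v)" "card (E - D v) = card E - card (D v)"
      using sub finDW by (auto intro: card_Diff_subset)
    have "\<exists>S\<subseteq>V - W v. (\<forall>e\<in>E - D v. S \<inter> e \<noteq> {}) \<and> 4 * card S \<le> card (V - W v) + card (E - D v)"
    proof (rule less.hyps)
      show "card (V - W v) + card (E - D v) < card V + card E" using c le drop(2) by linarith
      show "e \<subseteq> V - W v \<and> 3 \<le> card e" if "e \<in> E - D v" for e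
        using E[of e] that by (auto simp: W_def D_def)
    qed (use fin in auto)
    then obtain S where S: "S \<subseteq> V - W v" "\<forall>e\<in>E - D v. S \<inter> e \<noteq> {}" "4 * card S \<le> card (V - W v) + card (E - D v)" by blast
    have "card (insert v S) \<le> Suc (card S)" by (rule card_insert_le_m1) auto
    then have "4 * card (insert v S) \<le> card V + card E" using S(3) c le drop(2) by linarith
    moreover have "insert v S \<subseteq> V" using S(1) drop(1) by auto
    moreover have "insert v S \<inter> e \<noteq> {}" if "e \<in> E" for e using S(2) that by (auto simp: D_def)
    ultimately show ?thesis by blast
  next
    case isolated
    have "\<exists>S\<subseteq>V - {v}. (\<forall>e\<in>E. S \<inter> e \<noteq> {}) \<and> 4 * card S \<le> card (V - {v}) + card E"
    proof (rule less.hyps)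
      show "card (V - {v}) + card E < card V + card E" 
        using card_Diff1_less[OF fin(1) isolated(1)] by linarith
      show "e \<subseteq> V - {v} \<and> 3 \<le> card e" if "e \<in> E" for e using E[OF that] isolated that by (auto simp: D_def)
    qed (use fin in auto)
    then obtain S where S: "S \<subseteq> V - {v}" "\<forall>e\<in>E. S \<inter> e \<noteq> {}" "4 * card S \<le> card (V - {v}) + card E" by blast
    have "card (V - {v}) \<le> card V" using fin by (intro card_mono) auto
    then show ?thesis using S by (intro exI[of _ S]) auto
  next
    case two
    have pair: "card (W v) \<ge> 2" if "u \<in> V" "v \<in> V" "u \<noteq> v" "D u \<subseteq> D v" for u v
      using card_mono[OF finDW(2), of "{u, v}" v] that by (auto simp: W_def)
    have le2: "card (D v) \<le> 2" if "v \<in> V" for v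
      using two(1)[OF that] vW[OF that] finDW card_gt_0_iff[of "W v"] by fastforce
    \<comment> \<open>If \<open>e\<close> were the only edge at \<open>v\<close>, a vertex of
      \<open>e\<close> of degree two would make \<open>v\<close> irrelevant as well and reach the
      total 4. So all of \<open>e\<close> lies in \<open>W v\<close>, and \<open>v\<close> reaches
      the total 4 itself.\<close>
    have deg: "card (D v) = 2" if v: "v \<in> V" for v
    proof (rule ccontr)
      assume "card (D v) \<noteq> 2"
      then have "card (D v) = 1" using le2[OF v] two(2)[OF v] finDW(1)[of v]
        by (metis One_nat_def Suc_1 card_0_eq le_SucE le_zero_eq)
      then obtain e where e: "D v = {e}" by (auto simp: card_1_singleton_iff)
      then have eE: "e \<in> E" "v \<in> e" by (auto simp: D_def)
      have Du: "D u = {e}" if u: "u \<in> e" for u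
      proof (rule ccontr)
        assume ne: "D u \<noteq> {e}"
        have uV: "u \<in> V" "e \<in> D u" using u eE E[OF eE(1)] by (auto simp: D_def)
        have "u \<noteq> v" using ne e by auto
        have "card (D u) \<noteq> 1" using ne uV by (auto simp: card_1_singleton_iff)
        moreover have "card (D u) \<noteq> 0" using uV finDW by auto
        ultimately have "card (D u) = 2" using le2[OF uV(1)] by linarith
        moreover have "2 \<le> card (W u)" using pair[OF v uV(1)] e uV \<open>u \<noteq> v\<close> by auto
        ultimately show False using two(1)[OF uV(1)] by linarith
      qed
      have "e \<subseteq> W v" using E[OF eE(1)] Du e by (auto simp: W_def)
      then have "3 \<le> card (W v)" using E[OF eE(1)] card_mono[OF finDW(2), of e v] by linarith
      then show False using two(1)[OF v] \<open>card (D v) = 1\<close> by linarith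
    qed
    show ?thesis
    proof (rule hitting_set_two_regular[OF fin E])
      show "card {e \<in> E. v \<in> e} = 2" if "v \<in> V" for v using deg[OF that] by (simp add: D_def)
      show "u = v" if "u \<in> V" "v \<in> V" "{e \<in> E. u \<in> e} = {e \<in> E. v \<in> e}" for u v
        using pair[OF that(1,2)] that(3) two(1)[OF that(2)] deg[OF that(2)] by (auto simp: D_def)
    qed
  qed
qed

section \<open>Choice of directions when all pairs are of the ordinary kind\<close>

locale pair_family =
  fixes k :: nat and N :: "nat \<times> bool \<Rightarrow> 'q \<Rightarrow> bool"
begin

definition full :: "'q \<Rightarrow> nat \<Rightarrow> bool" where "full b i \<longleftrightarrow> N (i, False) b \<and> N (i, True) b"
definition onlyx :: "'q \<Rightarrow> nat \<Rightarrow> bool" where "onlyx b i \<longleftrightarrow> N (i, False) b \<and> \<not> N (i, True) b"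
definition onlyy :: "'q \<Rightarrow> nat \<Rightarrow> bool" where "onlyy b i \<longleftrightarrow> \<not> N (i, False) b \<and> N (i, True) b"
definition many :: "'q \<Rightarrow> bool" where "many b \<longleftrightarrow> (\<exists>i<k. \<exists>j<k. i \<noteq> j \<and> full b i \<and> full b j)"
text \<open>The direction rule for a sole full zone: go left if some other zone has value 1. Letters
  with two values -1 go right instead; thus a letter using -2 in its sole full zone has at most one
  value -1, which leaves only \<open>k = 3\<close> open in a comparison.\<close>

definition neg :: "'q \<Rightarrow> bool" where
  "neg b \<longleftrightarrow> (\<exists>j<k. onlyy b j) \<and> \<not> (\<exists>i<k. \<exists>j<k. i \<noteq> j \<and> onlyx b i \<and> onlyx b j)"
text \<open>A letter with two full zones takes both extreme values and is therefore neither strictly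
  below nor strictly above any letter.\<close>

definition rank :: "'q \<Rightarrow> nat \<Rightarrow> int" where
  "rank b i = (if full b i then (if (if many b then i = (LEAST j. j < k \<and> full b j) else neg b) then -2 else 2)
     else if onlyx b i then -1 else if onlyy b i then 1 else 0)"

definition less :: "'q \<Rightarrow> 'q \<Rightarrow> bool" where "less b b' \<longleftrightarrow> (\<forall>i<k. rank b i < rank b' i)"

lemma pair_rank_rank: "pair_rank (N (i, False) b) (N (i, True) b) (rank b i)"
  by (auto simp: pair_rank_def rank_def full_def onlyx_def onlyy_def)

lemma rank_bounds: "-2 \<le> rank b i" "rank b i \<le> 2"
  by (auto simp: rank_def)

lemma rank_simps:
  "onlyx b i \<Longrightarrow> rank b i = -1" "onlyy b i \<Longrightarrow> rank b i = 1"
  "\<not> N (i, False) b \<Longrightarrow> \<not> N (i, True) b \<Longrightarrow> rank b i = 0"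
  by (auto simp: rank_def full_def onlyx_def onlyy_def)

lemma many_extremes:
  assumes "many b" shows "\<exists>i<k. rank b i = 2" "\<exists>i<k. rank b i = -2"
proof -
  obtain i j where ij: "i < k" "j < k" "i \<noteq> j" "full b i" "full b j" using assms by (auto simp: many_def)
  define m where "m = (LEAST j. j < k \<and> full b j)"
  have m: "m < k" "full b m" using LeastI[of "\<lambda>j. j < k \<and> full b j" i] ij by (auto simp: m_def)
  have "rank b m = -2" using m assms by (simp add: rank_def m_def)
  then show "\<exists>i<k. rank b i = -2" using m by blast
  have "rank b l = 2" if "full b l" "l \<noteq> m" for l using that assms by (simp add: rank_def m_def)
  then show "\<exists>i<k. rank b i = 2" using ij by metis
qed

lemma less_not_many: "less b b' \<Longrightarrow> \<not> many b" "less b b' \<Longrightarrow> \<not> many b'"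
  using many_extremes rank_bounds unfolding less_def by (metis not_le)+

lemma not_many: "\<not> many b \<Longrightarrow> i < k \<Longrightarrow> j < k \<Longrightarrow> full b i \<Longrightarrow> full b j \<Longrightarrow> i = j"
  by (auto simp: many_def)

lemma rank_neg2: "\<not> many b \<Longrightarrow> rank b i < -1 \<Longrightarrow> full b i \<and> neg b"
  by (auto simp: rank_def split: if_splits)

lemma rank_pos2: "\<not> many b \<Longrightarrow> 1 < rank b i \<Longrightarrow> full b i \<and> \<not> neg b"
  by (auto simp: rank_def split: if_splits)

lemma rep_if_not_less:
  assumes "3 \<le> k" "finite Q" "\<And>b b'. b \<in> Q \<Longrightarrow> b' \<in> Q \<Longrightarrow> \<not> less b b'"
  shows "rep k ({..<k} \<times> UNIV) Q N"
  using assms pair_rank_rank by (intro rep_pair_scheme[where d = rank]) (auto simp: less_def not_less)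

text \<open>Let \<open>b\<close> be strictly below \<open>b'\<close>. The hitting assumption gives
  \<open>b\<close> a zone of value 1, so \<open>b'\<close> has value 2 there. A value -1 of
  \<open>b'\<close> requires the only full zone of \<open>b\<close>, so it occurs at most once, and
  the direction rule leaves \<open>b'\<close> no value 1. Hence \<open>b'\<close> jumps over two
  points, or over at most three with \<open>k = 3\<close>; these sizes are excluded.\<close>

lemma rep_independent:
  assumes k: "3 \<le> k" and fin: "finite Q"
    and hit: "\<And>b. b \<in> Q \<Longrightarrow> \<exists>i<k. N (i, True) b"
    and size: "\<And>b. b \<in> Q \<Longrightarrow> card {a \<in> {..<k} \<times> UNIV. N a b} \<noteq> 2"
      "\<And>b. k = 3 \<Longrightarrow> b \<in> Q \<Longrightarrow> card {a \<in> {..<k} \<times> UNIV. N a b} \<noteq> 3"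
  shows "rep k ({..<k} \<times> UNIV) Q N"
proof (rule rep_if_not_less[OF k fin])
  fix b b' assume b: "b \<in> Q" "b' \<in> Q"
  show "\<not> less b b'"
  proof
    assume less: "less b b'"
    note nm = less_not_many[OF less]
    have lt: "rank b i < rank b' i" if "i < k" for i using less that by (simp add: less_def)
    have "\<exists>j<k. onlyy b j"
    proof -
      obtain j where j: "j < k" "N (j, True) b" using hit[OF b(1)] by blast
      show ?thesis
      proof (cases "full b j")
        case True
        then have "rank b j = -2" using lt[OF j(1)] rank_bounds(2)[of b' j] by (auto simp: rank_def split: if_splits)
        then have "neg b" using rank_neg2[OF nm(1), of j] by simp
        then show ?thesis by (simp add: neg_def)
      next
        case False
        then show ?thesis using j by (auto simp: full_def onlyy_def)
      qed
    qed
    then obtain j where j: "j < k" "onlyy b j" by blast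
    have "1 < rank b' j" using lt[OF j(1)] rank_simps(2)[OF j(2)] by simp
    then have full': "full b' j" "\<not> neg b'" using rank_pos2[OF nm(2)] by blast+
    have x_full: "full b m" if "m < k" "onlyx b' m" for m
      using lt[OF that(1)] rank_simps(1)[OF that(2)] rank_neg2[OF nm(1)] by simp
    have "\<not> (\<exists>i<k. \<exists>j<k. i \<noteq> j \<and> onlyx b' i \<and> onlyx b' j)"
      using x_full not_many[OF nm(1)] by blast
    then have noy: "\<not> onlyy b' m" if "m < k" for m using full'(2) that by (auto simp: neg_def)
    have nofull: "\<not> full b' m" if "m < k" "m \<noteq> j" for m using not_many[OF nm(2) that(1) j(1)] full'(1) that by blast
    have Y': "\<not> N (m, True) b'" if "m < k" "m \<noteq> j" for m
      using noy[OF that(1)] nofull[OF that] by (auto simp: full_def onlyy_def)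
    have X': "full b m" if "m < k" "m \<noteq> j" "N (m, False) b'" for m
      using x_full[OF that(1)] Y'[OF that(1,2)] that(3) by (auto simp: onlyx_def)
    have xb: "onlyx b m" if "m < k" "m \<noteq> j" "\<not> full b m" for m
    proof -
      have "rank b' m = 0" using rank_simps(3) X'[OF that(1,2)] Y'[OF that(1,2)] that(3) by blast
      then show ?thesis using lt[OF that(1)] that(3) by (auto simp: rank_def split: if_splits)
    qed
    have inj2: "card {(j, False), (j, True)} = 2" by simp
    show False
    proof (cases "\<exists>i<k. full b i")
      case False
      then have "{a \<in> {..<k} \<times> UNIV. N a b'} = {(j, False), (j, True)}"
        using X' Y' full'(1) j(1) unfolding full_def by (auto; metis (full_types))
      then show False using size(1)[OF b(2)] inj2 by simp
    next
      case True
      then obtain i where i: "i < k" "full b i" by blast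
      have ij: "i \<noteq> j" using i j by (auto simp: full_def onlyy_def)
      have "rank b i = -2" using lt[OF i(1)] rank_bounds(2)[of b' i] i(2) by (auto simp: rank_def split: if_splits)
      then have "neg b" using rank_neg2[OF nm(1), of i] by simp
      then have two: "m = m'" if "m < k" "m' < k" "onlyx b m" "onlyx b m'" for m m'
        using that by (auto simp: neg_def)
      have xb': "onlyx b m" if "m < k" "m \<noteq> j" "m \<noteq> i" for m
        using xb[OF that(1,2)] not_many[OF nm(1) that(1) i(1) _ i(2)] that(3) by blast
      \<comment> \<open>In all zones other than \<open>i\<close> and \<open>j\<close> the letter
        \<open>b\<close> has value -1, and \<open>neg b\<close> admits only one such zone.\<close>
      have k3: "k = 3"
      proof (rule ccontr)
        assume "k \<noteq> 3"
        then have "4 \<le> k" using k by simp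
        have "card ({..<4} - {i, j}) \<ge> 2" using card_Diff_subset[of "{i, j} \<inter> {..<4}" "{..<4::nat}"]
          card_mono[of "{i, j}" "{i, j} \<inter> {..<4}"] ij by (simp add: Diff_Int)
        then obtain m m' where "m \<in> {..<4} - {i, j}" "m' \<in> {..<4} - {i, j}" "m \<noteq> m'"
          by (metis card_2_iff' card_le_Suc0_iff_eq finite_Diff finite_lessThan not_less_eq_eq numeral_2_eq_2 One_nat_def)
        then show False using two[of m m'] xb' \<open>4 \<le> k\<close> by auto
      qed
      have sub: "{a \<in> {..<k} \<times> UNIV. N a b'} \<subseteq> {(j, False), (j, True), (i, False)}"
        using X' Y' i not_many[OF nm(1)] by (auto; metis (full_types))
      have "{(j, False), (j, True)} \<subseteq> {a \<in> {..<k} \<times> UNIV. N a b'}"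
        using full'(1) j(1) by (auto simp: full_def)
      then have "2 \<le> card {a \<in> {..<k} \<times> UNIV. N a b'}"
        using card_mono[of "{a \<in> {..<k} \<times> UNIV. N a b'}" "{(j, False), (j, True)}"] finite_subset[OF sub] by simp
      moreover have "card {a \<in> {..<k} \<times> UNIV. N a b'} \<le> 3"
        using card_mono[OF _ sub] ij by simp
      ultimately show False using size(1)[OF b(2)] size(2)[OF k3 b(2)] by linarith
    qed
  qed
qed

text \<open>A strict comparison requires -1 below or 1 above in zone 0, and that letter is 0
  elsewhere. So the other letter has constant strict sign in the remaining zones. It has a full zone
  by \<open>noX\<close> or \<open>noY\<close>, and then the direction rule rules out a constant
  sign.\<close>

lemma rep_two_singletons:
  assumes k: "3 \<le> k" and fin: "finite Q"
    and single: "\<And>b i s s'. b \<in> Q \<Longrightarrow> N (0, s) b \<Longrightarrow> i < k \<Longrightarrow> N (i, s') b \<Longrightarrow> i = 0 \<and> s' = s"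
    and noX: "\<And>b. b \<in> Q \<Longrightarrow> \<exists>i<k. i \<noteq> 0 \<and> \<not> onlyx b i"
    and noY: "\<And>b. b \<in> Q \<Longrightarrow> \<exists>i<k. i \<noteq> 0 \<and> \<not> onlyy b i"
  shows "rep k ({..<k} \<times> UNIV) Q N"
proof (rule rep_if_not_less[OF k fin])
  fix b b' assume b: "b \<in> Q" "b' \<in> Q"
  show "\<not> less b b'"
  proof
    assume less: "less b b'"
    note nm = less_not_many[OF less]
    have lt: "rank b i < rank b' i" if "i < k" for i using less that by (simp add: less_def)
    have k0: "0 < k" using k by simp
    have zone0: "rank c 0 = (if N (0, False) c then -1 else if N (0, True) c then 1 else 0)" if "c \<in> Q" for c
      using single[OF that _ k0] by (auto simp: rank_def full_def onlyx_def onlyy_def)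
    have zero: "rank c m = 0" if "c \<in> Q" "N (0, s) c" "m < k" "m \<noteq> 0" for c m s
      using single[OF that(1,2) that(3)] that(4) rank_simps(3) by blast
    consider "N (0, False) b" | "N (0, True) b'"
      using lt[OF k0] zone0[OF b(1)] zone0[OF b(2)] by (auto split: if_splits)
    then show False
    proof cases
      case 1
      have pos: "0 < rank b' m" if "m < k" "m \<noteq> 0" for m using lt[OF that(1)] zero[OF b(1) 1 that] by simp
      have nx: "\<not> onlyx b' m" if m: "m < k" for m
      proof (cases "m = 0")
        case True
        have k1: "1 < k" using k by simp
        show ?thesis using zero[OF b(2), of False 1] pos[OF k1] k1 True by (auto simp: onlyx_def)
      qed (use pos[OF m] rank_simps(1)[of b' m] in auto)
      obtain i where i: "i < k" "i \<noteq> 0" "\<not> onlyy b' i" using noY[OF b(2)] by blast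
      then have "full b' i" using pos[OF i(1,2)] by (auto simp: rank_def split: if_splits)
      moreover have "1 < rank b' i" using pos[OF i(1,2)] \<open>full b' i\<close> by (auto simp: rank_def split: if_splits)
      ultimately have "\<not> neg b'" using rank_pos2[OF nm(2)] by blast
      then have ny: "\<not> onlyy b' m" if "m < k" for m using nx that by (auto simp: neg_def)
      obtain m where m: "m < k" "m \<noteq> 0" "m \<noteq> i" using ex_third[OF k] by blast
      then have "full b' m" using pos[OF m(1,2)] ny by (auto simp: rank_def split: if_splits)
      then show False using not_many[OF nm(2)] m i \<open>full b' i\<close> by blast
    next
      case 2
      have neg: "rank b m < 0" if "m < k" "m \<noteq> 0" for m using lt[OF that(1)] zero[OF b(2) 2 that] by simp
      have ny: "\<not> onlyy b m" if m: "m < k" for m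
      proof (cases "m = 0")
        case True
        have k1: "1 < k" using k by simp
        show ?thesis using zero[OF b(1), of True 1] neg[OF k1] k1 True by (auto simp: onlyy_def)
      qed (use neg[OF m] rank_simps(2)[of b m] in auto)
      obtain i where i: "i < k" "i \<noteq> 0" "\<not> onlyx b i" using noX[OF b(1)] by blast
      then have "full b i" using neg[OF i(1,2)] by (auto simp: rank_def split: if_splits)
      then have "rank b i < -1" using neg[OF i(1,2)] by (auto simp: rank_def split: if_splits)
      then have "neg b" using rank_neg2[OF nm(1)] by blast
      then show False using ny by (auto simp: neg_def)
    qed
  qed
qed

end

section \<open>Choice of directions around a centre pair\<close>

context pair_family
begin

definition exc :: "'q \<Rightarrow> bool" where "exc b \<longleftrightarrow> N (k - 1, True) b \<and> \<not> N (k - 1, False) b"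

text \<open>If \<open>J\<close> has at least two zones, a letter that is not exceptional and has a
  full zone in \<open>J\<close> is neither negative nor nonnegative on all of \<open>J\<close>.
  Exceptional letters go right, against their low value in zone 1.\<close>

definition crank :: "nat set \<Rightarrow> 'q \<Rightarrow> nat \<Rightarrow> int" where
  "crank J b i = (if full b i then
      (if exc b then 2
       else if \<exists>i\<in>J. \<exists>j\<in>J. i \<noteq> j \<and> full b i \<and> full b j then (if i = (LEAST j. j \<in> J \<and> full b j) then -2 else 2)
       else if \<forall>j\<in>J - {i}. onlyx b j then 2 else -2)
     else if onlyx b i then -1 else if onlyy b i then 1 else 0)"

lemma crank_bounds: "-2 \<le> crank J b i" "crank J b i \<le> 2"
  by (auto simp: crank_def)

lemma crank_simps:
  "onlyx b i \<Longrightarrow> crank J b i = -1" "onlyy b i \<Longrightarrow> crank J b i = 1"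
  by (auto simp: crank_def full_def onlyx_def onlyy_def)

lemma crank_full: "full b i \<Longrightarrow> crank J b i = -2 \<or> crank J b i = 2"
  by (auto simp: crank_def)

lemma pair_rank_crank: "pair_rank (N (i, False) b) (N (i, True) b) (crank J b i)"
proof (cases "full b i")
  case True
  then show ?thesis using crank_full[OF True, of J] by (simp add: pair_rank_def full_def disj_commute)
next
  case False
  then show ?thesis by (simp add: crank_def pair_rank_def full_def onlyx_def onlyy_def)
qed

lemma crank_not_full: "\<not> full b i \<Longrightarrow> -1 \<le> crank J b i \<and> crank J b i \<le> 1"
  by (auto simp: crank_def)

lemma crank_many:
  assumes "i \<in> J" "j \<in> J" "i \<noteq> j" "full b i" "full b j" "\<not> exc b"
  shows "\<exists>i\<in>J. crank J b i = 2" "\<exists>i\<in>J. crank J b i = -2"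
proof -
  define m where "m = (LEAST j. j \<in> J \<and> full b j)"
  have m: "m \<in> J" "full b m" using LeastI[of "\<lambda>j. j \<in> J \<and> full b j" i] assms by (auto simp: m_def)
  have c: "\<exists>i\<in>J. \<exists>j\<in>J. i \<noteq> j \<and> full b i \<and> full b j" using assms by blast
  have "crank J b m = -2" using m assms(6) c by (simp add: crank_def m_def)
  then show "\<exists>i\<in>J. crank J b i = -2" using m by blast
  have "crank J b l = 2" if "full b l" "l \<noteq> m" for l
    using that assms(6) c by (simp add: crank_def m_def)
  then show "\<exists>i\<in>J. crank J b i = 2" using assms by metis
qed

lemma crank_one:
  assumes "i \<in> J" "full b i" "\<not> exc b" "\<And>j. j \<in> J \<Longrightarrow> j \<noteq> i \<Longrightarrow> \<not> full b j"
  shows "crank J b i = (if \<forall>j\<in>J - {i}. onlyx b j then 2 else -2)"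
  using assms by (auto simp: crank_def)

text \<open>Full zones have extreme values, so the middle letter has none and stays between -1 and
  1. The top letter is then nonnegative throughout, which by the direction rule excludes full zones;
  so the middle letter is at most 0, the bottom letter is negative throughout, and full zones are
  excluded there too. Only -1, 0, 1 remain.\<close>

lemma crank_chain:
  assumes J: "\<And>i. \<exists>j\<in>J. j \<noteq> i" and exc: "\<not> exc b" "\<not> exc b2"
    and lt: "\<And>i. i \<in> J \<Longrightarrow> crank J b1 i < crank J b i" "\<And>i. i \<in> J \<Longrightarrow> crank J b i < crank J b2 i"
    and i: "i \<in> J"
  shows "onlyx b1 i" "\<not> N (i, False) b" "\<not> N (i, True) b" "onlyy b2 i"
proof -
  have nf: "\<not> full b i" if "i \<in> J" for i
    using crank_full[of b i J] lt[OF that] crank_bounds[of J b1 i] crank_bounds[of J b2 i] by auto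
  have b: "-1 \<le> crank J b i" "crank J b i \<le> 1" if "i \<in> J" for i using crank_not_full[OF nf[OF that]] by auto
  have nf2: "\<not> full b2 i" if i: "i \<in> J" for i
  proof
    assume f: "full b2 i"
    have pos: "crank J b2 j \<ge> 0" if "j \<in> J" for j using lt(2)[OF that] b[OF that] by simp
    have one: "\<not> full b2 j" if "j \<in> J" "j \<noteq> i" for j
      using crank_many(2)[OF that(1) i that(2) _ f exc(2)] pos by fastforce
    have "crank J b2 i \<noteq> -2" using pos[OF i] by simp
    then have x: "\<forall>j\<in>J - {i}. onlyx b2 j" using crank_one[OF i f exc(2) one] by (metis (full_types))
    obtain j where "j \<in> J" "j \<noteq> i" using J by blast
    then show False using pos[of j] crank_simps(1)[of b2 j J] x by auto
  qed
  have b0: "crank J b i \<le> 0" if "i \<in> J" for i using lt(2)[OF that] crank_not_full[OF nf2[OF that], of J] by linarith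
  have nf1: "\<not> full b1 i" if i: "i \<in> J" for i
  proof
    assume f: "full b1 i"
    have neg: "crank J b1 j < 0" if "j \<in> J" for j using lt(1)[OF that] b0[OF that] by simp
    show False
    proof (cases "exc b1")
      case True
      then show False using f neg[OF i] by (simp add: crank_def)
    next
      case False
      have one: "\<not> full b1 j" if "j \<in> J" "j \<noteq> i" for j
        using crank_many(1)[OF that(1) i that(2) _ f False] neg by fastforce
      have "onlyx b1 j" if "j \<in> J" "j \<noteq> i" for j
        using neg[OF that(1)] one[OF that] by (auto simp: crank_def split: if_splits)
      then have "crank J b1 i = 2" using crank_one[OF i f False one] by auto
      then show False using neg[OF i] by simp
    qed
  qed
  have "crank J b1 i < 0" using lt(1)[OF i] b0[OF i] by simp
  then show "onlyx b1 i" using nf1[OF i] by (auto simp: crank_def split: if_splits)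
  then have "crank J b i = 0" using crank_simps(1)[of b1 i J] lt(1)[OF i] b0[OF i] by simp
  then show "\<not> N (i, False) b" "\<not> N (i, True) b" "onlyy b2 i"
    using nf[OF i] nf2[OF i] lt(2)[OF i] by (auto simp: crank_def full_def onlyx_def onlyy_def split: if_splits)
qed

text \<open>No letter is exceptional, so in any chain the bottom letter has only first members and
  the middle letter nothing in the ordinary zones. Each alternative of \<open>empty\<close> forbids
  one of the two.\<close>

lemma rep_dominated:
  assumes k: "3 \<le> k" and fin: "finite Q"
    and dom: "\<And>b. b \<in> Q \<Longrightarrow> N (k - 1, True) b \<Longrightarrow> N (k - 1, False) b"
    and empty: "(\<forall>b\<in>Q. N (k - 1, False) b \<longrightarrow> (\<exists>i<k - 1. \<exists>s. N (i, s) b)) \<or> (\<forall>b\<in>Q. \<exists>i<k - 1. \<not> onlyx b i)"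
  shows "rep k ({..<k} \<times> UNIV) Q N"
proof (rule rep_center_scheme[OF k fin, where ins = False and e = "crank {..<k - 1}"])
  have exc: "\<not> exc b" if "b \<in> Q" for b using dom that by (auto simp: exc_def)
  have J: "\<exists>j\<in>{..<k - 1}. j \<noteq> i" for i using k by (intro bexI[of _ "if i = 0 then 1 else 0"]) auto
  fix b assume b: "b \<in> Q" "N (k - 1, False) b"
  show "(\<forall>b'\<in>Q. \<exists>i<k - 1. crank {..<k - 1} b' i \<le> crank {..<k - 1} b i) \<or>
    (\<forall>b'\<in>Q. \<exists>i<k - 1. crank {..<k - 1} b i \<le> crank {..<k - 1} b' i)"
  proof (rule ccontr)
    assume "\<not> ?thesis"
    then obtain b1 b2 where b12: "b1 \<in> Q" "b2 \<in> Q"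
      "\<And>i. i \<in> {..<k - 1} \<Longrightarrow> crank {..<k - 1} b1 i < crank {..<k - 1} b i"
      "\<And>i. i \<in> {..<k - 1} \<Longrightarrow> crank {..<k - 1} b i < crank {..<k - 1} b2 i"
      by (auto simp: not_le)
    note c = crank_chain[OF J exc[OF b(1)] exc[OF b12(2)] b12(3,4)]
    have "\<not> N (i, s) b" if "i < k - 1" for i s using c(2,3)[of i] that by (cases s) auto
    then show False using empty b b12(1) c(1) by (metis lessThan_iff)
  qed
qed (use dom pair_rank_crank in auto)

text \<open>Zone 1 carries the inserted copy of \<open>z\<close>, and two other ordinary zones must
  remain for \<open>crank_chain\<close>, hence \<open>4 \<le> k\<close>. In zone 1 a middle value -1
  forces an exceptional bottom letter; any other middle value forces the top letter over the second
  member.\<close>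

lemma rep_center_exceptional:
  assumes k: "4 \<le> k" and fin: "finite Q"
    and excp: "\<And>b. b \<in> Q \<Longrightarrow> exc b \<Longrightarrow> N (1, False) b \<and> (\<exists>i<k - 1. i \<noteq> 1 \<and> \<not> onlyx b i)"
    and noY: "\<And>b. b \<in> Q \<Longrightarrow> \<exists>i<k - 1. \<not> N (i, True) b \<or> i \<noteq> 1 \<and> N (i, False) b"
  shows "rep k ({..<k} \<times> UNIV) Q N"
proof -
  define J where "J = {..<k - 1} - {1}"
  define e where "e b i = (if i = 1 then
      (if exc b then (if N (1, True) b then -3 else -2)
       else if full b 1 then 2 else if onlyx b 1 then -1 else if onlyy b 1 then 1 else 0)
    else crank J b i)" for b i
  have J: "\<exists>j\<in>J. j \<noteq> i" for i using k by (intro bexI[of _ "if i = 0 then 2 else 0"]) (auto simp: J_def)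
  show ?thesis
  proof (rule rep_center_scheme[OF _ fin, where ins = True and e = e])
    fix b assume b: "b \<in> Q" "N (k - 1, False) b"
    then have nexc: "\<not> exc b" by (simp add: exc_def)
    show "(\<forall>b'\<in>Q. \<exists>i<k - 1. e b' i \<le> e b i) \<or> (\<forall>b'\<in>Q. \<exists>i<k - 1. e b i \<le> e b' i)"
    proof (rule ccontr)
      assume "\<not> ?thesis"
      then obtain b1 b2 where b12: "b1 \<in> Q" "b2 \<in> Q"
        "\<And>i. i < k - 1 \<Longrightarrow> e b1 i < e b i" "\<And>i. i < k - 1 \<Longrightarrow> e b i < e b2 i"
        by (auto simp: not_le)
      have k1: "1 < k - 1" using k by simp
      have lt1: "e b1 1 < e b 1" "e b 1 < e b2 1" using b12(3,4) k1 by auto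
      have nexc2: "\<not> exc b2" using lt1 nexc by (auto simp: e_def split: if_splits)
      have lt: "crank J b1 i < crank J b i" "crank J b i < crank J b2 i" if "i \<in> J" for i
        using b12(3,4)[of i] that by (auto simp: J_def e_def)
      note c = crank_chain[OF J nexc nexc2 lt]
      have nf: "\<not> full b 1" using lt1 nexc nexc2 by (auto simp: e_def split: if_splits)
      show False
      proof (cases "e b 1 = -1")
        case True
        then have "exc b1" using lt1 by (auto simp: e_def split: if_splits)
        then show False using excp[OF b12(1)] c(1) by (auto simp: J_def)
      next
        case False
        then have "N (1, True) b2"
          using lt1 nexc nexc2 nf by (auto simp: e_def full_def onlyx_def onlyy_def split: if_splits)
        then have "N (i, True) b2" "i \<noteq> 1 \<Longrightarrow> \<not> N (i, False) b2" if "i < k - 1" for i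
          using c(4)[of i] that by (auto simp: J_def onlyy_def)
        then show False using noY[OF b12(2)] by blast
      qed
    qed
  qed (use k excp pair_rank_crank in \<open>auto simp: e_def exc_def pair_rank_def full_def onlyx_def onlyy_def\<close>)
qed

definition pattern :: "'q \<Rightarrow> bool \<times> bool \<times> bool \<times> bool" where
  "pattern b = (N (1, False) b, N (1, True) b, N (0, False) b, N (0, True) b)"

text \<open>
  The patterns for which the displacements of \<open>b1\<close>, \<open>b\<close>, \<open>b2\<close> in the zones \<open>0\<close> and \<open>1\<close> can form a strict chain.
  The flag \<open>\<chi>\<close> is the direction in zone \<open>0\<close> of a letter that is not exceptional and jumps over both
  members of pair \<open>0\<close> and over neither member of pair \<open>1\<close>.
\<close>

definition chain3 :: "bool \<Rightarrow> 'q \<Rightarrow> 'q \<Rightarrow> 'q \<Rightarrow> bool" where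
  "chain3 \<chi> b1 b b2 \<longleftrightarrow>
    (let u1 = pattern b1; u = pattern b; u2 = pattern b2;
         r1 = (exc b1 \<and> N (0, False) b1 \<and> \<not> N (0, True) b1)
     in u = (True, False, False, False) \<and> r1 \<and>
          (u2 \<in> {(False, False, False, True), (False, True, False, True), (True, True, False, True)} \<or>
           \<chi> \<and> u2 = (False, False, True, True))
      \<or> u = (True, False, False, True) \<and> exc b1 \<and> \<not> N (0, True) b1 \<and> \<chi> \<and> u2 = (False, False, True, True)
      \<or> u = (False, True, False, False) \<and> (r1 \<or> \<not> exc b1 \<and>
           (u1 \<in> {(False, False, True, False), (True, False, True, False)} \<or> \<not> \<chi> \<and> u1 = (False, False, True, True))) \<and>
          u2 = (True, True, False, True)
      \<or> u = (False, True, True, False) \<and> \<not> exc b1 \<and> \<not> \<chi> \<and> u1 = (False, False, True, True) \<and>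
          u2 \<in> {(True, True, False, False), (True, True, False, True)}
      \<or> u = (False, False, False, False) \<and> (r1 \<or> \<not> exc b1 \<and> u1 = (True, False, True, False)) \<and>
          u2 \<in> {(False, True, False, True), (True, True, False, True)})"

text \<open>Only zone 0 is left beside zone 1 and the centre pair, so the sign argument has no
  second zone to work with; the possible chains are listed instead.\<close>

lemma rep_center_three:
  assumes k: "k = 3" and fin: "finite Q"
    and excp: "\<And>b. b \<in> Q \<Longrightarrow> exc b \<Longrightarrow> N (1, False) b"
    and chain: "\<And>b1 b b2. b1 \<in> Q \<Longrightarrow> b \<in> Q \<Longrightarrow> b2 \<in> Q \<Longrightarrow> N (2, False) b \<Longrightarrow> \<not> exc b2 \<Longrightarrow> \<not> chain3 \<chi> b1 b b2"
  shows "rep k ({..<k} \<times> UNIV) Q N"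
proof -
  \<comment> \<open>In zone 0 a jump over both members goes against the sign in zone 1;
    \<open>\<chi>\<close> decides when the value there is 0.\<close>
  define e :: "'q \<Rightarrow> nat \<Rightarrow> int" where "e b i = (if i = 1 then
      (if exc b then (if N (1, True) b then -3 else -2)
       else if full b 1 then 2 else if onlyx b 1 then -1 else if onlyy b 1 then 1 else 0)
    else if full b i then
      (if exc b then 2 else if N (1, True) b then -2 else if N (1, False) b then 2 else if \<chi> then 2 else -2)
    else if onlyx b i then -1 else if onlyy b i then 1 else 0)" for b i
  show ?thesis
  proof (rule rep_center_scheme[OF _ fin, where ins = True and e = e])
    fix b assume b: "b \<in> Q" "N (k - 1, False) b"
    then have nexc: "\<not> exc b" by (simp add: exc_def)
    show "(\<forall>b'\<in>Q. \<exists>i<k - 1. e b' i \<le> e b i) \<or> (\<forall>b'\<in>Q. \<exists>i<k - 1. e b i \<le> e b' i)"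
    proof (rule ccontr)
      assume "\<not> ?thesis"
      then obtain b1 b2 where b12: "b1 \<in> Q" "b2 \<in> Q"
        "\<And>i. i < k - 1 \<Longrightarrow> e b1 i < e b i" "\<And>i. i < k - 1 \<Longrightarrow> e b i < e b2 i"
        by (auto simp: not_le)
      have lt: "e b1 0 < e b 0" "e b1 1 < e b 1" "e b 0 < e b2 0" "e b 1 < e b2 1" using b12(3,4) k by auto
      have nexc2: "\<not> exc b2" using lt(2,4) nexc by (auto simp: e_def split: if_splits)
      have e0: "-2 \<le> e c 0" "e c 0 \<le> 2" for c by (simp_all add: e_def)
      have e1: "e c 1 \<le> 2" for c by (simp add: e_def)
      have nf: "\<not> full b 0" "\<not> full b 1"
      proof -
        show "\<not> full b 0"
        proof
          assume "full b 0"
          then have "e b 0 = -2 \<or> e b 0 = 2" by (simp add: e_def)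
          then show False using lt(1,3) e0[of b1] e0[of b2] by linarith
        qed
        show "\<not> full b 1"
        proof
          assume "full b 1"
          then have "e b 1 = 2" using nexc by (simp add: e_def)
          then show False using lt(4) e1[of b2] by linarith
        qed
      qed
      define r1 where "r1 \<longleftrightarrow> exc b1 \<and> N (0, False) b1 \<and> \<not> N (0, True) b1"
      \<comment> \<open>What the comparison of \<open>b1\<close> with \<open>b\<close> in both zones
        implies, sorted by the pattern of the middle letter; \<open>B\<close> does the same for
        \<open>b\<close> and \<open>b2\<close>.\<close>
      have A: "case pattern b of (p, q, r, s) \<Rightarrow>
          (p \<and> \<not> s \<longrightarrow> r1 \<and> \<not> r) \<and> (p \<and> s \<longrightarrow> exc b1 \<and> \<not> N (0, True) b1) \<and>
          (q \<and> r \<longrightarrow> \<not> exc b1 \<and> \<not> \<chi> \<and> pattern b1 = (False, False, True, True)) \<and>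
          (q \<and> \<not> r \<and> \<not> s \<longrightarrow> r1 \<or> \<not> exc b1 \<and>
            (pattern b1 \<in> {(False, False, True, False), (True, False, True, False)} \<or>
             \<not> \<chi> \<and> pattern b1 = (False, False, True, True))) \<and>
          (\<not> p \<and> \<not> q \<and> \<not> s \<longrightarrow> \<not> r \<and> (r1 \<or> \<not> exc b1 \<and> pattern b1 = (True, False, True, False)))"
      proof (cases "exc b1")
        case True
        then show ?thesis using lt(1,2) nexc nf
          unfolding e_def r1_def pattern_def full_def onlyx_def onlyy_def
          by (cases "N (0, False) b1"; cases "N (0, True) b1") (simp_all split: if_splits)
      next
        case False
        then show ?thesis using lt(1,2) nexc nf
          unfolding e_def r1_def pattern_def full_def onlyx_def onlyy_def
          by (cases "N (1, False) b1"; cases "N (1, True) b1"; cases "N (0, False) b1"; cases "N (0, True) b1")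
             (simp_all split: if_splits)
      qed
      have B: "case pattern b of (p, q, r, s) \<Rightarrow>
          (p \<and> \<not> s \<and> \<not> r \<longrightarrow> pattern b2 \<in> {(False, False, False, True), (False, True, False, True), (True, True, False, True)} \<or>
             \<chi> \<and> pattern b2 = (False, False, True, True)) \<and>
          (p \<and> s \<longrightarrow> \<chi> \<and> pattern b2 = (False, False, True, True)) \<and>
          (q \<and> r \<longrightarrow> pattern b2 \<in> {(True, True, False, False), (True, True, False, True)}) \<and>
          (q \<and> \<not> r \<longrightarrow> \<not> s \<and> pattern b2 = (True, True, False, True)) \<and>
          (\<not> p \<and> \<not> q \<and> \<not> r \<longrightarrow> \<not> s \<and> pattern b2 \<in> {(False, True, False, True), (True, True, False, True)})"
        using lt(3,4) nexc nexc2 nf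
        unfolding e_def pattern_def full_def onlyx_def onlyy_def
        by (cases "N (1, False) b2"; cases "N (1, True) b2"; cases "N (0, False) b2"; cases "N (0, True) b2")
           (simp_all split: if_splits)
      have "chain3 \<chi> b1 b b2"
        using A B nf unfolding chain3_def Let_def r1_def[symmetric]
        by (cases "N (1, False) b"; cases "N (1, True) b"; cases "N (0, False) b"; cases "N (0, True) b")
           (simp_all add: pattern_def[of b] full_def)
      then show False using chain[OF b12(1) b(1) b12(2)] b(2) nexc2 k by simp
    qed
  next
    fix b i assume b: "b \<in> Q" and "i < k - 1" "\<not> (True \<and> i = 1)"
    then have "i = 0" using k by auto
    then show "pair_rank (N (i, False) b) (N (i, True) b) (e b i)"
      by (auto simp: e_def pair_rank_def full_def onlyx_def onlyy_def)
  next
    fix b assume b: "b \<in> Q" and "\<not> (N (k - 1, True) b \<and> \<not> N (k - 1, False) b)"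
    then have "\<not> exc b" by (simp add: exc_def)
    then show "pair_rank (N (1, False) b) (N (1, True) b) (e b 1) \<and> e b 1 \<noteq> -2"
      by (auto simp: e_def pair_rank_def full_def onlyx_def onlyy_def)
  next
    fix b assume b: "b \<in> Q" and "N (k - 1, True) b" "\<not> N (k - 1, False) b"
    then have "exc b" by (simp add: exc_def)
    then show "True \<and> N (1, False) b \<and> e b 1 = (if N (1, True) b then - 3 else - 2)"
      using excp[OF b] by (simp add: e_def)
  qed (use k in simp)
qed

end

section \<open>From indexed pairs to sets of points\<close>

lemma inj_on_nth_pair:
  assumes len: "length xs = k" "length ys = k" and dist: "distinct (xs @ ys)"
  shows "inj_on (\<lambda>(i, s). (if s then ys else xs) ! i) ({..<k} \<times> UNIV)"
proof (rule inj_onI)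
  fix u v assume uv: "u \<in> {..<k} \<times> (UNIV :: bool set)" "v \<in> {..<k} \<times> (UNIV :: bool set)"
    "(\<lambda>(i, s). (if s then ys else xs) ! i) u = (\<lambda>(i, s). (if s then ys else xs) ! i) v"
  obtain i s j t where ij: "u = (i, s)" "v = (j, t)" by (cases u; cases v)
  have lt: "i < k" "j < k" using uv ij by auto
  have eq: "(if s then ys else xs) ! i = (if t then ys else xs) ! j" using uv(3) ij by simp
  have "xs ! m \<noteq> ys ! n" if "m < k" "n < k" for m n
  proof
    assume "xs ! m = ys ! n"
    moreover have "xs ! m \<in> set xs" "ys ! n \<in> set ys" using len that by auto
    ultimately show False using dist by auto
  qed
  then have "s = t" using eq lt by (cases s; cases t) (simp_all, metis)
  moreover have "i = j" using eq lt len dist \<open>s = t\<close> by (cases t) (simp_all add: nth_eq_iff_index_eq)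
  ultimately show "u = v" using ij by simp
qed

lemma rep_lists:
  assumes len: "length xs = k" "length ys = k" and dist: "distinct (xs @ ys)"
    and rep: "rep k ({..<k} \<times> UNIV) Q (\<lambda>(i, s) b. N ((if s then ys else xs) ! i) b)"
  shows "rep k (set xs \<union> set ys) Q N"
proof -
  define h where "h = (\<lambda>(i, s). (if s then ys else xs) ! i)"
  have inj: "inj_on h ({..<k} \<times> UNIV)" unfolding h_def using len dist by (rule inj_on_nth_pair)
  have "h ` ({..<k} \<times> UNIV) = set xs \<union> set ys"
  proof -
    have "h ` ({..<k} \<times> UNIV) = (\<lambda>i. xs ! i) ` {..<k} \<union> (\<lambda>i. ys ! i) ` {..<k}"
      by (force simp: h_def image_iff)
    then show ?thesis using len nth_image[of k xs] nth_image[of k ys] by (simp add: lessThan_atLeast0)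
  qed
  then show ?thesis
    using rep_reindex[OF rep inj inj_on_id, of N] by (auto simp: h_def)
qed

lemma ex_list: "finite A \<Longrightarrow> \<exists>xs. set xs = A \<and> distinct xs \<and> length xs = card A"
  by (metis finite_distinct_list distinct_card)

lemma rep_if_hit:
  assumes k: "3 \<le> k" and fin: "finite P" "finite Q" and card: "card P = 2 * k"
    and Y: "Y \<subseteq> P" "card Y = k" and hit: "\<And>b. b \<in> Q \<Longrightarrow> \<exists>a\<in>Y. N a b"
    and size: "\<And>b. b \<in> Q \<Longrightarrow> card {a\<in>P. N a b} \<noteq> 2" "\<And>b. k = 3 \<Longrightarrow> b \<in> Q \<Longrightarrow> card {a\<in>P. N a b} \<noteq> 3"
  shows "rep k P Q N"
proof -
  have finY: "finite Y" "finite (P - Y)" using fin Y finite_subset by auto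
  have cX: "card (P - Y) = k" using Y card finY by (simp add: card_Diff_subset)
  obtain xs where xs: "set xs = P - Y" "distinct xs" "length xs = k" using ex_list[OF finY(2)] cX by metis
  obtain ys where ys: "set ys = Y" "distinct ys" "length ys = k" using ex_list[OF finY(1)] Y(2) by metis
  define N' where "N' = (\<lambda>(i, s) b. N ((if s then ys else xs) ! i) b)"
  have dist: "distinct (xs @ ys)" using xs ys by auto
  have P: "set xs \<union> set ys = P" using xs ys Y by auto
  have count: "card {a \<in> {..<k} \<times> UNIV. N' a b} = card {a\<in>P. N a b}" for b
  proof -
    define h where "h = (\<lambda>(i, s). (if s then ys else xs) ! i)"
    have inj: "inj_on h ({..<k} \<times> UNIV)" unfolding h_def using xs(3) ys(3) dist by (rule inj_on_nth_pair)
    have "h ` {a \<in> {..<k} \<times> UNIV. N' a b} = {a\<in>P. N a b}"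
    proof
      show "h ` {a \<in> {..<k} \<times> UNIV. N' a b} \<subseteq> {a\<in>P. N a b}"
        using P xs(3) ys(3) by (force simp: h_def N'_def)
      show "{a\<in>P. N a b} \<subseteq> h ` {a \<in> {..<k} \<times> UNIV. N' a b}"
      proof
        fix a assume a: "a \<in> {a\<in>P. N a b}"
        then consider i where "i < k" "a = xs ! i" | i where "i < k" "a = ys ! i"
          using P xs(3) ys(3) by (metis (no_types, lifting) Un_iff in_set_conv_nth mem_Collect_eq)
        then show "a \<in> h ` {a \<in> {..<k} \<times> UNIV. N' a b}"
        proof cases
          case 1 then show ?thesis using a by (intro image_eqI[of _ _ "(i, False)"]) (auto simp: h_def N'_def)
        next
          case 2 then show ?thesis using a by (intro image_eqI[of _ _ "(i, True)"]) (auto simp: h_def N'_def)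
        qed
      qed
    qed
    then show ?thesis using card_image[OF inj_on_subset[OF inj, of "{a \<in> {..<k} \<times> UNIV. N' a b}"]] by auto
  qed
  have "rep k ({..<k} \<times> UNIV) Q N'"
  proof (rule pair_family.rep_independent[OF k fin(2)])
    fix b assume "b \<in> Q"
    then obtain a where "a \<in> set ys" "N a b" using hit ys by blast
    then show "\<exists>i<k. N' (i, True) b" using ys(3) by (auto simp: N'_def in_set_conv_nth)
  qed (use size count in auto)
  then show ?thesis using rep_lists[OF xs(3) ys(3) dist, of Q N] P by (simp add: N'_def)
qed

text \<open>\<open>z\<close> and \<open>u\<close> occupy zone 0 and \<open>X\<close> supplies the
  other first members. The two sets excluded by \<open>ne\<close> are the traces with exactly the
  first, or exactly the second, member of every remaining pair.\<close>

lemma rep_if_two_isolated: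
  assumes k: "3 \<le> k" and fin: "finite P" "finite Q" and card: "card P = 2 * k"
    and zu: "z \<in> P" "u \<in> P" "z \<noteq> u"
    and single: "\<And>b a. b \<in> Q \<Longrightarrow> a \<in> P \<Longrightarrow> N a b \<Longrightarrow> N z b \<Longrightarrow> a = z" "\<And>b a. b \<in> Q \<Longrightarrow> a \<in> P \<Longrightarrow> N a b \<Longrightarrow> N u b \<Longrightarrow> a = u"
    and X: "X \<subseteq> P - {z, u}" "card X = k - 1"
    and ne: "\<And>b. b \<in> Q \<Longrightarrow> {a\<in>P - {z, u}. N a b} \<noteq> X" "\<And>b. b \<in> Q \<Longrightarrow> {a\<in>P - {z, u}. N a b} \<noteq> P - {z, u} - X"
  shows "rep k P Q N"
proof -
  define Y where "Y = P - {z, u} - X"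
  have finX: "finite X" "finite Y" using fin X finite_subset by (auto simp: Y_def)
  have "card (P - {z, u}) = 2 * k - 2" using zu card fin by (simp add: card_Diff_subset)
  then have cY: "card Y = k - 1" using X finX by (simp add: Y_def card_Diff_subset)
  obtain xs where xs: "set xs = X" "distinct xs" "length xs = k - 1" using ex_list[OF finX(1)] X(2) by metis
  obtain ys where ys: "set ys = Y" "distinct ys" "length ys = k - 1" using ex_list[OF finX(2)] cY by metis
  define N' where "N' = (\<lambda>(i, s) b. N ((if s then u # ys else z # xs) ! i) b)"
  have dist: "distinct ((z # xs) @ (u # ys))" using xs ys X zu by (auto simp: Y_def)
  have P: "set (z # xs) \<union> set (u # ys) = P" using xs ys X zu by (auto simp: Y_def)
  have len: "length (z # xs) = k" "length (u # ys) = k" using xs ys k by auto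
  have mem: "(z # xs) ! i \<in> P" "(u # ys) ! i \<in> P" if "i < k" for i
  proof -
    have "(z # xs) ! i \<in> set (z # xs)" "(u # ys) ! i \<in> set (u # ys)"
      by (rule nth_mem, use that len in simp)+
    then show "(z # xs) ! i \<in> P" "(u # ys) ! i \<in> P" using P by blast+
  qed
  have N0: "N' (0, False) b = N z b" "N' (0, True) b = N u b" for b by (simp_all add: N'_def)
  have zi: "(z # xs) ! i = z \<longleftrightarrow> i = 0" "(u # ys) ! i = u \<longleftrightarrow> i = 0" "(z # xs) ! i \<noteq> u" "(u # ys) ! i \<noteq> z" if "i < k" for i
  proof -
    have "distinct (z # xs)" "distinct (u # ys)" "u \<notin> set (z # xs)" "z \<notin> set (u # ys)" using dist by auto
    then show "(z # xs) ! i = z \<longleftrightarrow> i = 0" "(u # ys) ! i = u \<longleftrightarrow> i = 0" "(z # xs) ! i \<noteq> u" "(u # ys) ! i \<noteq> z"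
      using that len nth_eq_iff_index_eq[of "z # xs" i 0] nth_eq_iff_index_eq[of "u # ys" i 0] nth_mem[of i "z # xs"] nth_mem[of i "u # ys"]
      by auto
  qed
  have tail: "\<exists>i<k. i \<noteq> 0 \<and> (z # xs) ! i = a" if "a \<in> X" for a
    using that xs len by (metis in_set_conv_nth nth_Cons_Suc length_Cons Suc_less_eq nat.distinct(1))
  have tail': "\<exists>i<k. i \<noteq> 0 \<and> (u # ys) ! i = a" if "a \<in> Y" for a
    using that ys len by (metis in_set_conv_nth nth_Cons_Suc length_Cons Suc_less_eq nat.distinct(1))
  have memXY: "(z # xs) ! i \<in> X" "(u # ys) ! i \<in> Y" if "i < k" "i \<noteq> 0" for i
    using that xs ys nth_mem[of "i - 1" xs] nth_mem[of "i - 1" ys] by (auto simp: nth_Cons')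
  have part: "P - {z, u} = X \<union> Y" "X \<inter> Y = {}" using X by (auto simp: Y_def)
  have "rep k ({..<k} \<times> UNIV) Q N'"
  proof (rule pair_family.rep_two_singletons[OF k fin(2)])
    fix b i s s' assume b: "b \<in> Q" "N' (0, s) b" "i < k" "N' (i, s') b"
    show "i = 0 \<and> s' = s"
      using b single(1)[OF b(1) mem(1)[OF b(3)]] single(1)[OF b(1) mem(2)[OF b(3)]]
        single(2)[OF b(1) mem(1)[OF b(3)]] single(2)[OF b(1) mem(2)[OF b(3)]] zi[OF b(3)]
      by (cases s; cases s') (auto simp: N'_def)
  next
    fix b assume b: "b \<in> Q"
    show "\<exists>i<k. i \<noteq> 0 \<and> \<not> pair_family.onlyx N' b i"
    proof (rule ccontr)
      assume "\<not> ?thesis"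
      then have "N ((z # xs) ! i) b \<and> \<not> N ((u # ys) ! i) b" if "i < k" "i \<noteq> 0" for i
        using that by (auto simp: pair_family.onlyx_def N'_def)
      then have "N a b" if "a \<in> X" for a using tail[OF that] by blast
      moreover have "\<not> N a b" if "a \<in> Y" for a
        using tail'[OF that] \<open>\<And>i. i < k \<Longrightarrow> i \<noteq> 0 \<Longrightarrow> N ((z # xs) ! i) b \<and> \<not> N ((u # ys) ! i) b\<close> by blast
      ultimately have "{a\<in>P - {z, u}. N a b} = X" unfolding part(1) by blast
      then show False using ne(1)[OF b] by simp
    qed
    show "\<exists>i<k. i \<noteq> 0 \<and> \<not> pair_family.onlyy N' b i"
    proof (rule ccontr)
      assume "\<not> ?thesis"
      then have "\<not> N ((z # xs) ! i) b \<and> N ((u # ys) ! i) b" if "i < k" "i \<noteq> 0" for i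
        using that by (auto simp: pair_family.onlyy_def N'_def)
      then have "\<not> N a b" if "a \<in> X" for a using tail[OF that] by blast
      moreover have "N a b" if "a \<in> Y" for a
        using tail'[OF that] \<open>\<And>i. i < k \<Longrightarrow> i \<noteq> 0 \<Longrightarrow> \<not> N ((z # xs) ! i) b \<and> N ((u # ys) ! i) b\<close> by blast
      ultimately have "{a\<in>P - {z, u}. N a b} = Y" unfolding part(1) by blast
      then show False using ne(2)[OF b] by (simp add: Y_def)
    qed
  qed
  then show ?thesis using rep_lists[OF len dist, of Q N] P by (simp add: N'_def)
qed

text \<open>\<open>c\<close> and \<open>z\<close> form the centre pair, and \<open>X\<close>
  supplies the other first members; a trace equal to \<open>X\<close> is what the bottom letter of a
  chain would have.\<close>

lemma rep_if_dominated:
  assumes k: "3 \<le> k" and fin: "finite P" "finite Q" and card: "card P = 2 * k"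
    and zc: "z \<in> P" "c \<in> P" "z \<noteq> c" and dom: "\<And>b. b \<in> Q \<Longrightarrow> N z b \<Longrightarrow> N c b"
    and X: "X \<subseteq> P - {z, c}" "card X = k - 1"
    and ne: "(\<forall>b\<in>Q. N c b \<longrightarrow> (\<exists>a\<in>P - {z, c}. N a b)) \<or> (\<forall>b\<in>Q. {a\<in>P - {z, c}. N a b} \<noteq> X)"
  shows "rep k P Q N"
proof -
  define Y where "Y = P - {z, c} - X"
  have finX: "finite X" "finite Y" using fin X finite_subset by (auto simp: Y_def)
  have "card (P - {z, c}) = 2 * k - 2" using zc card fin by (simp add: card_Diff_subset)
  then have cY: "card Y = k - 1" using X finX by (simp add: Y_def card_Diff_subset)
  obtain xs where xs: "set xs = X" "distinct xs" "length xs = k - 1" using ex_list[OF finX(1)] X(2) by metis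
  obtain ys where ys: "set ys = Y" "distinct ys" "length ys = k - 1" using ex_list[OF finX(2)] cY by metis
  define N' where "N' = (\<lambda>(i, s) b. N ((if s then ys @ [z] else xs @ [c]) ! i) b)"
  have dist: "distinct ((xs @ [c]) @ (ys @ [z]))" using xs ys X zc by (auto simp: Y_def)
  have P: "set (xs @ [c]) \<union> set (ys @ [z]) = P" using xs ys X zc by (auto simp: Y_def)
  have len: "length (xs @ [c]) = k" "length (ys @ [z]) = k" using xs ys k by auto
  have Nc: "N' (k - 1, False) b = N c b" "N' (k - 1, True) b = N z b" for b
    using xs(3) ys(3) by (simp_all add: N'_def nth_append)
  have Ni: "N' (i, False) b = N (xs ! i) b" "N' (i, True) b = N (ys ! i) b" if "i < k - 1" for i b
    using xs(3) ys(3) that by (simp_all add: N'_def nth_append)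
  have part: "P - {z, c} = X \<union> Y" "X \<inter> Y = {}" using X by (auto simp: Y_def)
  have "rep k ({..<k} \<times> UNIV) Q N'"
  proof (rule pair_family.rep_dominated[OF k fin(2)])
    show "(\<forall>b\<in>Q. N' (k - 1, False) b \<longrightarrow> (\<exists>i<k - 1. \<exists>s. N' (i, s) b)) \<or> (\<forall>b\<in>Q. \<exists>i<k - 1. \<not> pair_family.onlyx N' b i)"
      using ne
    proof
      assume *: "\<forall>b\<in>Q. N c b \<longrightarrow> (\<exists>a\<in>P - {z, c}. N a b)"
      have "\<exists>i<k - 1. \<exists>s. N' (i, s) b" if b: "b \<in> Q" "N c b" for b
      proof -
        obtain a where a: "a \<in> X \<union> Y" "N a b" using * b part by blast
        then obtain i where i: "i < k - 1" "a = xs ! i \<or> a = ys ! i" using xs ys by (metis Un_iff in_set_conv_nth)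
        then show ?thesis using Ni[OF i(1), of b] a(2) by blast
      qed
      then show ?thesis unfolding Nc by blast
    next
      assume *: "\<forall>b\<in>Q. {a\<in>P - {z, c}. N a b} \<noteq> X"
      have "\<exists>i<k - 1. \<not> pair_family.onlyx N' b i" if b: "b \<in> Q" for b
      proof (rule ccontr)
        assume "\<not> ?thesis"
        then have i: "N (xs ! i) b" "\<not> N (ys ! i) b" if "i < k - 1" for i
          using that Ni[OF that] by (auto simp: pair_family.onlyx_def)
        have "N a b" if "a \<in> X" for a using that xs i(1) by (metis in_set_conv_nth)
        moreover have "\<not> N a b" if "a \<in> Y" for a using that ys i(2) by (metis in_set_conv_nth)
        ultimately have "{a\<in>P - {z, c}. N a b} = X" unfolding part(1) by blast
        then show False using * b by blast
      qed
      then show ?thesis by blast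
    qed
  qed (simp del: One_nat_def add: Nc dom)
  then show ?thesis using rep_lists[OF len dist, of Q N] P by (simp add: N'_def)
qed

text \<open>\<open>p\<close> and \<open>y\<close> form pair 1, next to which \<open>z\<close> is
  inserted. A letter with trace \<open>Y\<close> on \<open>W\<close> could be the top of a chain; an
  exceptional letter with trace \<open>W - Y\<close>, up to \<open>y\<close>, could be its
  bottom.\<close>

lemma rep_if_exceptional:
  assumes k: "4 \<le> k" and fin: "finite P" "finite Q" and card: "card P = 2 * k"
    and zcp: "z \<in> P" "c \<in> P" "p \<in> P" "z \<noteq> c" "z \<noteq> p" "c \<noteq> p"
    and exc: "\<And>b. b \<in> Q \<Longrightarrow> N z b \<Longrightarrow> \<not> N c b \<Longrightarrow> N p b"
    and W: "W = P - {z, c, p}" and Y: "Y \<subseteq> W" "card Y = k - 1" "y \<in> Y"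
    and ne: "\<And>b. b \<in> Q \<Longrightarrow> {a\<in>W. N a b} \<noteq> Y"
      "\<And>b. b \<in> Q \<Longrightarrow> N z b \<Longrightarrow> \<not> N c b \<Longrightarrow> {a\<in>W - {y}. N a b} \<noteq> W - Y"
  shows "rep k P Q N"
proof -
  have finW: "finite W" "finite (W - Y)" "finite (Y - {y})" using fin W Y finite_subset by auto
  have "card W = 2 * k - 3" using zcp card fin by (simp add: W card_Diff_subset)
  then have cX: "card (W - Y) = k - 2" using Y finW finite_subset[OF Y(1)] by (simp add: card_Diff_subset)
  have cY: "card (Y - {y}) = k - 2" using Y finite_subset[OF Y(1)] finW by simp
  obtain xs' where xs': "set xs' = W - Y" "distinct xs'" "length xs' = k - 2" using ex_list[OF finW(2)] cX by metis
  obtain ys' where ys': "set ys' = Y - {y}" "distinct ys'" "length ys' = k - 2" using ex_list[OF finW(3)] cY by metis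
  obtain x0 xs where xs: "xs' = x0 # xs" using xs'(3) k by (cases xs') auto
  obtain y0 ys where ys: "ys' = y0 # ys" using ys'(3) k by (cases ys') auto
  \<comment> \<open>\<open>p\<close> and \<open>y\<close> must get index 1, \<open>c\<close> and
    \<open>z\<close> index \<open>k - 1\<close>; \<open>x0\<close> and \<open>y0\<close> are split
    off to fill index 0.\<close>
  define us where "us = x0 # p # xs @ [c]"
  define vs where "vs = y0 # y # ys @ [z]"
  define N' where "N' = (\<lambda>(i, s) b. N ((if s then vs else us) ! i) b)"
  have len: "length us = k" "length vs = k" using xs' ys' xs ys k by (auto simp: us_def vs_def)
  have sets: "set us = insert p (insert c (W - Y))" "set vs = insert z Y"
    using xs'(1) ys'(1) Y(3) unfolding xs ys us_def vs_def by auto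
  have "distinct us" "distinct vs"
    using xs'(1,2) ys'(1,2) Y W zcp unfolding xs ys us_def vs_def by auto
  moreover have "set us \<inter> set vs = {}" unfolding sets using Y W zcp by blast
  ultimately have dist: "distinct (us @ vs)" by simp
  have P: "set us \<union> set vs = P" unfolding sets using Y W zcp by blast
  have lens: "length xs = k - 3" "length ys = k - 3" using xs' ys' xs ys by auto
  have k1: "k - 1 = Suc (Suc (k - 3))" using k by simp
  have Nc: "N' (k - 1, False) b = N c b" "N' (k - 1, True) b = N z b" for b
  proof -
    have "us ! (k - 1) = c" "vs ! (k - 1) = z"
      using nth_append_length[of "x0 # p # xs" c "[]"] nth_append_length[of "y0 # y # ys" z "[]"] lens
      unfolding k1 by (simp_all add: us_def vs_def)
    then show "N' (k - 1, False) b = N c b" "N' (k - 1, True) b = N z b" by (simp_all add: N'_def)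
  qed
  have N1: "N' (1, False) b = N p b" "N' (1, True) b = N y b" for b
    by (simp_all add: N'_def us_def vs_def)
  have ex_x: "\<exists>i<k - 1. i \<noteq> 1 \<and> us ! i = a" if a: "a \<in> W - Y" for a
  proof -
    have "a = x0 \<or> a \<in> set xs" using a xs' xs by auto
    then show ?thesis
    proof
      assume "a \<in> set xs"
      then obtain j where "j < k - 3" "xs ! j = a" using lens by (auto simp: in_set_conv_nth)
      then show ?thesis using lens k by (intro exI[of _ "Suc (Suc j)"]) (simp add: us_def nth_append)
    qed (use k in \<open>intro exI[of _ 0], simp add: us_def\<close>)
  qed
  have ex_y: "\<exists>i<k - 1. i \<noteq> 1 \<and> vs ! i = a" if a: "a \<in> Y - {y}" for a
  proof -
    have "a = y0 \<or> a \<in> set ys" using a ys' ys by auto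
    then show ?thesis
    proof
      assume "a \<in> set ys"
      then obtain j where "j < k - 3" "ys ! j = a" using lens by (auto simp: in_set_conv_nth)
      then show ?thesis using lens k by (intro exI[of _ "Suc (Suc j)"]) (simp add: vs_def nth_append)
    qed (use k in \<open>intro exI[of _ 0], simp add: vs_def\<close>)
  qed
  have "rep k ({..<k} \<times> UNIV) Q N'"
  proof (rule pair_family.rep_center_exceptional[OF k fin(2)])
    fix b assume b: "b \<in> Q" "pair_family.exc k N' b"
    then have e: "N z b" "\<not> N c b" unfolding pair_family.exc_def Nc by blast+
    have "\<exists>i<k - 1. i \<noteq> 1 \<and> \<not> pair_family.onlyx N' b i"
    proof (rule ccontr)
      assume "\<not> ?thesis"
      then have i: "N (us ! i) b" "\<not> N (vs ! i) b" if "i < k - 1" "i \<noteq> 1" for i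
        using that by (auto simp: pair_family.onlyx_def N'_def)
      have "N a b" if "a \<in> W - Y" for a using ex_x[OF that] i(1) by blast
      moreover have "\<not> N a b" if "a \<in> Y - {y}" for a using ex_y[OF that] i(2) by blast
      ultimately have "{a\<in>W - {y}. N a b} = W - Y" using Y by blast
      then show False using ne(2)[OF b(1) e] by simp
    qed
    then show "N' (1, False) b \<and> (\<exists>i<k - 1. i \<noteq> 1 \<and> \<not> pair_family.onlyx N' b i)"
      using exc[OF b(1) e] unfolding N1 by blast
  next
    fix b assume b: "b \<in> Q"
    show "\<exists>i<k - 1. \<not> N' (i, True) b \<or> i \<noteq> 1 \<and> N' (i, False) b"
    proof (rule ccontr)
      assume "\<not> ?thesis"
      then have i: "N (vs ! i) b" "i \<noteq> 1 \<Longrightarrow> \<not> N (us ! i) b" if "i < k - 1" for i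
        using that by (auto simp: N'_def)
      have "N a b" if "a \<in> Y - {y}" for a using ex_y[OF that] i(1) by blast
      moreover have "N y b" using i(1)[of 1] k by (simp add: vs_def)
      moreover have "\<not> N a b" if "a \<in> W - Y" for a using ex_x[OF that] i(2) by blast
      ultimately have "{a\<in>W. N a b} = Y" using Y by blast
      then show False using ne(1)[OF b] by simp
    qed
  qed
  then show ?thesis using rep_lists[OF len dist, of Q N] P by (simp add: N'_def)
qed

section \<open>Three zones: six points on each side\<close>

text \<open>The pairs of zones 0, 1, 2 are \<open>r\<close>, \<open>s\<close>; \<open>p\<close>,
  \<open>q\<close>; \<open>c\<close>, \<open>z\<close>, and \<open>b0\<close> is the only
  exceptional letter. If no representation exists, every assignment of the roles and every
  \<open>\<chi>\<close> yields letters of one of these kinds; contradictions arise by combining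
  several assignments.\<close>

lemma chain_if_not_rep_three:
  fixes \<chi> :: bool
  assumes fin: "finite Q" and P: "P = {z, c, p, q, r, s}" "distinct [z, c, p, q, r, s]"
    and exc: "\<forall>b\<in>Q. N z b \<and> \<not> N c b \<longleftrightarrow> b = b0" and b0: "b0 \<in> Q" "N p b0"
    and notrep: "\<not> rep 3 P Q N"
  shows "\<exists>b\<in>Q. N c b \<and>
    (N p b \<and> \<not> N q b \<and> \<not> N r b \<and> \<not> N s b \<and> N r b0 \<and> \<not> N s b0
     \<or> N p b \<and> \<not> N q b \<and> \<not> N r b \<and> N s b \<and> \<chi> \<and> \<not> N s b0 \<and> (\<exists>b2\<in>Q - {b0}. \<not> N p b2 \<and> \<not> N q b2 \<and> N r b2 \<and> N s b2)
     \<or> \<not> N p b \<and> N q b \<and> \<not> N r b \<and> \<not> N s b \<and>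
       (N r b0 \<and> \<not> N s b0 \<or> (\<exists>b1\<in>Q - {b0}. \<not> N q b1 \<and> N r b1 \<and> \<not> N s b1)
        \<or> \<not> \<chi> \<and> (\<exists>b1\<in>Q - {b0}. \<not> N p b1 \<and> \<not> N q b1 \<and> N r b1 \<and> N s b1)) \<and>
       (\<exists>b2\<in>Q - {b0}. N p b2 \<and> N q b2 \<and> \<not> N r b2 \<and> N s b2)
     \<or> \<not> N p b \<and> N q b \<and> N r b \<and> \<not> N s b \<and> \<not> \<chi>
     \<or> \<not> N p b \<and> \<not> N q b \<and> \<not> N r b \<and> \<not> N s b \<and>
       (N r b0 \<and> \<not> N s b0 \<or> (\<exists>b1\<in>Q - {b0}. N p b1 \<and> \<not> N q b1 \<and> N r b1 \<and> \<not> N s b1)) \<and>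
       (\<exists>b2\<in>Q - {b0}. N q b2 \<and> \<not> N r b2 \<and> N s b2))"
proof (rule ccontr)
  assume no: "\<not> ?thesis"
  define N' where "N' = (\<lambda>(i, t) b. N ((if t then [s, q, z] else [r, p, c]) ! i) b)"
  have N': "N' (0, False) b = N r b" "N' (1, False) b = N p b" "N' (2, False) b = N c b"
     "N' (0, True) b = N s b" "N' (1, True) b = N q b" "N' (2, True) b = N z b" for b
    by (simp_all add: N'_def)
  have exc': "pair_family.exc 3 N' b \<longleftrightarrow> b = b0" if "b \<in> Q" for b
    using bspec[OF exc that] N'(3,6)[of b] by (simp add: pair_family.exc_def)
  have "rep 3 ({..<3} \<times> UNIV) Q N'"
  proof (rule pair_family.rep_center_three[OF refl fin, where \<chi> = \<chi>])
    fix b assume "b \<in> Q" "pair_family.exc 3 N' b"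
    then show "N' (1, False) b" unfolding N' using exc' b0 by blast
  next
    fix b1 b b2 assume b: "b1 \<in> Q" "b \<in> Q" "b2 \<in> Q" "N' (2, False) b" "\<not> pair_family.exc 3 N' b2"
    have b2: "b2 \<in> Q - {b0}" using b(3,5) exc' by blast
    show "\<not> pair_family.chain3 3 N' \<chi> b1 b b2"
    proof
      assume ch: "pair_family.chain3 3 N' \<chi> b1 b b2"
      have Nc: "N c b" using b(4) unfolding N' .
      have b1: "b1 \<in> Q - {b0}" if "b1 \<noteq> b0" using b(1) that by blast
      show False
        using ch unfolding pair_family.chain3_def pair_family.pattern_def Let_def N' exc'[OF b(1)]
        apply (simp only: insert_iff prod.inject empty_iff eq_True eq_False simp_thms)
        apply (rule notE[OF no], rule bexI[OF _ b(2)], rule conjI[OF Nc])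
        apply (cases "b1 = b0")
        subgoal using b2 by (elim disjE conjE) (simp_all, blast+)
        subgoal using b2 b1 by (elim disjE conjE) (simp_all, blast+)
        done
    qed
  qed
  then have "rep 3 (set [r, p, c] \<union> set [s, q, z]) Q N"
    using P(2) by (intro rep_lists) (auto simp: N'_def)
  moreover have "set [r, p, c] \<union> set [s, q, z] = P" by (auto simp: P(1))
  ultimately show False using notrep by simp
qed

lemma ex_remaining:
  assumes "finite Q" "distinct xs" "set xs \<subseteq> Q" "card Q = Suc (length xs)"
  shows "\<exists>x. Q = insert x (set xs)"
proof -
  have "card (Q - set xs) = 1" using assms by (simp add: card_Diff_subset distinct_card)
  then obtain x where "Q - set xs = {x}" by (auto simp: card_1_singleton_iff)
  then show ?thesis using assms(3) by blast
qed

lemma set_eq_if_distinct: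
  assumes "finite Q" "distinct xs" "set xs \<subseteq> Q" "card Q = length xs"
  shows "Q = set xs"
  using assms by (metis card_subset_eq distinct_card)

text \<open>Choosing \<open>\<chi>\<close> true removes the alternative in which \<open>b\<close>
  contains \<open>q\<close> and \<open>r\<close>; choosing it false removes the one with
  \<open>p\<close> and \<open>s\<close>.\<close>

lemma chain_true:
  assumes fin: "finite Q" and P: "P = {z, c, p, q, r, s}" "distinct [z, c, p, q, r, s]"
    and exc: "\<forall>b\<in>Q. N z b \<and> \<not> N c b \<longleftrightarrow> b = b0" and b0: "b0 \<in> Q" "N p b0"
    and notrep: "\<not> rep 3 P Q N"
  obtains (only_p) b where "b \<in> Q" "N c b" "N p b" "\<not> N q b" "\<not> N r b" "\<not> N s b" "N r b0" "\<not> N s b0"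
    | (p_s) b b2 where "b \<in> Q" "N c b" "N p b" "\<not> N q b" "\<not> N r b" "N s b" "\<not> N s b0"
        "b2 \<in> Q" "b2 \<noteq> b0" "\<not> N p b2" "\<not> N q b2" "N r b2" "N s b2"
    | (only_q) b b2 where "b \<in> Q" "N c b" "\<not> N p b" "N q b" "\<not> N r b" "\<not> N s b"
        "N r b0 \<and> \<not> N s b0 \<or> (\<exists>b1\<in>Q - {b0}. \<not> N q b1 \<and> N r b1 \<and> \<not> N s b1)"
        "b2 \<in> Q" "b2 \<noteq> b0" "N p b2" "N q b2" "\<not> N r b2" "N s b2"
    | (none) b b2 where "b \<in> Q" "N c b" "\<not> N p b" "\<not> N q b" "\<not> N r b" "\<not> N s b"
        "N r b0 \<and> \<not> N s b0 \<or> (\<exists>b1\<in>Q - {b0}. N p b1 \<and> \<not> N q b1 \<and> N r b1 \<and> \<not> N s b1)"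
        "b2 \<in> Q" "b2 \<noteq> b0" "N q b2" "\<not> N r b2" "N s b2"
  using chain_if_not_rep_three[OF fin P exc b0 notrep, where \<chi> = True]
  apply (simp only: simp_thms not_True_eq_False)
  apply (elim bexE conjE disjE)
  subgoal by (rule only_p)
  subgoal for b b2 by (rule p_s[of b b2]; blast)
  subgoal for b b2 by (rule only_q[of b b2]; blast)
  subgoal for b b2 b1 by (rule only_q[of b b2]; blast)
  subgoal for b b2 by (rule none[of b b2]; blast)
  subgoal for b b2 b1 by (rule none[of b b2]; blast)
  done

lemma chain_false:
  assumes fin: "finite Q" and P: "P = {z, c, p, q, r, s}" "distinct [z, c, p, q, r, s]"
    and exc: "\<forall>b\<in>Q. N z b \<and> \<not> N c b \<longleftrightarrow> b = b0" and b0: "b0 \<in> Q" "N p b0"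
    and notrep: "\<not> rep 3 P Q N"
  obtains (only_p) "N r b0"
    | (only_q) b where "b \<in> Q" "N c b" "\<not> N p b" "N q b" "\<not> N r b" "\<not> N s b"
    | (q_r) b where "b \<in> Q" "N c b" "\<not> N p b" "N q b" "N r b" "\<not> N s b"
    | (none) b1 where "b1 \<in> Q" "b1 \<noteq> b0" "N p b1" "\<not> N q b1" "N r b1" "\<not> N s b1"
  using chain_if_not_rep_three[OF fin P exc b0 notrep, where \<chi> = False]
  apply (simp only: simp_thms not_False_eq_True)
  apply (elim bexE conjE disjE)
  subgoal by (rule only_p)
  subgoal by (rule only_q)
  subgoal by (rule only_q)
  subgoal by (rule only_q)
  subgoal by (rule q_r)
  subgoal by (rule only_p)
  subgoal for b b2 b1 by (rule none[of b1]; blast)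
  done

lemma ex_list_third:
  assumes "card R = 3" "r \<in> R" shows "\<exists>q s. R = {q, r, s} \<and> distinct [q, r, s]"
proof -
  obtain u v w where R: "R = {u, v, w}" "u \<noteq> v" "u \<noteq> w" "v \<noteq> w" using assms(1) by (auto simp: card_3_iff)
  consider "r = u" | "r = v" | "r = w" using assms(2) R by auto
  then show ?thesis
  proof cases
    case 1 then show ?thesis using R by (intro exI[of _ v] exI[of _ w]) auto
  next
    case 2 then show ?thesis using R by (intro exI[of _ u] exI[of _ w]) auto
  next
    case 3 then show ?thesis using R by (intro exI[of _ u] exI[of _ v]) auto
  qed
qed

lemma ex_two: "2 \<le> card A \<Longrightarrow> \<exists>p\<in>A. \<exists>s\<in>A. p \<noteq> s"
  by (metis card_2_iff insert_subset obtain_subset_with_card_n)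

text \<open>A point \<open>c\<close> in two of the three letters of \<open>z\<close> leaves a single
  exceptional letter \<open>b0\<close>. Two arrangements then force five letters that cannot tell
  \<open>p\<close> from \<open>s\<close>, and the sixth cannot keep each of these points from being
  dominated by the other.\<close>

lemma rep_three_degree_three:
  assumes fin: "finite P" "finite Q" and card: "card P = 6" "card Q = 6"
    and ndA: "\<And>a a'. a \<in> P \<Longrightarrow> a' \<in> P \<Longrightarrow> a \<noteq> a' \<Longrightarrow> \<exists>b\<in>Q. N a b \<and> \<not> N a' b"
    and ndB: "\<And>b b'. b \<in> Q \<Longrightarrow> b' \<in> Q \<Longrightarrow> b \<noteq> b' \<Longrightarrow> \<exists>a\<in>P. N a b \<and> \<not> N a b'"
    and size: "\<And>b. b \<in> Q \<Longrightarrow> card {a\<in>P. N a b} \<noteq> 2"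
    and z: "z \<in> P" "card {b\<in>Q. N z b} = 3"
  shows "rep 3 P Q N"
proof (rule ccontr)
  assume notrep: "\<not> rep 3 P Q N"
  obtain x y w where D: "{b\<in>Q. N z b} = {x, y, w}" "x \<noteq> y" "x \<noteq> w" "y \<noteq> w"
    using z(2) by (auto simp: card_3_iff)
  have memD: "b \<in> Q \<and> N z b \<longleftrightarrow> b = x \<or> b = y \<or> b = w" for b using D(1) by auto
  define T where "T b = {a\<in>P. N a b} - {z}" for b
  have T2: "2 \<le> card (T b)" if b: "b \<in> Q" "N z b" for b
  proof -
    have "\<exists>b'\<in>Q. b' \<noteq> b \<and> N z b'" using memD[of x] memD[of y] D(2) by metis
    then obtain b' where b': "b' \<in> Q" "b' \<noteq> b" "N z b'" by blast
    have "T b \<noteq> {}" using ndB[OF b(1) b'(1)] b' by (auto simp: T_def)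
    moreover have "card (T b) = card {a\<in>P. N a b} - 1" using z b fin by (simp add: T_def)
    moreover have "finite (T b)" using fin by (simp add: T_def)
    ultimately have "card (T b) \<noteq> 0" "card (T b) = card {a\<in>P. N a b} - 1" by auto
    then show ?thesis using size[OF b(1)] by arith
  qed
  \<comment> \<open>Three sets of size at least two among the five points other than
    \<open>z\<close> cannot be disjoint.\<close>
  have "\<exists>b\<in>{x, y, w}. \<exists>b'\<in>{x, y, w}. b \<noteq> b' \<and> T b \<inter> T b' \<noteq> {}"
  proof (rule ccontr)
    assume no: "\<not> ?thesis"
    have "(T x \<union> T y) \<inter> T w = {}" "T x \<inter> T y = {}" using no D(2-4) by auto
    then have "card (T x \<union> T y \<union> T w) = card (T x) + card (T y) + card (T w)"
      using fin by (simp add: card_Un_disjoint T_def)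
    moreover have "card (T x \<union> T y \<union> T w) \<le> card (P - {z})"
      using fin by (intro card_mono) (auto simp: T_def)
    moreover have "card (P - {z}) = 5" using card z fin by simp
    ultimately show False using T2[of x] T2[of y] T2[of w] memD[of x] memD[of y] memD[of w] by simp
  qed
  then obtain b b' c where bb': "b \<in> {x, y, w}" "b' \<in> {x, y, w}" "b \<noteq> b'" "c \<in> T b \<inter> T b'"
    by (meson ex_in_conv)
  then have c: "b \<in> Q" "N z b" "b' \<in> Q" "N z b'" "c \<in> P" "c \<noteq> z" "N c b" "N c b'"
    using memD[of b] memD[of b'] by (auto simp: T_def)
  obtain b0 where b0: "b0 \<in> Q" "N z b0" "\<not> N c b0" using ndA[OF z(1) c(5)] c(6) by metis
  have exc: "\<forall>b''\<in>Q. N z b'' \<and> \<not> N c b'' \<longleftrightarrow> b'' = b0"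
  proof
    fix b'' assume "b'' \<in> Q"
    then show "N z b'' \<and> \<not> N c b'' \<longleftrightarrow> b'' = b0"
      using c bb'(3) b0 memD[of b] memD[of b'] memD[of b''] memD[of b0] by metis
  qed
  obtain p s where ps: "p \<in> T b0" "s \<in> T b0" "p \<noteq> s"
    using ex_two[OF T2[OF b0(1,2)]] by blast
  then have ps': "p \<in> P" "s \<in> P" "p \<noteq> z" "s \<noteq> z" "p \<noteq> c" "s \<noteq> c" "N p b0" "N s b0" using b0 by (auto simp: T_def)
  have "card (P - {z, c, p, s}) = 2" using fin card z c ps ps' by (simp add: card_Diff_subset)
  then obtain q r where qr: "P - {z, c, p, s} = {q, r}" "q \<noteq> r" by (auto simp: card_2_iff)
  \<comment> \<open>As \<open>s\<close> lies in \<open>b0\<close>, two cases of the chain fail; the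
    case \<open>none\<close> fails because a letter containing \<open>c\<close> contains a point
    besides \<open>z\<close> and \<open>c\<close>.\<close>
  have claim: "\<exists>b\<in>Q. \<exists>b2\<in>Q - {b0}. N z b \<and> N c b \<and> N q b \<and> \<not> N p b \<and> \<not> N r b \<and> \<not> N s b
      \<and> N p b2 \<and> N q b2 \<and> \<not> N r b2 \<and> N s b2" if qr: "P - {z, c, p, s} = {q, r}" "q \<noteq> r" for q r
  proof -
    have P: "P = {z, c, p, q, r, s}" using qr z c ps' by blast
    have dist: "distinct [z, c, p, q, r, s]" using qr z c ps' ps by auto
    have single: "\<exists>a\<in>P. a \<noteq> z \<and> a \<noteq> c \<and> N a d" if d: "d \<in> Q" "N c d" for d
    proof (rule ccontr)
      assume no: "\<not> ?thesis"
      show False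
      proof (cases "N z d")
        case True
        have "{a\<in>P. N a d} = {z, c}" using no True d z c by blast
        then show False using size[OF d(1)] c(6) by simp
      next
        case False
        have "d \<noteq> b" using False c(2) by blast
        then obtain a where "a \<in> P" "N a d" "\<not> N a b" using ndB[OF d(1) c(1)] by blast
        then show False using no False c(7) by metis
      qed
    qed
    have two: "N z d" if d: "d \<in> Q" "N c d" "N q d" "\<not> N p d" "\<not> N r d" "\<not> N s d" for d
    proof (rule ccontr)
      assume no: "\<not> ?thesis"
      have "{a\<in>P. N a d} = {c, q}" using no d P by blast
      then show False using size[OF d(1)] dist by simp
    qed
    have P_ex: "N p d \<or> N q d \<or> N r d \<or> N s d" if "d \<in> Q" "N c d" for d
      using single[OF that] unfolding P by auto
    show ?thesis
    proof (rule chain_true[OF fin(2) P dist exc b0(1) ps'(7) notrep])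
      fix b b2 assume b: "b \<in> Q" "N c b" "\<not> N p b" "N q b" "\<not> N r b" "\<not> N s b"
        "b2 \<in> Q" "b2 \<noteq> b0" "N p b2" "N q b2" "\<not> N r b2" "N s b2"
      then show ?thesis using two[OF b(1,2,4,3,5,6)] by blast
    qed (use ps'(8) P_ex in blast)+
  qed
  obtain d1 d2 where d: "d1 \<in> Q" "d2 \<in> Q - {b0}" "N z d1" "N c d1" "N q d1" "\<not> N p d1" "\<not> N r d1" "\<not> N s d1"
    "N p d2" "N q d2" "\<not> N r d2" "N s d2" using claim[OF qr] by blast
  have qr': "P - {z, c, p, s} = {r, q}" "r \<noteq> q" using qr by auto
  obtain e1 e2 where e: "e1 \<in> Q" "e2 \<in> Q - {b0}" "N z e1" "N c e1" "N r e1" "\<not> N p e1" "\<not> N q e1" "\<not> N s e1"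
    "N p e2" "N r e2" "\<not> N q e2" "N s e2" using claim[OF qr'] by blast
  have dist: "distinct [b0, d1, d2, e1, e2]" using d e ps' by auto
  have sub: "set [b0, d1, d2, e1, e2] \<subseteq> Q" using d e b0 by auto
  obtain x where Q: "Q = insert x (set [b0, d1, d2, e1, e2])"
    using ex_remaining[OF fin(2) dist sub] card by auto
  have "N p x \<and> \<not> N s x" using ndA[OF ps'(1,2) ps(3)] ps' d e unfolding Q by auto
  moreover have "N s x \<and> \<not> N p x" using ndA[OF ps'(2,1)] ps(3) ps' d e unfolding Q by auto
  ultimately show False by blast
qed

text \<open>Nondomination of \<open>b0\<close> and \<open>b1\<close> provides \<open>c\<close> and
  \<open>p\<close>, and \<open>b0\<close> becomes the only exceptional letter. The argument then
  concerns the traces of letters on the three remaining points \<open>R\<close>.\<close>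

lemma rep_three_degree_two:
  assumes fin: "finite P" "finite Q" and card: "card P = 6" "card Q = 6"
    and ndA: "\<And>a a'. a \<in> P \<Longrightarrow> a' \<in> P \<Longrightarrow> a \<noteq> a' \<Longrightarrow> \<exists>b\<in>Q. N a b \<and> \<not> N a' b"
    and ndB: "\<And>b b'. b \<in> Q \<Longrightarrow> b' \<in> Q \<Longrightarrow> b \<noteq> b' \<Longrightarrow> \<exists>a\<in>P. N a b \<and> \<not> N a b'"
    and z: "z \<in> P" "{b\<in>Q. N z b} = {b0, b1}" "b0 \<noteq> b1" and le: "card {a\<in>P. N a b0} \<le> card {a\<in>P. N a b1}"
  shows "rep 3 P Q N"
proof (rule ccontr)
  assume notrep: "\<not> rep 3 P Q N"
  have memD: "b \<in> Q \<and> N z b \<longleftrightarrow> b = b0 \<or> b = b1" for b using z(2) by auto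
  have b01: "b0 \<in> Q" "b1 \<in> Q" "N z b0" "N z b1" using memD by auto
  obtain c where c: "c \<in> P" "N c b1" "\<not> N c b0" using ndB[OF b01(2,1)] z(3) by metis
  obtain p where p: "p \<in> P" "N p b0" "\<not> N p b1" using ndB[OF b01(1,2)] z(3) by metis
  have zcp: "z \<noteq> c" "z \<noteq> p" "c \<noteq> p" using c p b01 by auto
  have exc: "\<forall>b\<in>Q. N z b \<and> \<not> N c b \<longleftrightarrow> b = b0" using memD b01 c by metis
  define R where "R = P - {z, c, p}"
  have cR: "card R = 3" using zcp z c p fin card by (simp add: R_def card_Diff_subset)
  \<comment> \<open>Otherwise \<open>a\<close> would lie in both letters of \<open>z\<close> and
    dominate it.\<close>
  have disj: "\<not> (N a b0 \<and> N a b1)" if a: "a \<in> R" for a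
  proof -
    have "a \<in> P" "z \<noteq> a" using a by (auto simp: R_def)
    then show ?thesis using ndA[OF z(1), of a] memD by metis
  qed
  have PR: "P = {z, c, p, q, r, s}" "distinct [z, c, p, q, r, s]" if "R = {q, r, s}" "distinct [q, r, s]" for q r s
  proof -
    have "P = {z, c, p} \<union> R" "z \<notin> R" "c \<notin> R" "p \<notin> R" using z c p by (auto simp: R_def)
    then show "P = {z, c, p, q, r, s}" "distinct [z, c, p, q, r, s]" using that zcp by auto
  qed
  note chain_true' = chain_true[OF fin(2) PR exc b01(1) p(2) notrep]
  note chain_false' = chain_false[OF fin(2) PR exc b01(1) p(2) notrep]
  have zfree: "\<not> N z b" if "b \<in> Q" "b \<noteq> b1" "N c b" for b using that memD c by metis
  show False
  proof (cases "\<forall>r\<in>R. \<not> N r b0 \<longrightarrow> (\<exists>b\<in>Q - {b0}. N r b \<and> (\<forall>x\<in>R - {r}. \<not> N x b))")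
    case False
    then obtain r where r: "r \<in> R" "\<not> N r b0" "\<And>b. b \<in> Q - {b0} \<Longrightarrow> N r b \<Longrightarrow> \<exists>x\<in>R - {r}. N x b" by blast
    obtain q s where R: "R = {q, r, s}" "distinct [q, r, s]" using ex_list_third[OF cR r(1)] by blast
    have R': "R = {s, r, q}" "distinct [s, r, q]" using R by auto
    have P: "P = {z, c, p, q, r, s}" using PR[OF R] by blast
    have nor: "N q b \<or> N s b" if "b \<in> Q" "b \<noteq> b0" "N r b" for b using r(3)[of b] that R by auto
    \<comment> \<open>\<open>r\<close> is neither in \<open>b0\<close> nor alone in the trace of
      another letter, so only the case \<open>p_s\<close> is possible.\<close>
    have both: "\<exists>b\<in>Q. N c b \<and> N p b \<and> \<not> N x b \<and> \<not> N r b \<and> N y b" if xy: "R = {x, r, y}" "distinct [x, r, y]" for x y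
    proof -
      have nor: "N x b \<or> N y b" if "b \<in> Q" "b \<noteq> b0" "N r b" for b using r(3)[of b] that xy by auto
      show ?thesis by (rule chain_true'[OF xy xy]) (use r(2) nor in blast)+
    qed
    obtain d1 where d1: "d1 \<in> Q" "N c d1" "N p d1" "\<not> N q d1" "\<not> N r d1" "N s d1" using both[OF R] by blast
    obtain d2 where d2: "d2 \<in> Q" "N c d2" "N p d2" "\<not> N s d2" "\<not> N r d2" "N q d2" using both[OF R'] by blast
    \<comment> \<open>Such a letter misses \<open>z\<close>, \<open>r\<close> and one of
      \<open>q\<close>, \<open>s\<close>, so \<open>d1\<close> or \<open>d2\<close> would dominate
      it.\<close>
    have cq: False if "b \<in> Q" "b \<noteq> b1" "b \<noteq> d1" "b \<noteq> d2" "N c b" "\<not> N r b" "\<not> (N q b \<and> N s b)" for b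
      using ndB[OF that(1) d1(1) that(3)] ndB[OF that(1) d2(1) that(4)] zfree[OF that(1,2,5)] d1 d2 that(5-) unfolding P by auto
    show False
    proof (cases "\<exists>x\<in>R. N x b1")
      case False
      have new: "\<exists>b\<in>Q. N c b \<and> \<not> N p b \<and> N x b \<and> N r b \<and> \<not> N y b"
        if xy: "R = {x, r, y}" "distinct [x, r, y]" "x = q \<and> y = s \<or> x = s \<and> y = q" for x y
      proof (rule chain_false'[OF xy(1,2) xy(1,2)])
        assume "N r b0" then show ?thesis using r by blast
      next
        fix b assume b: "b \<in> Q" "N c b" "\<not> N p b" "N x b" "\<not> N r b" "\<not> N y b"
        have "b \<noteq> b1" "b \<noteq> d1" "b \<noteq> d2" using b(3,4) d1 d2 False xy(1) by auto
        then show ?thesis using cq[OF b(1) _ _ _ b(2,5)] xy(3) b by blast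
      next
        fix b assume "b \<in> Q" "b \<noteq> b0" "N p b" "\<not> N x b" "N r b" "\<not> N y b"
        then show ?thesis using nor[of b] xy(3) by blast
      qed blast
      obtain d3 where d3: "d3 \<in> Q" "N c d3" "\<not> N p d3" "N q d3" "N r d3" "\<not> N s d3" using new[OF R] by blast
      obtain d4 where d4: "d4 \<in> Q" "N c d4" "\<not> N p d4" "N s d4" "N r d4" "\<not> N q d4" using new[OF R'] by blast
      have dist: "distinct [b0, b1, d1, d2, d3, d4]" using z(3) c p d1 d2 d3 d4 False R(1) by auto
      have sub: "set [b0, b1, d1, d2, d3, d4] \<subseteq> Q" using b01 d1 d2 d3 d4 by auto
      have Q: "Q = set [b0, b1, d1, d2, d3, d4]" by (rule set_eq_if_distinct[OF fin(2) dist sub]) (simp add: card)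
      \<comment> \<open>Now every letter containing \<open>r\<close> also contains
        \<open>c\<close>.\<close>
      have "r \<in> P" "r \<noteq> c" using r(1) by (auto simp: R_def)
      then show False using ndA[of r c] c d1 d2 d3 d4 r(2) unfolding Q by auto
    next
      case True
      \<comment> \<open>With \<open>r\<close> in the last place all cases fail. Since
        \<open>cq\<close> does not cover \<open>b1\<close>, the order of the other two points is
        chosen according to \<open>b1\<close>.\<close>
      have no: False if xy: "R = {x, y, r}" "distinct [x, y, r]" "x = q \<and> y = s \<or> x = s \<and> y = q" "N y b1 \<or> N r b1 \<or> \<not> N x b1" for x y
      proof (rule chain_true'[OF xy(1,2) xy(1,2)])
        fix b assume b: "b \<in> Q" "N c b" "N p b" "\<not> N x b" "\<not> N y b" "\<not> N r b"
        have "b \<noteq> b1" "b \<noteq> d1" "b \<noteq> d2" using b xy(3) p d1 d2 by auto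
        then show ?thesis using cq[OF b(1) _ _ _ b(2,6)] xy(3) b by blast
      next
        fix b assume b: "b \<in> Q" "N c b" "\<not> N x b" "\<not> N y b" "N r b"
        then show ?thesis using nor[of b] c(3) xy(3) by blast
      next
        fix b assume b: "b \<in> Q" "N c b" "\<not> N p b" "N x b" "\<not> N y b" "\<not> N r b"
        have "b \<noteq> b1" "b \<noteq> d1" "b \<noteq> d2" using b xy(4) d1 d2 by auto
        then show ?thesis using cq[OF b(1) _ _ _ b(2,6)] xy(3) b by blast
      next
        fix b assume b: "b \<in> Q" "N c b" "\<not> N p b" "\<not> N x b" "\<not> N y b" "\<not> N r b"
        have "b \<noteq> b1" "b \<noteq> d1" "b \<noteq> d2" using b xy(1) True d1 d2 by auto
        then show ?thesis using cq[OF b(1) _ _ _ b(2,6)] xy(3) b by blast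
      qed
      show False
      proof (cases "N s b1 \<or> N r b1 \<or> \<not> N q b1")
        case True then show False using no[of q s] R by auto
      next
        case False then show False using no[of s q] R by auto
      qed
    qed
  next
    case single: True
    show False
    proof (cases "\<exists>t\<in>R. N t b0")
      case True
      then obtain t where t: "t \<in> R" "N t b0" by blast
      obtain x y where R: "R = {x, t, y}" "distinct [x, t, y]" using ex_list_third[OF cR t(1)] by blast
      note P = PR[OF R]
      have low: "card S \<le> card {a\<in>P. N a b1}" if "S \<subseteq> {a\<in>P. N a b0}" for S
        using le card_mono[OF _ that] fin(1) by simp
      have up: "card {a\<in>P. N a b1} \<le> card S" if "{a\<in>P. N a b1} \<subseteq> S" "finite S" for S
        using card_mono[OF that(2,1)] .
      have tb1: "\<not> N t b1" using disj[OF t(1)] t(2) by blast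
      \<comment> \<open>Here \<open>le\<close> enters: \<open>b0\<close> contains \<open>z\<close>,
        \<open>p\<close>, \<open>t\<close>, so \<open>b1\<close> needs a third point beyond
        \<open>z\<close> and \<open>c\<close>; a fourth point of \<open>b0\<close> would leave
        \<open>b1\<close> too small.\<close>
      have xy: "\<not> N x b0" "\<not> N y b0" "N x b1 \<or> N y b1"
      proof -
        have "N x b1 \<or> N y b1"
        proof (rule ccontr)
          assume "\<not> ?thesis"
          then have "{a\<in>P. N a b1} \<subseteq> {z, c}" unfolding P(1) using tb1 p by auto
          moreover have "{z, p, t} \<subseteq> {a\<in>P. N a b0}" unfolding P(1) using t p b01 by auto
          ultimately have "card {z, p, t} \<le> card {z, c}" using low up by (meson finite.emptyI finite_insert le_trans)
          then show False using P(2) by simp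
        qed
        moreover have "\<not> N a b0" if a: "{x, y} = {a, a'}" for a a'
        proof
          assume Na: "N a b0"
          then have "\<not> N a b1" using disj[of a] R(1) a by blast
          then have "{a\<in>P. N a b1} \<subseteq> {z, c, a'}" unfolding P(1) using tb1 p a by auto
          moreover have "{z, p, t, a} \<subseteq> {a\<in>P. N a b0}" unfolding P(1) using t p b01 Na a by auto
          ultimately have "card {z, p, t, a} \<le> card {z, c, a'}" using low up by (meson finite.emptyI finite_insert le_trans)
          moreover have "card {z, p, t, a} = 4" using P(2) a by (auto simp: doubleton_eq_iff)
          moreover have "card {z, c, a'} \<le> 3" by (rule card_insert_le_m1) (simp_all add: card_insert_if)
          ultimately show False by simp
        qed
        ultimately show "\<not> N x b0" "\<not> N y b0" "N x b1 \<or> N y b1" by (blast, blast, blast)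
      qed
      \<comment> \<open>With \<open>t\<close> in the last place only \<open>only_q\<close> survives:
        \<open>t\<close> lies in \<open>b0\<close>, and a letter with \<open>c\<close> alone would
        be dominated by \<open>b1\<close>.\<close>
      have claim: "\<exists>b\<in>Q. \<exists>b2\<in>Q - {b0}. N c b \<and> \<not> N p b \<and> N q b \<and> \<not> N r b \<and> \<not> N t b \<and> N p b2 \<and> N q b2 \<and> \<not> N r b2 \<and> N t b2"
        if R': "R = {q, r, t}" "distinct [q, r, t]" "q = x \<and> r = y \<or> q = y \<and> r = x" for q r
      proof (rule chain_true'[OF R'(1,2) R'(1,2)])
        assume "N r b0" then show ?thesis using xy R'(3) by blast
      next
        assume "\<not> N t b0" then show ?thesis using t by blast
      next
        fix b b2 assume "b \<in> Q" "N c b" "\<not> N p b" "N q b" "\<not> N r b" "\<not> N t b"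
          "b2 \<in> Q" "b2 \<noteq> b0" "N p b2" "N q b2" "\<not> N r b2" "N t b2"
        then show ?thesis by blast
      next
        fix b assume b: "b \<in> Q" "N c b" "\<not> N p b" "\<not> N q b" "\<not> N r b" "\<not> N t b"
        then have "b \<noteq> b1" using xy(3) R'(3) by blast
        then show ?thesis using ndB[OF b(1) b01(2)] zfree[OF b(1)] b c(2) unfolding P(1) using R'(3) by auto
      qed
      have R': "R = {x, y, t}" "distinct [x, y, t]" "R = {y, x, t}" "distinct [y, x, t]" using R by auto
      obtain e1 f1 where e: "e1 \<in> Q" "f1 \<in> Q" "f1 \<noteq> b0" "N c e1" "\<not> N p e1" "N x e1" "\<not> N y e1" "\<not> N t e1"
          "N p f1" "N x f1" "\<not> N y f1" "N t f1" using claim[OF R'(1,2)] by blast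
      obtain e2 f2 where f: "e2 \<in> Q" "f2 \<in> Q" "f2 \<noteq> b0" "N c e2" "\<not> N p e2" "N y e2" "\<not> N x e2" "\<not> N t e2"
          "N p f2" "N y f2" "\<not> N x f2" "N t f2" using claim[OF R'(3,4)] by blast
      have dist: "distinct [b0, e1, f1, e2, f2]" using e f p by auto
      have sub: "set [b0, e1, f1, e2, f2] \<subseteq> Q" using e f b01 by auto
      obtain w where Q: "Q = insert w (set [b0, e1, f1, e2, f2])"
        using ex_remaining[OF fin(2) dist sub] card by auto
      have pt: "t \<in> P" "t \<noteq> p" using t by (auto simp: R_def)
      \<comment> \<open>\<open>p\<close> and \<open>t\<close> agree on the other five letters, so
        the sixth would have to separate them in both directions.\<close>
      have "N p w \<and> \<not> N t w" using ndA[OF p(1) pt(1)] pt(2) p t e f unfolding Q by auto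
      moreover have "N t w \<and> \<not> N p w" using ndA[OF pt(1) p(1) pt(2)] p t e f unfolding Q by auto
      ultimately show False by blast
    next
      case False
      define pr where "pr x y \<longleftrightarrow> (\<exists>b\<in>Q - {b0}. N x b \<and> N y b \<and> (\<forall>a\<in>R - {x, y}. \<not> N a b))" for x y
      have pr_sym: "pr x y \<longleftrightarrow> pr y x" for x y by (auto simp: pr_def insert_commute)
      \<comment> \<open>Each arrangement asks for one of two traces of size two on \<open>R\<close>.
        So at least two of the three such traces occur, and they share a point
        \<open>g\<close>.\<close>
      have ex_pr: "pr q s \<or> pr r s" if R: "R = {q, r, s}" "distinct [q, r, s]" for q r s
      proof (rule ccontr)
        assume no: "\<not> ?thesis"
        have "R - {q, s} = {r}" "R - {r, s} = {q}" using R by auto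
        then have "\<not> (N q b \<and> N s b \<and> \<not> N r b)" "\<not> (N r b \<and> N s b \<and> \<not> N q b)" if "b \<in> Q" "b \<noteq> b0" for b
          using that no unfolding pr_def by auto
        moreover have "\<not> N r b0" using False R by blast
        ultimately show False by - (rule chain_true'[OF R R]; blast)
      qed
      obtain u v w where R: "R = {u, v, w}" "distinct [u, v, w]" using cR by (auto simp: card_3_iff)
      have R': "R = {u, w, v}" "distinct [u, w, v]" "R = {v, w, u}" "distinct [v, w, u]" using R by auto
      have "\<exists>x y g. R = {x, y, g} \<and> distinct [x, y, g] \<and> pr x g \<and> pr y g"
      proof -
        consider "pr u w" "pr v w" | "pr u v" "pr w v" | "pr v u" "pr w u"
          using ex_pr[OF R] ex_pr[OF R'(1,2)] ex_pr[OF R'(3,4)] pr_sym by blast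
        then show ?thesis by cases (use R R' in blast)+
      qed
      then obtain x y g where R: "R = {x, y, g}" "distinct [x, y, g]" and pr: "pr x g" "pr y g" by blast
      have Rx: "R - {x, g} = {y}" "R - {y, g} = {x}" "R - {x} = {y, g}" "R - {y} = {x, g}" "R - {g} = {x, y}"
        "x \<in> R" "y \<in> R" "g \<in> R" using R by auto
      obtain f1 where f1: "f1 \<in> Q" "f1 \<noteq> b0" "N x f1" "N g f1" "\<not> N y f1" using pr(1) Rx by (auto simp: pr_def)
      obtain f2 where f2: "f2 \<in> Q" "f2 \<noteq> b0" "N y f2" "N g f2" "\<not> N x f2" using pr(2) Rx by (auto simp: pr_def)
      have ex_single: "\<exists>b\<in>Q - {b0}. N a b \<and> (\<forall>a'\<in>R - {a}. \<not> N a' b)" if "a \<in> R" for a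
        using single False that by blast
      obtain h1 where h1: "h1 \<in> Q" "h1 \<noteq> b0" "N x h1" "\<not> N y h1" "\<not> N g h1" using ex_single[OF Rx(6)] Rx by auto
      obtain h2 where h2: "h2 \<in> Q" "h2 \<noteq> b0" "N y h2" "\<not> N x h2" "\<not> N g h2" using ex_single[OF Rx(7)] Rx by auto
      obtain h3 where h3: "h3 \<in> Q" "h3 \<noteq> b0" "N g h3" "\<not> N x h3" "\<not> N y h3" using ex_single[OF Rx(8)] Rx by auto
      have dist: "distinct [b0, h1, h2, h3, f1, f2]" using f1 f2 h1 h2 h3 by auto
      have sub: "set [b0, h1, h2, h3, f1, f2] \<subseteq> Q" using b01 f1 f2 h1 h2 h3 by auto
      \<comment> \<open>\<open>b0\<close>, three singleton traces and two traces of size two exhaust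
        the six letters, so all traces on \<open>R\<close> are known.\<close>
      have Q: "Q = set [b0, h1, h2, h3, f1, f2]" by (rule set_eq_if_distinct[OF fin(2) dist sub]) (simp add: card)
      have b0R: "\<not> N x b0" "\<not> N y b0" "\<not> N g b0" using False Rx by blast+
      have mem: "b = b0 \<or> b = h1 \<or> b = h2 \<or> b = h3 \<or> b = f1 \<or> b = f2" if "b \<in> Q" for b using that unfolding Q by simp
      have R1: "R = {y, g, x}" "distinct [y, g, x]" using R by auto
      have ph1: "N p h1"
        by (rule chain_true'[OF R1 R1]; (use b0R mem f1(3-) f2(3-) h1(3-) h2(3-) h3(3-) in metis))
      have R2: "R = {g, y, x}" "distinct [g, y, x]" using R by auto
      have pf1: "N p f1"
        by (rule chain_true'[OF R2 R2]; (use b0R mem f1(3-) f2(3-) h1(3-) h2(3-) h3(3-) c in metis))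
      have "x \<in> P" "x \<noteq> p" using Rx(6) by (auto simp: R_def)
      \<comment> \<open>\<open>x\<close> occurs only in \<open>h1\<close> and \<open>f1\<close>,
        both of which contain \<open>p\<close>, so \<open>p\<close> would dominate it.\<close>
      then show False using ndA[OF _ p(1)] mem ph1 pf1 b0R f2 h2 h3 by metis
    qed
  qed
qed

section \<open>Counting subsets\<close>

lemma fresh_subset:
  assumes "finite U" "finite F" "card F < card U choose m"
  shows "\<exists>W\<subseteq>U. card W = m \<and> W \<notin> F"
proof (rule ccontr)
  assume "\<not> ?thesis"
  then have "{W. W \<subseteq> U \<and> card W = m} \<subseteq> F" by blast
  then have "card U choose m \<le> card F" using n_subsets[OF assms(1), of m] card_mono[OF assms(2)] by metis
  then show False using assms(3) by simp
qed

lemma choose_ge_choose_two: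
  assumes "2 \<le> m" "2 * m \<le> (n::nat)" shows "n * (n - 1) div 2 \<le> n choose m"
  using binomial_mono[of 2 m n] assms by (simp add: choose_two)

text \<open>Tight at \<open>k = 3\<close>, where five traces face six subsets.\<close>

lemma central_binomial_bound:
  assumes "3 \<le> (k::nat)" shows "2 * k - 1 < (2 * k - 2) choose (k - 1)"
proof -
  obtain j where k: "k = j + 3" using assms by (metis add.commute le_Suc_ex)
  have "(2 * j + 4) * (2 * j + 4 - 1) = 2 * ((j + 2) * (2 * j + 3))" by (simp add: algebra_simps)
  then have "(j + 2) * (2 * j + 3) \<le> (2 * j + 4) choose (j + 2)"
    using choose_ge_choose_two[of "j + 2" "2 * j + 4"] by simp
  moreover have "2 * j + 5 < (j + 2) * (2 * j + 3)" by (simp add: algebra_simps)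
  ultimately have "2 * j + 5 < (2 * j + 4) choose (j + 2)" by (rule less_le_trans[rotated])
  moreover have "2 * k - 1 = 2 * j + 5" "2 * k - 2 = 2 * j + 4" "k - 1 = j + 2" by (simp_all add: k)
  ultimately show ?thesis by metis
qed

text \<open>Leaves room for all traces and their complements, which are \<open>4 * k\<close> sets;
  at \<open>k = 3\<close> there would be only six subsets for twelve sets.\<close>

lemma central_binomial_bound_strong:
  assumes "4 \<le> (k::nat)" shows "4 * k < (2 * k - 2) choose (k - 1)"
proof (cases "k = 4")
  case True
  have "(6::nat) choose 3 = 20" by (simp add: numeral_eq_Suc)
  then show ?thesis using True by simp
next
  case False
  then have "5 \<le> k" using assms by simp
  then obtain j where k: "k = j + 5" by (metis add.commute le_Suc_ex)
  have "(2 * j + 8) * (2 * j + 8 - 1) = 2 * ((j + 4) * (2 * j + 7))" by (simp add: algebra_simps)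
  then have "(j + 4) * (2 * j + 7) \<le> (2 * j + 8) choose (j + 4)"
    using choose_ge_choose_two[of "j + 4" "2 * j + 8"] by simp
  moreover have "4 * (j + 5) < (j + 4) * (2 * j + 7)" by (simp add: algebra_simps)
  ultimately have "4 * (j + 5) < (2 * j + 8) choose (j + 4)" by (rule less_le_trans[rotated])
  moreover have "4 * k = 4 * (j + 5)" "2 * k - 2 = 2 * j + 8" "k - 1 = j + 4" by (simp_all add: k)
  ultimately show ?thesis by metis
qed

text \<open>Leaves room for \<open>2 * k\<close> traces and one further set; at \<open>k = 4\<close>
  ten subsets face nine sets.\<close>

lemma odd_binomial_bound:
  assumes "4 \<le> (k::nat)" shows "2 * k + 1 < (2 * k - 3) choose (k - 1)"
proof -
  obtain j where k: "k = j + 4" using assms by (metis add.commute le_Suc_ex)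
  have "(2 * j + 5) * (2 * j + 5 - 1) = 2 * ((2 * j + 5) * (j + 2))" by (simp add: algebra_simps)
  then have "(2 * j + 5) * (j + 2) \<le> (2 * j + 5) choose (j + 2)"
    using choose_ge_choose_two[of "j + 2" "2 * j + 5"] by simp
  moreover have "2 * j + 9 < (2 * j + 5) * (j + 2)" by (simp add: algebra_simps)
  ultimately have "2 * j + 9 < (2 * j + 5) choose (j + 2)" by (rule less_le_trans[rotated])
  moreover have "(2 * j + 5) choose (j + 2) = (2 * j + 5) choose (j + 3)"
    using binomial_symmetric[of "j + 2" "2 * j + 5"] by (simp add: numeral_eq_Suc)
  moreover have "2 * k + 1 = 2 * j + 9" "2 * k - 3 = 2 * j + 5" "k - 1 = j + 3" by (simp_all add: k)
  ultimately show ?thesis by metis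
qed

section \<open>Dominated points, small sides and small degrees\<close>

lemma rep_if_dominating_pair:
  assumes k: "3 \<le> k" and fin: "finite P" "finite Q" and card: "card P = 2 * k" "card Q = 2 * k"
    and zc: "z \<in> P" "c \<in> P" "z \<noteq> c" and dom: "\<And>b. b \<in> Q \<Longrightarrow> N z b \<Longrightarrow> N c b"
  shows "rep k P Q N"
proof -
  define R where "R = P - {z, c}"
  define tr where "tr b = {a\<in>R. N a b}" for b
  have finR: "finite R" and cR: "card R = 2 * k - 2" using zc card fin by (simp_all add: R_def card_Diff_subset)
  have dominated: "rep k P Q N" if "X \<subseteq> R" "card X = k - 1"
    "(\<forall>b\<in>Q. N c b \<longrightarrow> (\<exists>a\<in>R. N a b)) \<or> (\<forall>b\<in>Q. {a\<in>R. N a b} \<noteq> X)" for X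
    by (rule rep_if_dominated[where X = X, OF k fin card(1) zc]) (use that dom R_def in blast)+
  show ?thesis
  proof (cases "\<exists>b\<in>Q. tr b = {}")
    case False
    have "k - 1 \<le> card R" using cR by linarith
    then obtain X where "X \<subseteq> R" "card X = k - 1" by (rule obtain_subset_with_card_n)
    then show ?thesis using False by (intro dominated[of X]) (auto simp: tr_def)
  next
    case True
    then obtain b0 where b0: "b0 \<in> Q" "tr b0 = {}" by blast
    \<comment> \<open>An empty trace never equals \<open>X\<close>. Discounting this one letter is
      what makes the count succeed at \<open>k = 3\<close>.\<close>
    have "card (tr ` (Q - {b0})) \<le> 2 * k - 1"
      using card_image_le[of "Q - {b0}" tr] fin b0 card by simp
    then have "card (tr ` (Q - {b0})) < card R choose (k - 1)"
      using central_binomial_bound[OF k] unfolding cR by linarith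
    then obtain X where X: "X \<subseteq> R" "card X = k - 1" "X \<notin> tr ` (Q - {b0})"
      using fresh_subset[OF finR finite_imageI[OF finite_Diff[OF fin(2)]]] by blast
    have "tr b \<noteq> X" if "b \<in> Q" for b
      using X b0 k that by (cases "b = b0") auto
    then show ?thesis using X by (intro dominated[of X]) (auto simp: tr_def)
  qed
qed

text \<open>A padding point has no nonneighbours, so it is dominated by any \<open>c\<close>. As
  \<open>Q\<close> may now exceed \<open>2 * k\<close>, counting traces alone does not suffice; but
  if no \<open>c\<close> satisfies the first alternative of \<open>rep_if_dominated\<close>, every
  \<open>c\<close> owns a letter with no other point, and few letters with larger traces are
  left.\<close>

lemma rep_if_small_part:
  fixes P :: "'p set" and Q :: "'q set"
  assumes k: "3 \<le> k" and fin: "finite P" "finite Q" and card: "card P < 2 * k" "card P + card Q \<le> 4 * k"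
  shows "rep k P Q N"
proof -
  define P' :: "('p + nat) set" where "P' = P <+> {..<2 * k - card P}"
  define N' :: "'p + nat \<Rightarrow> 'q \<Rightarrow> bool" where "N' x b = (case x of Inl a \<Rightarrow> N a b | Inr _ \<Rightarrow> False)" for x b
  have finP': "finite P'" and cP': "card P' = 2 * k" using fin card by (simp_all add: P'_def card_Plus)
  have N': "N' (Inl a) b = N a b" "\<not> N' (Inr i) b" for a i b by (simp_all add: N'_def)
  have z: "Inr 0 \<in> P'" using card(1) by (auto simp: P'_def)
  have "rep k P' Q N'"
  proof (cases "\<exists>c\<in>P'. c \<noteq> Inr 0 \<and> (\<forall>b\<in>Q. N' c b \<longrightarrow> (\<exists>a\<in>P' - {Inr 0, c}. N' a b))")
    case True
    then obtain c where c: "c \<in> P'" "c \<noteq> Inr 0" "\<forall>b\<in>Q. N' c b \<longrightarrow> (\<exists>a\<in>P' - {Inr 0, c}. N' a b)" by blast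
    have "card (P' - {Inr 0, c}) = 2 * k - 2" using z c finP' cP' by (simp add: card_Diff_subset)
    then have "k - 1 \<le> card (P' - {Inr 0, c})" by linarith
    then obtain X where X: "X \<subseteq> P' - {Inr 0, c}" "card X = k - 1" by (rule obtain_subset_with_card_n)
    show ?thesis
      by (rule rep_if_dominated[OF k finP' fin(2) cP' z c(1) c(2)[symmetric] _ X disjI1[OF c(3)]]) (simp add: N')
  next
    case False
    then have single: "\<exists>b\<in>Q. N' c b \<and> (\<forall>a\<in>P' - {Inr 0, c}. \<not> N' a b)" if "c \<in> P'" "c \<noteq> Inr 0" for c using that by blast
    \<comment> \<open>A second padding point could not own a letter.\<close>
    have "Inr 1 \<notin> P'" using single[of "Inr 1"] N'(2) by auto
    then have cP: "card P = 2 * k - 1" using card(1) by (auto simp: P'_def)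
    obtain f where f: "\<And>a. a \<in> P \<Longrightarrow> f a \<in> Q \<and> N a (f a) \<and> (\<forall>a'\<in>P - {a}. \<not> N a' (f a))"
    proof -
      have "\<exists>b\<in>Q. N a b \<and> (\<forall>a'\<in>P - {a}. \<not> N a' b)" if "a \<in> P" for a
        using single[of "Inl a"] that N'(1) by (force simp: P'_def)
      then show ?thesis using that by metis
    qed
    have inj: "inj_on f P" using f by (intro inj_onI) (metis DiffI singletonD)
    have fQ: "f ` P \<subseteq> Q" using f by blast
    \<comment> \<open>There are at most \<open>2 * k + 1\<close> letters, and
      \<open>2 * k - 1\<close> of them are owned.\<close>
    have cF: "card (Q - f ` P) \<le> 2"
      using card_Diff_subset[OF finite_imageI[OF fin(1)] fQ] card_image[OF inj] cP card(2) by linarith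
    have "P \<noteq> {}" using cP k by auto
    then obtain c0 where "c0 \<in> P" by blast
    then have c: "Inl c0 \<in> P'" "Inr 0 \<noteq> (Inl c0 :: 'p + nat)" by (auto simp: P'_def)
    define R where "R = P' - {Inr 0, Inl c0}"
    define tr where "tr b = {a\<in>R. N' a b}" for b
    have finR: "finite R" and cR: "card R = 2 * k - 2" using z c finP' cP' by (simp_all add: R_def card_Diff_subset)
    have "card (tr ` (Q - f ` P)) \<le> 2" using card_image_le[of "Q - f ` P" tr] cF fin by simp
    then have less: "card (tr ` (Q - f ` P)) < card R choose (k - 1)"
      using central_binomial_bound[OF k] k unfolding cR by linarith
    obtain X where X: "X \<subseteq> R" "card X = k - 1" "X \<notin> tr ` (Q - f ` P)"
      using fresh_subset[OF finR finite_imageI[OF finite_Diff[OF fin(2)]] less] by blast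
    have "tr b \<noteq> X" if b: "b \<in> Q" for b
    proof (cases "b \<in> f ` P")
      case True
      then obtain a where a: "a \<in> P" "b = f a" by blast
      have "tr b \<subseteq> {Inl a}" using f[OF a(1)] N' a(2) by (auto simp: tr_def R_def P'_def)
      then have "card (tr b) \<le> 1" using card_mono[of "{Inl a}" "tr b"] by simp
      then show ?thesis using X(2) k by auto
    qed (use X(3) b in blast)
    then have "\<forall>b\<in>Q. {a\<in>P' - {Inr 0, Inl c0}. N' a b} \<noteq> X" by (simp add: tr_def R_def)
    then show ?thesis
      by (intro rep_if_dominated[OF k finP' fin(2) cP' z c _ X(1)[unfolded R_def] X(2) disjI2]) (simp_all add: N')
  qed
  then have "rep k (Inl ` P) Q N'" by (rule rep_subset) (auto simp: P'_def)
  moreover have "inj_on projl (Inl ` P :: ('p + nat) set)" by (auto intro: inj_onI)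
  ultimately have "rep k (projl ` (Inl ` P :: ('p + nat) set)) (id ` Q) N"
    using inj_on_id by (rule rep_reindex) (auto simp: N'_def)
  then show ?thesis by (simp add: image_image)
qed

text \<open>\<open>c\<close> and \<open>p\<close> are points that separate \<open>b0\<close> and
  \<open>b1\<close>, so that \<open>b0\<close> is the only exceptional letter and contains
  \<open>p\<close>.\<close>

lemma rep_if_degree_two:
  assumes k: "4 \<le> k" and fin: "finite P" "finite Q" and card: "card P = 2 * k" "card Q = 2 * k"
    and ndB: "\<And>b b'. b \<in> Q \<Longrightarrow> b' \<in> Q \<Longrightarrow> b \<noteq> b' \<Longrightarrow> \<exists>a\<in>P. N a b \<and> \<not> N a b'"
    and z: "z \<in> P" "{b\<in>Q. N z b} = {b0, b1}" "b0 \<noteq> b1"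
  shows "rep k P Q N"
proof -
  have memD: "b \<in> Q \<and> N z b \<longleftrightarrow> b = b0 \<or> b = b1" for b using z(2) by auto
  have b01: "b0 \<in> Q" "b1 \<in> Q" "N z b0" "N z b1" using memD by auto
  obtain c where c: "c \<in> P" "N c b1" "\<not> N c b0" using ndB[OF b01(2,1)] z(3) by metis
  obtain p where p: "p \<in> P" "N p b0" "\<not> N p b1" using ndB[OF b01(1,2)] z(3) by metis
  have zcp: "z \<noteq> c" "z \<noteq> p" "c \<noteq> p" using c p b01 by auto
  have exc: "b = b0" if "b \<in> Q" "N z b" "\<not> N c b" for b using that memD c by metis
  define W where "W = P - {z, c, p}"
  have finW: "finite W" and cW: "card W = 2 * k - 3" using zcp z c p fin card by (simp_all add: W_def card_Diff_subset)
  \<comment> \<open>The complement of the trace of \<open>b0\<close> is forbidden too, because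
    \<open>Y\<close> would equal it if two different choices of \<open>y\<close> both
    failed.\<close>
  define F where "F = insert (W - {a\<in>W. N a b0}) ((\<lambda>b. {a\<in>W. N a b}) ` Q)"
  have "card F \<le> Suc (card ((\<lambda>b. {a\<in>W. N a b}) ` Q))" unfolding F_def by (rule card_insert_le_m1) simp_all
  then have "card F < card W choose (k - 1)"
    using odd_binomial_bound[OF k] card_image_le[OF fin(2), of "\<lambda>b. {a\<in>W. N a b}"] card(2) unfolding cW by linarith
  moreover have "finite F" using fin by (simp add: F_def)
  ultimately obtain Y where Y: "Y \<subseteq> W" "card Y = k - 1" "Y \<notin> F" using fresh_subset[OF finW] by blast
  have "2 \<le> card Y" using Y k by simp
  then obtain y y' where y: "y \<in> Y" "y' \<in> Y" "y \<noteq> y'" using ex_two by blast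
  have "\<exists>y\<in>Y. {a\<in>W - {y}. N a b0} \<noteq> W - Y"
  proof (rule ccontr)
    assume "\<not> ?thesis"
    then have *: "{a\<in>W - {y}. N a b0} = W - Y" "{a\<in>W - {y'}. N a b0} = W - Y" using y by blast+
    have "N a b0 \<longleftrightarrow> a \<notin> Y" if "a \<in> W" for a
    proof (cases "a = y")
      case True then show ?thesis using *(2) that y by blast
    next
      case False then show ?thesis using *(1) that by blast
    qed
    then have "W - {a\<in>W. N a b0} = Y" using Y(1) by blast
    then show False using Y(3) by (simp add: F_def)
  qed
  then obtain y where y: "y \<in> Y" "{a\<in>W - {y}. N a b0} \<noteq> W - Y" by blast
  show ?thesis
  proof (rule rep_if_exceptional[OF k fin card(1) z(1) c(1) p(1) zcp _ W_def Y(1,2) y(1)])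
    show "N p b" if "b \<in> Q" "N z b" "\<not> N c b" for b using exc[OF that] p by simp
    show "{a\<in>W. N a b} \<noteq> Y" if "b \<in> Q" for b using Y(3) that by (auto simp: F_def)
    show "{a\<in>W - {y}. N a b} \<noteq> W - Y" if "b \<in> Q" "N z b" "\<not> N c b" for b using exc[OF that] y(2) by simp
  qed
qed

lemma rep_if_two_isolated_edges:
  assumes k: "3 \<le> k" and fin: "finite P" "finite Q" and card: "card P = 2 * k" "card Q = 2 * k"
    and zu: "z \<in> P" "u \<in> P" "z \<noteq> u"
    and single: "\<And>b a. b \<in> Q \<Longrightarrow> a \<in> P \<Longrightarrow> N a b \<Longrightarrow> N z b \<Longrightarrow> a = z" "\<And>b a. b \<in> Q \<Longrightarrow> a \<in> P \<Longrightarrow> N a b \<Longrightarrow> N u b \<Longrightarrow> a = u"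
    and size: "\<And>b. b \<in> Q \<Longrightarrow> card {a\<in>P. N a b} \<noteq> 2"
  shows "rep k P Q N"
proof -
  define R where "R = P - {z, u}"
  define tr where "tr b = {a\<in>R. N a b}" for b
  have finR: "finite R" and cR: "card R = 2 * k - 2" using zu card fin by (simp_all add: R_def card_Diff_subset)
  have "\<exists>X\<subseteq>R. card X = k - 1 \<and> (\<forall>b\<in>Q. tr b \<noteq> X \<and> tr b \<noteq> R - X)"
  proof (cases "k = 3")
    case True
    \<comment> \<open>A letter at \<open>z\<close> or \<open>u\<close> has empty trace, any other
      letter has all its points in \<open>R\<close>. So no trace has two elements, while
      \<open>X\<close> and its complement in \<open>R\<close> both do.\<close>
    have trc: "card (tr b) \<noteq> 2" if b: "b \<in> Q" for b
    proof (cases "N z b \<or> N u b")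
      case True
      then have "tr b = {}" using single[OF b] by (auto simp: tr_def R_def)
      then show ?thesis by simp
    next
      case False
      then have "tr b = {a\<in>P. N a b}" by (auto simp: tr_def R_def)
      then show ?thesis using size[OF b] by simp
    qed
    obtain X where X: "X \<subseteq> R" "card X = 2" using obtain_subset_with_card_n[of 2 R] cR True by auto
    moreover have "card (R - X) = 2" using X cR True finR by (simp add: card_Diff_subset finite_subset)
    ultimately have "tr b \<noteq> X \<and> tr b \<noteq> R - X" if "b \<in> Q" for b using trc[OF that] by metis
    then show ?thesis using X True by (intro exI[of _ X]) simp
  next
    case False
    define F where "F = tr ` Q \<union> (\<lambda>b. R - tr b) ` Q"
    have "card F \<le> card Q + card Q"
      unfolding F_def using card_Un_le card_image_le[OF fin(2)] by (meson add_mono le_trans)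
    then have "card F < card R choose (k - 1)"
      using central_binomial_bound_strong[of k] k False card(2) unfolding cR by simp
    moreover have "finite F" using fin by (simp add: F_def)
    ultimately obtain X where X: "X \<subseteq> R" "card X = k - 1" "X \<notin> F" using fresh_subset[OF finR] by blast
    have "tr b \<noteq> X \<and> tr b \<noteq> R - X" if "b \<in> Q" for b
    proof -
      have "tr b \<noteq> X" "R - tr b \<noteq> X" using X(3) that unfolding F_def by blast+
      then show ?thesis using X(1) by (metis double_diff subset_refl)
    qed
    then show ?thesis using X by blast
  qed
  then obtain X where X: "X \<subseteq> R" "card X = k - 1" "\<And>b. b \<in> Q \<Longrightarrow> tr b \<noteq> X" "\<And>b. b \<in> Q \<Longrightarrow> tr b \<noteq> R - X" by blast
  show ?thesis
    by (rule rep_if_two_isolated[OF k fin card(1) zu single X(1,2)[unfolded R_def] X(3,4)[unfolded tr_def R_def]])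
qed

lemma rep_if_few_isolated_edges:
  assumes k: "3 \<le> k" and fin: "finite P" "finite Q" and card: "card P = 2 * k" "card Q = 2 * k"
    and ndB: "\<And>b b'. b \<in> Q \<Longrightarrow> b' \<in> Q \<Longrightarrow> b \<noteq> b' \<Longrightarrow> \<exists>a\<in>P. N a b \<and> \<not> N a b'"
    and size: "\<And>b. b \<in> Q \<Longrightarrow> card {a\<in>P. N a b} \<noteq> 2" "\<And>b. k = 3 \<Longrightarrow> b \<in> Q \<Longrightarrow> card {a\<in>P. N a b} \<noteq> 3"
    and S: "S = {a\<in>P. \<exists>b\<in>Q. {a'\<in>P. N a' b} = {a}}" "card S \<le> 1"
  shows "rep k P Q N"
proof -
  define T where "T b = {a\<in>P. N a b}" for b
  have finT: "finite (T b)" and TP: "T b \<subseteq> P" for b using fin by (auto simp: T_def)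
  have SP: "S \<subseteq> P" "finite S" using fin S(1) by auto
  have T_cases: "(\<exists>a\<in>S. T b = {a}) \<or> 3 \<le> card (T b)" if b: "b \<in> Q" for b
  proof -
    have "1 \<le> card (Q - {b})" using card fin b k by simp
    then obtain b' where "b' \<in> Q" "b \<noteq> b'" by (metis DiffE card.empty equals0I insertI1 not_one_le_zero)
    then have "T b \<noteq> {}" using ndB[OF b] by (auto simp: T_def)
    then have "card (T b) \<noteq> 0" using finT by simp
    moreover have "\<exists>a\<in>S. T b = {a}" if one: "card (T b) = 1"
    proof -
      obtain a where "T b = {a}" using one by (auto simp: card_1_singleton_iff)
      moreover from this have "a \<in> S" using TP b unfolding S(1) T_def by blast
      ultimately show ?thesis by blast
    qed
    ultimately show ?thesis using size(1)[OF b] unfolding T_def by linarith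
  qed
  have "\<exists>Y0\<subseteq>P. S \<subseteq> Y0 \<and> card Y0 \<le> k \<and> (\<forall>b\<in>Q. 4 \<le> card (T b) \<and> k = 3 \<or> T b \<inter> Y0 \<noteq> {})"
  proof (cases "k = 3")
    case True
    \<comment> \<open>Any three of the six points meet a set of four, so only the singleton letters
      need care.\<close>
    have "T b \<inter> S \<noteq> {} \<or> 4 \<le> card (T b)" if "b \<in> Q" for b
      using T_cases[OF that] size(2)[OF True that] by (fold T_def) fastforce
    then show ?thesis using SP S(2) True by (intro exI[of _ S]) auto
  next
    case False
    define E where "E = T ` {b\<in>Q. 3 \<le> card (T b)}"
    have E: "e \<subseteq> P - S \<and> 3 \<le> card e" if e: "e \<in> E" for e
    proof -
      obtain b where b: "b \<in> Q" "e = T b" "3 \<le> card (T b)" using e by (auto simp: E_def)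
      \<comment> \<open>A point with a singleton letter lies in no other letter, which would
        dominate the singleton.\<close>
      have "a \<notin> S" if a: "a \<in> T b" for a
      proof
        assume "a \<in> S"
        then obtain b' where b': "b' \<in> Q" "T b' = {a}" by (auto simp: S(1) T_def)
        have "b' \<noteq> b" using b' b by auto
        then obtain a' where "a' \<in> P" "N a' b'" "\<not> N a' b" using ndB[OF b'(1) b(1)] by blast
        then show False using b'(2) a by (auto simp: T_def)
      qed
      then show ?thesis using b TP by blast
    qed
    have finE: "finite E" "finite (P - S)" using fin by (simp_all add: E_def)
    obtain S' where S': "S' \<subseteq> P - S" "\<And>e. e \<in> E \<Longrightarrow> S' \<inter> e \<noteq> {}" "4 * card S' \<le> card (P - S) + card E"
      using small_hitting_set[OF finE(2,1) E] by blast
    have cPS: "card (P - S) = 2 * k - card S" using card SP by (simp add: card_Diff_subset)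
    \<comment> \<open>A point in \<open>S\<close> removes one vertex and one edge, so the hitting
      set then has at most \<open>k - 1\<close> points and leaves room for it.\<close>
    have "card E \<le> 2 * k - card S"
    proof (cases "S = {}")
      case True
      have "card {b\<in>Q. 3 \<le> card (T b)} \<le> card Q" using fin by (intro card_mono) auto
      then show ?thesis unfolding E_def using card_image_le[of "{b\<in>Q. 3 \<le> card (T b)}" T] True card fin by simp
    next
      case False
      then obtain a b where a: "a \<in> S" "b \<in> Q" "T b = {a}" by (auto simp: S(1) T_def)
      have "card {b\<in>Q. 3 \<le> card (T b)} \<le> card (Q - {b})" using fin a by (intro card_mono) auto
      moreover have "card (Q - {b}) = 2 * k - 1" using fin a card by simp
      moreover have "card S = 1" using S(2) False SP(2) by (simp add: le_Suc_eq)
      ultimately show ?thesis unfolding E_def using card_image_le[of "{b\<in>Q. 3 \<le> card (T b)}" T] fin by simp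
    qed
    then have "card S' + card S \<le> k" using S'(3) cPS S(2) k by arith
    moreover have "card (S' \<union> S) \<le> card S' + card S" by (rule card_Un_le)
    ultimately have "card (S' \<union> S) \<le> k" by linarith
    moreover have "T b \<inter> (S' \<union> S) \<noteq> {}" if "b \<in> Q" for b
    proof (cases "3 \<le> card (T b)")
      case True then show ?thesis using S'(2)[of "T b"] that by (auto simp: E_def)
    next
      case False then show ?thesis using T_cases[OF that] by auto
    qed
    ultimately show ?thesis using S'(1) SP by (intro exI[of _ "S' \<union> S"]) auto
  qed
  then obtain Y0 where Y0: "Y0 \<subseteq> P" "card Y0 \<le> k" "\<And>b. b \<in> Q \<Longrightarrow> 4 \<le> card (T b) \<and> k = 3 \<or> T b \<inter> Y0 \<noteq> {}" by blast
  have "k \<le> card P" using card by simp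
  then obtain Y where Y: "Y0 \<subseteq> Y" "Y \<subseteq> P" "card Y = k"
    using exists_subset_between[OF Y0(2) _ Y0(1) fin(1)] by blast
  have hit: "\<exists>a\<in>Y. N a b" if b: "b \<in> Q" for b
  proof (cases "T b \<inter> Y = {}")
    case True
    then have "4 \<le> card (T b)" "k = 3" using Y0(3)[OF b] Y(1) by blast+
    moreover have "card (T b) + card Y \<le> card P"
      using card_mono[of P "T b \<union> Y"] card_Un_disjoint[OF finT finite_subset[OF Y(2) fin(1)] True] TP Y(2) fin(1) by simp
    ultimately show ?thesis using Y(3) card by simp
  qed (auto simp: T_def)
  show ?thesis by (rule rep_if_hit[OF k fin card(1) Y(2,3) hit size])
qed

section \<open>The case distinction and the bound\<close>

lemma rep_if_card_two:
  assumes k: "3 \<le> k" and fin: "finite P" "finite Q" and card: "card P = 2 * k" "card Q = 2 * k"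
    and ndA: "\<And>a a'. a \<in> P \<Longrightarrow> a' \<in> P \<Longrightarrow> a \<noteq> a' \<Longrightarrow> \<exists>b\<in>Q. N a b \<and> \<not> N a' b"
    and ndB: "\<And>b b'. b \<in> Q \<Longrightarrow> b' \<in> Q \<Longrightarrow> b \<noteq> b' \<Longrightarrow> \<exists>a\<in>P. N a b \<and> \<not> N a b'"
    and z: "z \<in> P" "card {b\<in>Q. N z b} = 2"
  shows "rep k P Q N"
proof -
  obtain b0 b1 where b: "{b\<in>Q. N z b} = {b0, b1}" "b0 \<noteq> b1" using z(2) by (auto simp: card_2_iff)
  show ?thesis
  proof (cases "k = 3")
    case True
    show ?thesis
    proof (cases "card {a\<in>P. N a b0} \<le> card {a\<in>P. N a b1}")
      case le: True
      show ?thesis unfolding True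
        by (rule rep_three_degree_two[where N = N and z = z, OF fin _ _ _ _ z(1) b le]) (simp_all add: card True ndA ndB b(2))
    next
      case False
      then have le: "card {a\<in>P. N a b1} \<le> card {a\<in>P. N a b0}" by simp
      have b': "{b\<in>Q. N z b} = {b1, b0}" "b1 \<noteq> b0" using b by auto
      show ?thesis unfolding True
        by (rule rep_three_degree_two[where N = N and z = z, OF fin _ _ _ _ z(1) b' le]) (simp_all add: card True ndA ndB b(2))
    qed
  next
    case False
    then have k4: "4 \<le> k" using k by simp
    show ?thesis 
      by (rule rep_if_degree_two[where N = N and z = z and ?b0.0 = b0 and ?b1.0 = b1])
        (rule k4 fin card z(1) b ndB; assumption)+
  qed
qed

lemma rep_if_nondominated:
  assumes k: "3 \<le> k" and fin: "finite P" "finite Q" and card: "card P = 2 * k" "card Q = 2 * k"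
    and ndA: "\<And>a a'. a \<in> P \<Longrightarrow> a' \<in> P \<Longrightarrow> a \<noteq> a' \<Longrightarrow> \<exists>b\<in>Q. N a b \<and> \<not> N a' b"
    and ndB: "\<And>b b'. b \<in> Q \<Longrightarrow> b' \<in> Q \<Longrightarrow> b \<noteq> b' \<Longrightarrow> \<exists>a\<in>P. N a b \<and> \<not> N a b'"
  shows "rep k P Q N"
proof -
  show ?thesis
  proof (cases "\<exists>b\<in>Q. card {a\<in>P. N a b} = 2")
    case True
    then obtain b where b: "b \<in> Q" "card {a\<in>P. N a b} = 2" by blast
    have "rep k Q P (\<lambda>b a. N a b)"
      by (rule rep_if_card_two[where N = "\<lambda>b a. N a b" and z = b, OF k fin(2,1) card(2,1) _ _ b]) (use ndA ndB in blast)+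
    then show ?thesis by (rule rep_swap)
  next
    case no2: False
    show ?thesis
    proof (cases "\<exists>a\<in>P. card {b\<in>Q. N a b} = 2")
      case True
      then obtain a where a: "a \<in> P" "card {b\<in>Q. N a b} = 2" by blast
      show ?thesis by (rule rep_if_card_two[where N = N and z = a, OF k fin card _ _ a]) (use ndA ndB in blast)+
    next
      case no2': False
      define S where "S = {a\<in>P. \<exists>b\<in>Q. {a'\<in>P. N a' b} = {a}}"
      have finS: "finite S" using fin by (simp add: S_def)
      \<comment> \<open>Two different letters containing \<open>z\<close>, one of them a singleton,
        would contradict nondomination; so points of \<open>S\<close> are ends of isolated edges of
        \<open>N\<close>.\<close>
      have S_single: "a = z" if S: "z \<in> S" "b \<in> Q" "a \<in> P" "N a b" "N z b" for a b z
      proof -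
        obtain b' where b': "b' \<in> Q" "{a'\<in>P. N a' b'} = {z}" using S(1) by (auto simp: S_def)
        have "b' = b"
        proof (rule ccontr)
          assume "b' \<noteq> b"
          then obtain a' where a': "a' \<in> P" "N a' b'" "\<not> N a' b" using ndB[OF b'(1) S(2)] by blast
          then have "a' \<in> {a'\<in>P. N a' b'}" by simp
          then show False unfolding b'(2) using a'(3) S(5) by simp
        qed
        then show ?thesis using b'(2) S by blast
      qed
      show ?thesis
      proof (cases "card S \<le> 1")
        case False
        then have "2 \<le> card S" by simp
        then obtain z u where zu: "z \<in> S" "u \<in> S" "z \<noteq> u" using ex_two by blast
        then have zu': "z \<in> P" "u \<in> P" by (auto simp: S_def)
        show ?thesis
        proof (rule rep_if_two_isolated_edges[OF k fin card zu' zu(3)])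
          show "a = z" if "b \<in> Q" "a \<in> P" "N a b" "N z b" for a b using S_single[OF zu(1) that] .
          show "a = u" if "b \<in> Q" "a \<in> P" "N a b" "N u b" for a b using S_single[OF zu(2) that] .
        qed (use no2 in blast)
      next
        case S1: True
        show ?thesis
        proof (cases "k = 3 \<and> (\<exists>b\<in>Q. card {a\<in>P. N a b} = 3)")
          case True
          then obtain b where b: "b \<in> Q" "card {a\<in>P. N a b} = 3" by blast
          have "rep 3 Q P (\<lambda>b a. N a b)"
            by (rule rep_three_degree_three[where N = "\<lambda>b a. N a b", OF fin(2,1) _ _ _ _ _ b]) (use True card ndA ndB no2' in \<open>(simp; fail) | blast\<close>)+
          then show ?thesis using rep_swap True by blast
        next
          case False
          show ?thesis by (rule rep_if_few_isolated_edges[OF k fin card ndB _ _ S_def S1]) (use no2 False in blast)+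
        qed
      qed
    qed
  qed
qed

lemma rep_if_card_le:
  assumes k: "3 \<le> k" and fin: "finite P" "finite Q" and card: "card P + card Q \<le> 4 * k"
  shows "rep k P Q N"
proof -
  consider "card P < 2 * k" | "card Q < 2 * k" | "card P = 2 * k" "card Q = 2 * k" using card by linarith
  then show ?thesis
  proof cases
    case 1 then show ?thesis using rep_if_small_part[OF k fin] card by blast
  next
    case 2
    then have "rep k Q P (\<lambda>b a. N a b)" using card by (intro rep_if_small_part[OF k fin(2,1)]) auto
    then show ?thesis by (rule rep_swap)
  next
    case 3
    show ?thesis
    proof (cases "\<exists>a\<in>P. \<exists>a'\<in>P. a \<noteq> a' \<and> (\<forall>b\<in>Q. N a b \<longrightarrow> N a' b)")
      case True
      then obtain a a' where a: "a \<in> P" "a' \<in> P" "a \<noteq> a'" "\<forall>b\<in>Q. N a b \<longrightarrow> N a' b" by blast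
      show ?thesis by (rule rep_if_dominating_pair[OF k fin 3 a(1-3)]) (use a(4) in blast)
    next
      case ndA: False
      show ?thesis
      proof (cases "\<exists>b\<in>Q. \<exists>b'\<in>Q. b \<noteq> b' \<and> (\<forall>a\<in>P. N a b \<longrightarrow> N a b')")
        case True
        then obtain b b' where b: "b \<in> Q" "b' \<in> Q" "b \<noteq> b'" "\<forall>a\<in>P. N a b \<longrightarrow> N a b'" by blast
        have "rep k Q P (\<lambda>b a. N a b)"
          by (rule rep_if_dominating_pair[OF k fin(2,1) 3(2,1) b(1-3)]) (use b(4) in blast)
        then show ?thesis by (rule rep_swap)
      next
        case False
        with ndA show ?thesis by (intro rep_if_nondominated[OF k fin 3]) blast+
      qed
    qed
  qed
qed

theorem theorem1p1:
  fixes G :: "'a pair_pre_digraph"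
  assumes "pair_graph G"
    and "bipartite G"
    and "card (pverts G) \<ge> 9"
  shows "int (representation_number G) \<le> \<lceil>real (card (pverts G)) / 4\<rceil>"
proof -
  interpret pair_graph G by fact
  define k where "k = nat \<lceil>real (card (pverts G)) / 4\<rceil>"
  have k_int: "int k = \<lceil>real (card (pverts G)) / 4\<rceil>" by (simp add: k_def)
  \<comment> \<open>The ceiling of 9/4 is 3, the number of zones from which the construction
    works.\<close>
  have k: "3 \<le> k" "card (pverts G) \<le> 4 * k" using assms(3) k_int by linarith+
  obtain A B where AB: "pverts G = A \<union> B" "A \<inter> B = {}"
    "\<forall>(u, v)\<in>parcs G. u \<in> A \<and> v \<in> B \<or> u \<in> B \<and> v \<in> A"
    using assms(2) unfolding bipartite_def by (elim exE conjE)
  have fin: "finite A" "finite B" using pair_finite_verts AB(1) by auto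
  have sym: "(v, u) \<in> parcs G" if "(u, v) \<in> parcs G" for u v
    using that sym_arcs by (auto simp: symmetric_def arcs_ends_conv sym_def)
  have "rep k A B (\<lambda>a b. (a, b) \<notin> parcs G)"
    using k AB fin by (intro rep_if_card_le) (simp_all add: card_Un_disjoint)
  then have "\<exists>w. uniform_representation G k w"
    by (rule uniform_representation_if_rep[OF _ AB(1,2)]) (use AB(2,3) sym in blast)+
  then have "representable k G" using k by (auto simp: representable_def)
  then have "representation_number G \<le> k" unfolding representation_number_def by (rule Least_le)
  then show ?thesis using k_int by simp
qed

end
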